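(* Let $D$ be a $\mathbb{C}$-proper convex domain in $\mathbb{C}^d$ such that $(D,K_D)$ is Gromov hyperbolic, and let $f,g:D\to D$ be commuting holomorphic maps. Suppose that $f$ and $g$ have no fixed points in $D$ and let $p_f\in\overline{D}^{\star}\setminus D$ (resp. $p_g\in\overline{D}^{\star}\setminus D$) be the Denjoy–Wolff point of $f$ (resp. of $g$). Then either $p_f=p_g$, or there exists a holomorphic retract $M$ of $D$, of complex dimension $1\le k\le d$, such that $p_f,p_g\in\overline{M}^{\star}\setminus M$, $f(M)=g(M)=M$ and $f|_M,\,g|_M\in\mathrm{Aut}(M)$.
   Context: A convex domain in $\mathbb{C}^d$ is $\mathbb{C}$-proper if it contains no complex affine line. $K_D$ is the Kobayashi distance of $D$; for a $\mathbb{C}$-proper convex domain, $(D,K_D)$ is a proper geodesic metric space. A proper geodesic metric space is Gromov hyperbolic if there is $\delta\ge0$ such that in every geodesic triangle each side lies in the $\delta$-neighborhood of the union of the other two sides. $\overline{D}\subset\mathbb{C}^d$ is the Euclidean closure of $D$ (not assumed bounded) and $\overline{D}^{\star}$ is the end (Freudenthal) compactification of $\overline{D}$: for an exhaustion $K_0\subset K_1\subset\cdots$ of $\overline{D}$ by compact sets (each contained in the interior, relative to $\overline{D}$, of the next), an end is a decreasing sequence $U_0\supset U_1\supset\cdots$ with $U_n$ a connected component of $\overline{D}\setminus K_n$, and an end $(U_j)$ has neighborhood basis $U_k\cup\{(V_j) \text{ end}: V_j=U_j \text{ for } j\le k\}$, $k\ge0$. If $D$ is bounded, $\overline{D}^{\star}=\overline{D}$.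 For $M\subset D$, $\overline{M}^{\star}$ denotes the closure of $M$ in $\overline{D}^{\star}$. Denjoy–Wolff point: for $D$ as in the claim and $f:D\to D$ holomorphic without fixed points in $D$, there is a unique $p_f\in\overline{D}^{\star}\setminus D$ such that the iterates satisfy $f^n(x)\to p_f$ in $\overline{D}^{\star}$ for all $x\in D$, uniformly on compact subsets; it is called the Denjoy–Wolff point of $f$. A holomorphic retract of $D$ is the image $\rho(D)$ of a holomorphic map $\rho:D\to D$ with $\rho\circ\rho=\rho$ (it is a closed complex submanifold of $D$). $\mathrm{Aut}(M)$ is the group of biholomorphic self-maps of $M$. *)

theory Defs
  imports "HOL-Complex_Analysis.Complex_Analysis"
begin

section \<open>Holomorphic maps of several variables\<close>

text \<open>For open \<open>S\<close>: complex differentiability, i.e. the real Frechet derivative exists and is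
  complex linear.\<close>

definition holomorphic_map_on :: "(complex^'m \<Rightarrow> complex^'n) \<Rightarrow> (complex^'m) set \<Rightarrow> bool" where
  "holomorphic_map_on f S \<longleftrightarrow>
     (\<forall>x\<in>S. \<exists>f'. (f has_derivative f') (at x) \<and> Vector_Spaces.linear (*s) (*s) f')"

definition analytic_disc :: "(complex^'d) set \<Rightarrow> (complex \<Rightarrow> complex^'d) \<Rightarrow> bool" where
  "analytic_disc D \<phi> \<longleftrightarrow>
     (\<forall>i. (\<lambda>z. \<phi> z $ i) holomorphic_on ball 0 1) \<and> \<phi> ` ball 0 1 \<subseteq> D"

definition contains_complex_line :: "(complex^'d) set \<Rightarrow> bool" where
  "contains_complex_line D \<longleftrightarrow> (\<exists>a v. v \<noteq> 0 \<and> (\<forall>z::complex. a + z *s v \<in> D))"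

definition complex_proper_convex_domain :: "(complex^'d) set \<Rightarrow> bool" where
  "complex_proper_convex_domain D \<longleftrightarrow>
     open D \<and> D \<noteq> {} \<and> convex D \<and> \<not> contains_complex_line D"


section \<open>The Kobayashi distance\<close>

text \<open>Poincare distance of the unit disc, normalised to curvature \<open>-4\<close>. Other normalisations only
  rescale the Kobayashi distance, which does not affect Gromov hyperbolicity.\<close>

definition poincare_dist :: "complex \<Rightarrow> complex \<Rightarrow> real" where
  "poincare_dist z w = artanh (cmod ((z - w) / (1 - cnj w * z)))"

text \<open>\<open>kobayashi_chain D x y m \<phi> a b\<close>: a chain of \<open>m \<ge> 1\<close> analytic discs in \<open>D\<close> joining \<open>x\<close> to \<open>y\<close>,
  the \<open>i\<close>-th disc leading from \<open>\<phi> i (a i)\<close> to \<open>\<phi> i (b i)\<close>.\<close>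

definition kobayashi_chain ::
  "(complex^'d) set \<Rightarrow> complex^'d \<Rightarrow> complex^'d \<Rightarrow> nat \<Rightarrow>
   (nat \<Rightarrow> complex \<Rightarrow> complex^'d) \<Rightarrow> (nat \<Rightarrow> complex) \<Rightarrow> (nat \<Rightarrow> complex) \<Rightarrow> bool" where
  "kobayashi_chain D x y m \<phi> a b \<longleftrightarrow>
     m \<ge> 1 \<and>
     (\<forall>i<m. analytic_disc D (\<phi> i) \<and> a i \<in> ball 0 1 \<and> b i \<in> ball 0 1) \<and>
     \<phi> 0 (a 0) = x \<and> \<phi> (m - 1) (b (m - 1)) = y \<and>
     (\<forall>i. Suc i < m \<longrightarrow> \<phi> i (b i) = \<phi> (Suc i) (a (Suc i)))"

definition kobayashi_dist :: "(complex^'d) set \<Rightarrow> complex^'d \<Rightarrow> complex^'d \<Rightarrow> real" where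
  "kobayashi_dist D x y =
     Inf {\<Sum>i<m. poincare_dist (a i) (b i) | m \<phi> a b. kobayashi_chain D x y m \<phi> a b}"


section \<open>Gromov hyperbolicity\<close>

definition geodesic_segment :: "'a set \<Rightarrow> ('a \<Rightarrow> 'a \<Rightarrow> real) \<Rightarrow> 'a \<Rightarrow> 'a \<Rightarrow> 'a set \<Rightarrow> bool" where
  "geodesic_segment M d x y S \<longleftrightarrow>
     (\<exists>(\<gamma> :: real \<Rightarrow> 'a) L. L \<ge> 0 \<and> \<gamma> ` {0..L} \<subseteq> M \<and> \<gamma> 0 = x \<and> \<gamma> L = y \<and>
        (\<forall>s\<in>{0..L}. \<forall>t\<in>{0..L}. d (\<gamma> s) (\<gamma> t) = \<bar>s - t\<bar>) \<and> S = \<gamma> ` {0..L})"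

text \<open>Thin triangles. The notion is meant for proper geodesic metric spaces \<open>(M, d)\<close>; as a hypothesis
  it does not itself assert that \<open>(M, d)\<close> is one. Stating the condition for one side covers all three,
  since the vertices can be permuted cyclically.\<close>

definition gromov_hyperbolic :: "'a set \<Rightarrow> ('a \<Rightarrow> 'a \<Rightarrow> real) \<Rightarrow> bool" where
  "gromov_hyperbolic M d \<longleftrightarrow>
     (\<exists>\<delta>\<ge>0. \<forall>x y z A B C.
        geodesic_segment M d x y A \<and> geodesic_segment M d y z B \<and> geodesic_segment M d z x C \<longrightarrow>
        (\<forall>p\<in>A. \<exists>q\<in>B \<union> C. d p q \<le> \<delta>))"


section \<open>The end compactification\<close>

definition compact_exhaustion :: "'a::topological_space set \<Rightarrow> (nat \<Rightarrow> 'a set) \<Rightarrow> bool" where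
  "compact_exhaustion X K \<longleftrightarrow>
     (\<forall>n. compact (K n) \<and> K n \<subseteq> (top_of_set X) interior_of (K (Suc n))) \<and> (\<Union>n. K n) = X"

definition ends :: "'a::topological_space set \<Rightarrow> (nat \<Rightarrow> 'a set) \<Rightarrow> (nat \<Rightarrow> 'a set) set" where
  "ends X K = {U. (\<forall>n. U n \<in> components (X - K n)) \<and> decseq U}"

datatype 'a end_pt = Pt 'a | End "nat \<Rightarrow> 'a set"

definition end_nbhd ::
  "'a::topological_space set \<Rightarrow> (nat \<Rightarrow> 'a set) \<Rightarrow> (nat \<Rightarrow> 'a set) \<Rightarrow> nat \<Rightarrow> 'a end_pt set" where
  "end_nbhd X K U k = Pt ` U k \<union> End ` {V \<in> ends X K. \<forall>j\<le>k. V j = U j}"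

definition end_compactification ::
  "'a::topological_space set \<Rightarrow> (nat \<Rightarrow> 'a set) \<Rightarrow> 'a end_pt topology" where
  "end_compactification X K = topology (\<lambda>W.
     W \<subseteq> Pt ` X \<union> End ` ends X K \<and>
     openin (top_of_set X) (Pt -` W) \<and>
     (\<forall>U. End U \<in> W \<longrightarrow> (\<exists>k. end_nbhd X K U k \<subseteq> W)))"

lemma openin_end_compactification:
  "openin (end_compactification X K) W \<longleftrightarrow>
     W \<subseteq> Pt ` X \<union> End ` ends X K \<and>
     openin (top_of_set X) (Pt -` W) \<and>
     (\<forall>U. End U \<in> W \<longrightarrow> (\<exists>k. end_nbhd X K U k \<subseteq> W))" (is "_ \<longleftrightarrow> ?P W")
proof -
  have anti: "end_nbhd X K U k \<subseteq> end_nbhd X K U l" if "U \<in> ends X K" "l \<le> k" for U k l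
    using that by (fastforce simp: end_nbhd_def ends_def decseq_def)
  have "istopology ?P"
    unfolding istopology_def
  proof (intro conjI allI impI)
    fix S T assume S: "?P S" and T: "?P T"
    show "S \<inter> T \<subseteq> Pt ` X \<union> End ` ends X K" using S by blast
    show "openin (top_of_set X) (Pt -` (S \<inter> T))" using S T by (simp add: openin_Int)
    fix U assume U: "End U \<in> S \<inter> T"
    then obtain k l where "end_nbhd X K U k \<subseteq> S" "end_nbhd X K U l \<subseteq> T" using S T by blast
    moreover have "U \<in> ends X K" using U S by blast
    then have "end_nbhd X K U (max k l) \<subseteq> end_nbhd X K U k"
        "end_nbhd X K U (max k l) \<subseteq> end_nbhd X K U l"
      by (simp_all add: anti)
    ultimately show "\<exists>k. end_nbhd X K U k \<subseteq> S \<inter> T" by blast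
  next
    fix \<K> assume P: "\<forall>S\<in>\<K>. ?P S"
    show "\<Union>\<K> \<subseteq> Pt ` X \<union> End ` ends X K" using P by blast
    show "openin (top_of_set X) (Pt -` \<Union>\<K>)" using P by (auto simp: vimage_Union)
    fix U assume "End U \<in> \<Union>\<K>"
    then show "\<exists>k. end_nbhd X K U k \<subseteq> \<Union>\<K>" using P by (meson UnionE Sup_upper order_trans)
  qed
  then show ?thesis by (simp add: end_compactification_def topology_inverse')
qed

lemma topspace_end_compactification:
  "topspace (end_compactification X K) = Pt ` X \<union> End ` ends X K"
proof -
  have "Pt -` (Pt ` X \<union> End ` ends X K) = X" by auto
  moreover have "end_nbhd X K U 0 \<subseteq> Pt ` X \<union> End ` ends X K" if "U \<in> ends X K" for U
    using that in_components_subset[of "U 0" "X - K 0"] by (auto simp: end_nbhd_def ends_def)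
  ultimately have "openin (end_compactification X K) (Pt ` X \<union> End ` ends X K)"
    unfolding openin_end_compactification by (metis (no_types, lifting) UnE end_pt.distinct(1)
      end_pt.inject(2) imageE openin_subtopology_self subset_refl)
  then show ?thesis
    by (meson openin_end_compactification openin_subset openin_topspace subset_antisym)
qed

lemma compact_exhaustion_cball:
  fixes X :: "'a::heine_borel set"
  assumes "closed X"
  shows "compact_exhaustion X (\<lambda>n. X \<inter> cball a (real n))"
  unfolding compact_exhaustion_def
proof (intro conjI allI)
  fix n
  show "compact (X \<inter> cball a (real n))" using assms by (simp add: closed_Int_compact)
  have "X \<inter> ball a (real (Suc n)) \<subseteq> (top_of_set X) interior_of (X \<inter> cball a (real (Suc n)))"
    by (rule interior_of_maximal) (auto simp: openin_open)
  then show "X \<inter> cball a (real n) \<subseteq> (top_of_set X) interior_of (X \<inter> cball a (real (Suc n)))"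
    by force
next
  show "(\<Union>n. X \<inter> cball a (real n)) = X" by (auto simp: real_arch_simple)
qed


section \<open>Denjoy--Wolff points\<close>

text \<open>Convergence to the constant \<open>p\<close>, uniformly on a set \<open>C\<close>, is with respect to the unique uniformity
  of the compact Hausdorff space \<open>end_compactification (closure D) K\<close>: every neighbourhood of \<open>p\<close>
  eventually contains the images of \<open>C\<close>.\<close>

definition denjoy_wolff_point ::
  "(complex^'d) set \<Rightarrow> (nat \<Rightarrow> (complex^'d) set) \<Rightarrow> (complex^'d \<Rightarrow> complex^'d) \<Rightarrow>
   (complex^'d) end_pt \<Rightarrow> bool" where
  "denjoy_wolff_point D K f p \<longleftrightarrow>
     (let T = end_compactification (closure D) K in
        p \<in> topspace T - Pt ` D \<and>
        (\<forall>x\<in>D. limitin T (\<lambda>n. Pt ((f ^^ n) x)) p sequentially) \<and>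
        (\<forall>C W. compact C \<and> C \<subseteq> D \<and> openin T W \<and> p \<in> W \<longrightarrow>
           (\<forall>\<^sub>F n in sequentially. \<forall>x\<in>C. Pt ((f ^^ n) x) \<in> W)))"


section \<open>Holomorphic retracts and automorphisms\<close>

definition holomorphic_retract :: "(complex^'d) set \<Rightarrow> (complex^'d) set \<Rightarrow> bool" where
  "holomorphic_retract D M \<longleftrightarrow>
     (\<exists>\<rho>. holomorphic_map_on \<rho> D \<and> \<rho> ` D \<subseteq> D \<and> (\<forall>x\<in>D. \<rho> (\<rho> x) = \<rho> x) \<and> M = \<rho> ` D)"

text \<open>\<open>M\<close> is an embedded complex submanifold, all of whose components have complex dimension \<open>k\<close>: near
  each of its points, \<open>M\<close> is straightened by a biholomorphism \<open>\<phi>\<close> (with inverse \<open>\<psi>\<close>) to a coordinate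
  subspace with \<open>k\<close> free coordinates \<open>J\<close>.\<close>

definition complex_submanifold_of_dim :: "nat \<Rightarrow> (complex^'d) set \<Rightarrow> bool" where
  "complex_submanifold_of_dim k M \<longleftrightarrow>
     (\<forall>p\<in>M. \<exists>U V \<phi> \<psi>. \<exists>J :: 'd set.
        open U \<and> p \<in> U \<and> open V \<and> card J = k \<and>
        holomorphic_map_on \<phi> U \<and> holomorphic_map_on \<psi> V \<and>
        \<phi> ` U = V \<and> \<psi> ` V = U \<and> (\<forall>x\<in>U. \<psi> (\<phi> x) = x) \<and> (\<forall>y\<in>V. \<phi> (\<psi> y) = y) \<and>
        \<phi> ` (U \<inter> M) = {y \<in> V. \<forall>i. i \<notin> J \<longrightarrow> y $ i = 0})"

text \<open>A map on a submanifold is holomorphic iff it extends holomorphically to the ambient space near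
  each point.\<close>

definition holomorphic_on_submanifold ::
  "(complex^'d \<Rightarrow> complex^'d) \<Rightarrow> (complex^'d) set \<Rightarrow> bool" where
  "holomorphic_on_submanifold h M \<longleftrightarrow>
     (\<forall>p\<in>M. \<exists>U F. open U \<and> p \<in> U \<and> holomorphic_map_on F U \<and> (\<forall>x\<in>U \<inter> M. F x = h x))"

text \<open>\<open>h\<close> restricted to \<open>M\<close> belongs to \<open>Aut(M)\<close>; values of \<open>h\<close> off \<open>M\<close> are irrelevant.\<close>

definition restricts_to_automorphism ::
  "(complex^'d \<Rightarrow> complex^'d) \<Rightarrow> (complex^'d) set \<Rightarrow> bool" where
  "restricts_to_automorphism h M \<longleftrightarrow>
     bij_betw h M M \<and> holomorphic_on_submanifold h M \<and>
     holomorphic_on_submanifold (inv_into M h) M"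

end

theory Submission
  imports Defs
begin

text \<open>
  Write \<open>x\<^sub>n = f\<^sup>n p\<close> and \<open>y\<^sub>m = g\<^sup>m p\<close>, and let \<open>d\<close> be the Kobayashi distance. Distinct boundary points are
  visible to each other: a geodesic from \<open>x\<^sub>n\<close> to \<open>y\<^sub>m\<close> meets a fixed ball around \<open>p\<close> for large \<open>n\<close>
  and \<open>m\<close>. Since \<open>f\<^sup>n g\<^sup>m p\<close> has distance at most \<open>d p y\<^sub>m\<close> from \<open>x\<^sub>n\<close> and at most \<open>d p x\<^sub>n\<close> from
  \<open>y\<^sub>m\<close>, hyperbolicity gives \<open>d p (f\<^sup>n g\<^sup>m p) \<le> \<bar>d p x\<^sub>n - d p y\<^sub>m\<bar> + C\<close>. Both distances tend to
  infinity with bounded steps, so this stays bounded along suitable \<open>n, m \<rightarrow> \<infinity>\<close>, and a holomorphic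
  retraction \<open>G\<close> is found among the limits of the maps \<open>f\<^sup>n g\<^sup>m\<close>. On \<open>M = G ` D\<close> the inverses of \<open>f\<close>
  and \<open>g\<close> are again such limits, and the orbits of points of \<open>M\<close> stay in \<open>M\<close>.

  For the visibility, geodesics that leave every ball would lead, since straight segments are
  quasi-geodesics, to points near two distinct boundary points at bounded distance. By the
  half-plane lower bound for \<open>d\<close> the boundary then contains a complex disc, and moving to the edge of
  the maximal such face gives a contradiction. Points at infinity are reduced to this case by
  picking intermediate points on the geodesics.
\<close>

section \<open>Geodesic hyperbolic spaces\<close>

text \<open>Convexity gives two kinds of estimates for the distance. Lower bounds: the complex form
  \<open>hermitian a\<close> maps a half-space \<open>a \<bullet> x < c\<close> containing
  \<open>D\<close> into a half-plane, where the Schwarz lemma applies. Separation of points,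
  compactness of balls, the speed of straight segments and the discs in the closure all follow from
  this one inequality. Upper bounds: a chain of affine discs along a segment has a length that
  depends only on the relative width available around the segment.

  The boundary may contain complex discs and \<open>D\<close> may be unbounded, so neither strict
  convexity nor compactness of the closure is at hand; this is why visibility goes through faces and
  through ends. \<open>gromov_hyperbolic\<close> speaks only of triangles that exist, so geodesics
  have to be constructed before it says anything.

  Neither the maps \<open>f\<^sup>n\<close> nor the maps \<open>g\<^sup>m\<close> alone have limit
  maps into \<open>D\<close>, because their orbits leave every ball; only the mixed products
  can.\<close>

lemma geodesic_segmentE:
  assumes "geodesic_segment M d x y S"
  obtains \<gamma> L where "L \<ge> 0" "\<gamma> ` {0..L} \<subseteq> M" "\<gamma> 0 = x" "\<gamma> L = y"
    "\<And>s t. s \<in> {0..L} \<Longrightarrow> t \<in> {0..L} \<Longrightarrow> d (\<gamma> s) (\<gamma> t) = \<bar>s - t\<bar>" "S = \<gamma> ` {0..L}"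
proof -
  have "\<exists>\<gamma> L. L \<ge> 0 \<and> \<gamma> ` {0..L} \<subseteq> M \<and> \<gamma> 0 = x \<and> \<gamma> L = y \<and>
      (\<forall>s\<in>{0..L}. \<forall>t\<in>{0..L}. d (\<gamma> s) (\<gamma> t) = \<bar>s - t\<bar>) \<and> S = \<gamma> ` {0..L}"
    using assms unfolding geodesic_segment_def .
  then show thesis by (elim exE conjE) (rule that; simp)
qed

lemma geodesic_segment_subset:
  assumes "geodesic_segment M d x y S"
  shows "S \<subseteq> M" "x \<in> S" "y \<in> S" "x \<in> M" "y \<in> M"
proof -
  obtain \<gamma> L where *: "L \<ge> 0" "\<gamma> ` {0..L} \<subseteq> M" "\<gamma> 0 = x" "\<gamma> L = y"
    "\<And>s t. s \<in> {0..L} \<Longrightarrow> t \<in> {0..L} \<Longrightarrow> d (\<gamma> s) (\<gamma> t) = \<bar>s - t\<bar>" "S = \<gamma> ` {0..L}"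
    using assms by (rule geodesic_segmentE) blast
  show "S \<subseteq> M" using * by simp
  show "x \<in> S" "y \<in> S" unfolding *(6)
    using *(1) imageI[of 0 "{0..L}" \<gamma>] imageI[of L "{0..L}" \<gamma>] unfolding *(3,4) by auto
  then show "x \<in> M" "y \<in> M" using \<open>S \<subseteq> M\<close> by auto
qed

lemma geodesic_segment_reverse:
  assumes "geodesic_segment M d x y S"
  shows "geodesic_segment M d y x S"
proof -
  obtain \<gamma> L where *: "L \<ge> 0" "\<gamma> ` {0..L} \<subseteq> M" "\<gamma> 0 = x" "\<gamma> L = y"
    "\<And>s t. s \<in> {0..L} \<Longrightarrow> t \<in> {0..L} \<Longrightarrow> d (\<gamma> s) (\<gamma> t) = \<bar>s - t\<bar>" "S = \<gamma> ` {0..L}"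
    using assms by (rule geodesic_segmentE) blast
  have im: "(\<lambda>t. \<gamma> (L - t)) ` {0..L} = \<gamma> ` {0..L}"
  proof -
    have "(\<lambda>t. L - t) ` {0..L} = {0..L}" by (simp add: image_diff_atLeastAtMost)
    then show ?thesis by (metis image_image)
  qed
  show ?thesis unfolding geodesic_segment_def
  proof (intro exI[of _ "\<lambda>t. \<gamma> (L - t)"] exI[of _ L] conjI ballI)
    show "S = (\<lambda>t. \<gamma> (L - t)) ` {0..L}" "(\<lambda>t. \<gamma> (L - t)) ` {0..L} \<subseteq> M" using * im by auto
    show "d (\<gamma> (L - s)) (\<gamma> (L - t)) = \<bar>s - t\<bar>" if "s \<in> {0..L}" "t \<in> {0..L}" for s t
      using *(5)[of "L-s" "L-t"] that by auto
  qed (use * in auto)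
qed

text \<open>The axioms are relative to \<open>M\<close> because the Kobayashi distance is a metric
  only on the domain. Existence of geodesics is an axiom of its own because thinness of triangles
  does not provide it.\<close>

locale geodesic_hyperbolic =
  fixes M :: "'a set" and d :: "'a \<Rightarrow> 'a \<Rightarrow> real" and \<delta> :: real
  assumes nonneg: "\<lbrakk>x \<in> M; y \<in> M\<rbrakk> \<Longrightarrow> 0 \<le> d x y"
    and refl: "x \<in> M \<Longrightarrow> d x x = 0"
    and sym: "\<lbrakk>x \<in> M; y \<in> M\<rbrakk> \<Longrightarrow> d x y = d y x"
    and tri: "\<lbrakk>x \<in> M; y \<in> M; z \<in> M\<rbrakk> \<Longrightarrow> d x z \<le> d x y + d y z"
    and geodesic: "\<lbrakk>x \<in> M; y \<in> M\<rbrakk> \<Longrightarrow> \<exists>S. geodesic_segment M d x y S"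
    and delta: "0 \<le> \<delta>"
    and thin: "\<lbrakk>geodesic_segment M d x y A; geodesic_segment M d y z B; geodesic_segment M d z x C;
      p \<in> A\<rbrakk> \<Longrightarrow> \<exists>q\<in>B \<union> C. d p q \<le> \<delta>"
begin

abbreviation "seg \<equiv> geodesic_segment M d"

lemmas seg_subset = geodesic_segment_subset[of M d]
lemmas seg_reverse = geodesic_segment_reverse[of M d]

text \<open>The parameter of a point of a segment is its distance from \<open>x\<close>, so that
  most later arguments need no parametrisation. The second equation concerns \<open>p\<close>
  alone.\<close>

lemma seg_dist:
  assumes "seg x y S" "p \<in> S" "q \<in> S"
  shows "d p q = \<bar>d x p - d x q\<bar>" "d x p + d p y = d x y"
proof -
  obtain \<gamma> L where *: "L \<ge> 0" "\<gamma> 0 = x" "\<gamma> L = y"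
    "\<And>s t. s \<in> {0..L} \<Longrightarrow> t \<in> {0..L} \<Longrightarrow> d (\<gamma> s) (\<gamma> t) = \<bar>s - t\<bar>" "S = \<gamma> ` {0..L}"
    using assms(1) by (rule geodesic_segmentE) blast
  obtain s t where st: "s \<in> {0..L}" "t \<in> {0..L}" "p = \<gamma> s" "q = \<gamma> t" using assms * by auto
  have 0: "d x p = s" "d x q = t" "d p q = \<bar>s - t\<bar>" "d p y = L - s" "d x y = L"
    using *(4)[of 0 s] *(4)[of 0 t] *(4)[of s t] *(4)[of s L] *(4)[of 0 L] st * by auto
  show "d p q = \<bar>d x p - d x q\<bar>" "d x p + d p y = d x y" using 0 by auto
qed

lemma seg_point_at:
  assumes "seg x y S" "0 \<le> s" "s \<le> d x y"
  obtains p where "p \<in> S" "d x p = s"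
proof -
  obtain \<gamma> L where *: "L \<ge> 0" "\<gamma> 0 = x" "\<gamma> L = y"
    "\<And>s t. s \<in> {0..L} \<Longrightarrow> t \<in> {0..L} \<Longrightarrow> d (\<gamma> s) (\<gamma> t) = \<bar>s - t\<bar>" "S = \<gamma> ` {0..L}"
    using assms(1) by (rule geodesic_segmentE) blast
  have "d x y = L" using *(4)[of 0 L] * by auto
  then show ?thesis using that[of "\<gamma> s"] *(4)[of 0 s] * assms by auto
qed

lemma seg_sub:
  assumes "seg x y S" "p \<in> S" "q \<in> S" "d x p \<le> d x q"
  shows "seg p q {u \<in> S. d x p \<le> d x u \<and> d x u \<le> d x q}"
proof -
  obtain \<gamma> L where *: "L \<ge> 0" "\<gamma> ` {0..L} \<subseteq> M" "\<gamma> 0 = x" "\<gamma> L = y"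
    "\<And>s t. s \<in> {0..L} \<Longrightarrow> t \<in> {0..L} \<Longrightarrow> d (\<gamma> s) (\<gamma> t) = \<bar>s - t\<bar>" "S = \<gamma> ` {0..L}"
    using assms(1) by (rule geodesic_segmentE) blast
  obtain s t where st: "s \<in> {0..L}" "t \<in> {0..L}" "p = \<gamma> s" "q = \<gamma> t"
    using assms(2,3) unfolding *(6) by blast
  have dx: "d x (\<gamma> u) = u" if "u \<in> {0..L}" for u
    using *(5)[of 0 u] that *(1,3) by simp
  have le: "s \<le> t" using dx st assms(4) by auto
  have sub: "(\<lambda>r. \<gamma> (s + r)) ` {0..t - s} = \<gamma> ` {s..t}"
  proof -
    have "(\<lambda>r. s + r) ` {0..t - s} = {s..t}" by simp
    then show ?thesis by (metis image_image)
  qed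
  have eq: "{u \<in> S. d x p \<le> d x u \<and> d x u \<le> d x q} = \<gamma> ` {s..t}"
    using dx st *(6) by (auto simp: image_iff)
  show ?thesis unfolding geodesic_segment_def
  proof (intro exI[of _ "\<lambda>r. \<gamma> (s + r)"] exI[of _ "t - s"] conjI ballI)
    show "{u \<in> S. d x p \<le> d x u \<and> d x u \<le> d x q} = (\<lambda>r. \<gamma> (s + r)) ` {0..t - s}"
      using eq sub by simp
    show "(\<lambda>r. \<gamma> (s + r)) ` {0..t - s} \<subseteq> M" unfolding sub using *(2) st by auto
    show "d (\<gamma> (s + u)) (\<gamma> (s + v)) = \<bar>u - v\<bar>" if "u \<in> {0..t-s}" "v \<in> {0..t-s}" for u v
      using *(5)[of "s+u" "s+v"] that st by auto
  qed (use st le in auto)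
qed

lemma seg_sub':
  assumes "seg x y S" "p \<in> S" "q \<in> S"
  obtains S' where "S' \<subseteq> S" "seg p q S'"
proof (cases "d x p \<le> d x q")
  case True
  then show ?thesis using that[OF _ seg_sub[OF assms True]] by blast
next
  case False
  then have le: "d x q \<le> d x p" by simp
  then show ?thesis using that[OF _ seg_reverse[OF seg_sub[OF assms(1,3,2) le]]] by blast
qed

text \<open>A diagonal cuts the quadrilateral into two triangles, each of which costs one
  \<open>\<delta>\<close>.\<close>

lemma thin_quad:
  assumes "seg x y S" "seg x a A" "seg a b B" "seg b y C" "p \<in> S"
  shows "\<exists>q\<in>A \<union> B \<union> C. d p q \<le> 2 * \<delta>"
proof -
  have M: "x \<in> M" "y \<in> M" "a \<in> M" "b \<in> M" "p \<in> M" using assms seg_subset by blast+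
  obtain E where E: "seg x b E" using geodesic M by blast
  obtain q where q: "q \<in> C \<union> E" "d p q \<le> \<delta>"
    using thin[OF assms(1) seg_reverse[OF assms(4)] seg_reverse[OF E] assms(5)] by blast
  show ?thesis
  proof (cases "q \<in> C")
    case True
    then show ?thesis using q delta by force
  next
    case False
    then have "q \<in> E" using q by simp
    then obtain r where r: "r \<in> A \<union> B" "d q r \<le> \<delta>"
      using thin[OF E seg_reverse[OF assms(3)] seg_reverse[OF assms(2)]] by blast
    have "d p r \<le> d p q + d q r" using r q M E assms seg_subset by (intro tri) blast+
    then show ?thesis using q r by force
  qed
qed

text \<open>Halving a chain costs one thin triangle, and \<open>k\<close> halvings leave a single
  step. The distance from the geodesic to an arbitrary chain with the same ends thus grows only
  logarithmically in the number of steps.\<close>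

lemma log_chain:
  assumes "seg x y S" "c 0 = x" "c N = y" "N \<le> 2 ^ k" "\<And>i. i < N \<Longrightarrow> d (c i) (c (Suc i)) \<le> s"
    "\<And>i. i \<le> N \<Longrightarrow> c i \<in> M" "p \<in> S" "0 \<le> s"
  shows "\<exists>i\<le>N. d p (c i) \<le> real k * \<delta> + s"
  using assms
proof (induction k arbitrary: x y S c N p)
  case 0
  have M: "x \<in> M" "y \<in> M" "p \<in> M" using 0 seg_subset by blast+
  have "d x y \<le> s"
  proof (cases "N = 0")
    case True
    then show ?thesis using 0 refl M by auto
  next
    case False
    then have "N = 1" using 0 by simp
    then show ?thesis using 0 by force
  qed
  moreover have "d x p + d p y = d x y" using seg_dist 0 by blast
  ultimately have "d p (c 0) \<le> s" using nonneg[of p y] M sym[of x p] 0 by auto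
  then show ?case by auto
next
  case (Suc k)
  \<comment> \<open>Cutting at \<open>2 ^ k\<close> leaves at most \<open>2 ^ k\<close> steps on
    either side; for \<open>N \<le> 2 ^ k\<close> the second part is a single point.\<close>
  define m where "m = min N (2 ^ k)"
  have m: "m \<le> N" "m \<le> 2 ^ k" "N - m \<le> 2 ^ k" using Suc.prems(4) by (auto simp: m_def)
  have M: "x \<in> M" "y \<in> M" "p \<in> M" "c m \<in> M" using Suc.prems seg_subset m by blast+
  obtain A where A: "seg x (c m) A" using geodesic M by blast
  obtain B where B: "seg (c m) y B" using geodesic M by blast
  obtain q where q: "q \<in> B \<union> A" "d p q \<le> \<delta>"
    using thin[OF Suc.prems(1) seg_reverse[OF B] seg_reverse[OF A] Suc.prems(7)] by blast
  have "\<exists>i\<le>N. d q (c i) \<le> real k * \<delta> + s"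
  proof (cases "q \<in> A")
    case True
    have "\<exists>i\<le>m. d q (c i) \<le> real k * \<delta> + s"
      by (rule Suc.IH[OF A]) (use Suc.prems m True in auto)
    then show ?thesis using m(1) le_trans by blast
  next
    case False
    then have qB: "q \<in> B" using q by simp
    have "\<exists>i\<le>N-m. d q (c (m + i)) \<le> real k * \<delta> + s"
      by (rule Suc.IH[OF B, where c="\<lambda>i. c (m + i)"]) (use Suc.prems m qB in auto)
    then show ?thesis using m by (metis le_diff_conv2 add.commute)
  qed
  then obtain i where i: "i \<le> N" "d q (c i) \<le> real k * \<delta> + s" by blast
  have "d p (c i) \<le> d p q + d q (c i)"
    by (rule tri) (use M i Suc.prems q A B seg_subset in blast)+
  then show ?case using i q by (intro exI[of _ i]) (auto simp: algebra_simps)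
qed

text \<open>Serves to solve an inequality of the form \<open>2 ^ k \<le> a * k + b\<close> for
  \<open>k\<close>. The factor 2 is there for \<open>k = 3\<close>.\<close>

lemma square_le_pow2: "real k ^ 2 \<le> 2 * 2 ^ k"
proof (induction k rule: less_induct)
  case (less k)
  show ?case
  proof (cases "k \<le> 3")
    case True
    then have "k = 0 \<or> k = 1 \<or> k = 2 \<or> k = 3" by auto
    then show ?thesis by auto
  next
    case False
    then obtain j where j: "k = Suc j" "j \<ge> 3" by (cases k) auto
    have "3 * real j \<le> real j * real j" "3 \<le> real j"
      using j mult_right_mono[of 3 "real j" "real j"] by auto
    moreover have "real k ^ 2 = 1 + 2 * real j + real j * real j"
      using j by (simp add: power2_eq_square algebra_simps)
    ultimately have "real k ^ 2 \<le> 2 * real j ^ 2" unfolding power2_eq_square by linarith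
    then show ?thesis using less.IH[of j] j by simp
  qed
qed

text \<open>Only this half of the stability of quasi-geodesics is needed. The path stays far from a
  geodesic point \<open>q\<close> at almost maximal distance \<open>D0\<close>, while it joins points at distance
  \<open>O(D0)\<close> in \<open>O(D0)\<close> steps, so that \<open>log_chain\<close> bounds \<open>D0\<close>.\<close>

lemma geodesic_near_quasi_geodesic:
  fixes K0 :: real
  obtains C where "\<And>p \<Lambda> S q. \<lbrakk>0 \<le> \<Lambda>; \<And>\<tau>. \<tau> \<in> {0..\<Lambda>} \<Longrightarrow> p \<tau> \<in> M;
      \<And>\<tau> \<tau>'. \<lbrakk>\<tau> \<in> {0..\<Lambda>}; \<tau>' \<in> {0..\<Lambda>}; \<bar>\<tau> - \<tau>'\<bar> \<le> 1\<rbrakk> \<Longrightarrow> d (p \<tau>) (p \<tau>') \<le> K0;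
      \<And>\<tau> \<tau>'. \<lbrakk>\<tau> \<in> {0..\<Lambda>}; \<tau>' \<in> {0..\<Lambda>}\<rbrakk> \<Longrightarrow> \<bar>\<tau> - \<tau>'\<bar> / 2 \<le> d (p \<tau>) (p \<tau>');
      seg (p 0) (p \<Lambda>) S; q \<in> S\<rbrakk> \<Longrightarrow> \<exists>\<tau>\<in>{0..\<Lambda>}. d q (p \<tau>) \<le> C"
proof -
  define E where "E = 1 + 2 * \<delta> + \<bar>K0\<bar>"
  \<comment> \<open>The numbers come from the end of the argument:
    \<open>N \<le> 12 * D0 + 14\<close> and \<open>2 ^ k \<le> 2 * N\<close> give
    \<open>k\<^sup>2 \<le> 48 * D0 + 56\<close>, and \<open>D0 \<le> k * \<delta> + E\<close> turns
    this into a bound for \<open>k\<close>.\<close>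
  define C where "C = (48 * \<delta> + 48 * E + 56) * \<delta> + E + 2"
  have E: "E \<ge> 1" using delta by (simp add: E_def)
  have "\<exists>\<tau>\<in>{0..\<Lambda>}. d q (p \<tau>) \<le> C"
    if "0 \<le> \<Lambda>" and pM: "\<And>\<tau>. \<tau> \<in> {0..\<Lambda>} \<Longrightarrow> p \<tau> \<in> M"
      and up: "\<And>\<tau> \<tau>'. \<lbrakk>\<tau> \<in> {0..\<Lambda>}; \<tau>' \<in> {0..\<Lambda>}; \<bar>\<tau> - \<tau>'\<bar> \<le> 1\<rbrakk> \<Longrightarrow> d (p \<tau>) (p \<tau>') \<le> K0"
      and low: "\<And>\<tau> \<tau>'. \<lbrakk>\<tau> \<in> {0..\<Lambda>}; \<tau>' \<in> {0..\<Lambda>}\<rbrakk> \<Longrightarrow> \<bar>\<tau> - \<tau>'\<bar> / 2 \<le> d (p \<tau>) (p \<tau>')"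
      and S: "seg (p 0) (p \<Lambda>) S" and q: "q \<in> S" for p \<Lambda> S q
  proof -
    let ?x = "p 0" and ?y = "p \<Lambda>"
    have SM: "\<And>u. u \<in> S \<Longrightarrow> u \<in> M" "?x \<in> M" "?y \<in> M" "?x \<in> S" "?y \<in> S"
      using seg_subset[OF S] by blast+
    \<comment> \<open>\<open>D0 = Sup R\<close> measures how far the geodesic gets from the path.
      The supremum need not be attained, so \<open>q0\<close> below is only more than
      \<open>D0 - 1\<close> away, while every point of \<open>S\<close> is within
      \<open>D0 + 1\<close>.\<close>
    define R where "R = {r. \<exists>q\<in>S. \<forall>\<tau>\<in>{0..\<Lambda>}. r \<le> d q (p \<tau>)}"
    have R0: "0 \<in> R" unfolding R_def using nonneg pM SM q by blast
    have Rb: "r \<le> d ?x ?y" if "r \<in> R" for r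
    proof -
      obtain q where q: "q \<in> S" "\<forall>\<tau>\<in>{0..\<Lambda>}. r \<le> d q (p \<tau>)" using \<open>r \<in> R\<close> unfolding R_def by blast
      then have "r \<le> d q ?x" using \<open>0 \<le> \<Lambda>\<close> by simp
      then show ?thesis using q seg_dist(2)[OF S q(1) q(1)] sym[of q ?x] nonneg[of q ?y] SM by auto
    qed
    then have bdd: "bdd_above R" by (rule bdd_aboveI)
    define D0 where "D0 = Sup R"
    have D0: "0 \<le> D0" unfolding D0_def using R0 bdd by (rule cSup_upper)
    have near: "\<exists>\<tau>\<in>{0..\<Lambda>}. d u (p \<tau>) \<le> D0 + 1" if "u \<in> S" for u
    proof (rule ccontr)
      assume "\<not> ?thesis"
      then have "D0 + 1 \<in> R" unfolding R_def using that by force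
      then have "D0 + 1 \<le> D0" unfolding D0_def using bdd by (rule cSup_upper)
      then show False by simp
    qed
    obtain r where "r \<in> R" "D0 - 1 < r"
      using less_cSupD[of R "D0 - 1"] R0 unfolding D0_def by fastforce
    then obtain q0 where q0: "q0 \<in> S" and far: "\<And>\<tau>. \<tau> \<in> {0..\<Lambda>} \<Longrightarrow> D0 - 1 < d q0 (p \<tau>)"
      unfolding R_def by force
    \<comment> \<open>On either side of \<open>q0\<close> some point \<open>y\<close> of the
      geodesic is linked to the path by a segment that stays away from \<open>q0\<close>. If the end
      \<open>e\<close> is near, it is taken itself, with a degenerate link. Otherwise
      \<open>y\<close> lies at distance exactly \<open>2 * D0 + 2\<close> from \<open>q0\<close>,
      and a link of length at most \<open>D0 + 1\<close> cannot come back to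
      \<open>q0\<close>.\<close>
    have side: "\<exists>y\<in>S. \<exists>\<tau>\<in>{0..\<Lambda>}. d e y \<le> d e q0 \<and> d y (p \<tau>) \<le> D0 + 1 \<and> d y q0 \<le> 2 * D0 + 2 \<and>
        (\<forall>A. seg y (p \<tau>) A \<longrightarrow> (\<forall>v\<in>A. D0 - 1 < d q0 v))"
      if e: "e = p \<tau>0" "\<tau>0 \<in> {0..\<Lambda>}" "seg e e' S" for e e' \<tau>0
    proof (cases "d e q0 \<le> 2 * D0 + 2")
      case True
      have eS: "e \<in> S" using e seg_subset by blast
      show ?thesis
      proof (intro bexI[of _ e] bexI[of _ \<tau>0] conjI allI impI ballI)
        show "d e e \<le> d e q0" "d e (p \<tau>0) \<le> D0 + 1"
          using refl[of e] SM eS e nonneg[of e q0] D0 q0 by auto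
        show "d e q0 \<le> 2 * D0 + 2" using True .
        fix A v assume A: "seg e (p \<tau>0) A" "v \<in> A"
        have v: "v \<in> M" "e \<in> M" using A seg_subset by blast+
        have "d e v + d v e = 0" using seg_dist(2)[OF A(1,2,2)] e refl v by auto
        then have "d v e = 0" using nonneg[of v e] nonneg[of e v] v by auto
        moreover have "d q0 e \<le> d q0 v + d v e" using q0 SM v by (intro tri) auto
        ultimately show "D0 - 1 < d q0 v" using far[of \<tau>0] e by auto
      qed (use eS e in auto)
    next
      case False
      have eM: "e \<in> M" "e' \<in> M" using e seg_subset by blast+
      have le: "d e q0 \<le> d e e'"
        using seg_dist(2)[OF e(3) q0 q0] nonneg[of q0 e'] eM SM q0 by auto
      obtain y where y: "y \<in> S" "d e y = d e q0 - (2 * D0 + 2)"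
        by (rule seg_point_at[OF e(3), of "d e q0 - (2 * D0 + 2)"]) (use False le D0 in auto)
      have yq: "d y q0 = 2 * D0 + 2" using seg_dist(1)[OF e(3) y(1) q0] y D0 by auto
      obtain \<tau> where \<tau>: "\<tau> \<in> {0..\<Lambda>}" "d y (p \<tau>) \<le> D0 + 1" using near y by blast
      show ?thesis
      proof (intro bexI[of _ y] bexI[of _ \<tau>] conjI allI impI ballI)
        fix A v assume A: "seg y (p \<tau>) A" "v \<in> A"
        have v: "v \<in> M" "y \<in> M" using A seg_subset by blast+
        have "d y v \<le> D0 + 1"
          using seg_dist(2)[OF A(1,2,2)] \<tau> nonneg[of v "p \<tau>"] v pM by auto
        moreover have "d q0 y \<le> d q0 v + d v y" using q0 SM v by (intro tri) auto
        ultimately show "D0 - 1 < d q0 v" using yq sym[of y q0] sym[of y v] v q0 SM D0 by auto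
      qed (use y \<tau> yq D0 in auto)
    qed
    obtain y \<tau>1 where y: "y \<in> S" "\<tau>1 \<in> {0..\<Lambda>}" "d ?x y \<le> d ?x q0" "d y (p \<tau>1) \<le> D0 + 1"
        "d y q0 \<le> 2 * D0 + 2" "\<And>A v. seg y (p \<tau>1) A \<Longrightarrow> v \<in> A \<Longrightarrow> D0 - 1 < d q0 v"
      using side[OF _ _ S, of 0] \<open>0 \<le> \<Lambda>\<close> by auto
    obtain z \<tau>2 where z: "z \<in> S" "\<tau>2 \<in> {0..\<Lambda>}" "d ?y z \<le> d ?y q0" "d z (p \<tau>2) \<le> D0 + 1"
        "d z q0 \<le> 2 * D0 + 2" "\<And>A v. seg z (p \<tau>2) A \<Longrightarrow> v \<in> A \<Longrightarrow> D0 - 1 < d q0 v"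
      using side[OF _ _ seg_reverse[OF S], of \<Lambda>] \<open>0 \<le> \<Lambda>\<close> by auto
    have M: "y \<in> M" "z \<in> M" "q0 \<in> M" "p \<tau>1 \<in> M" "p \<tau>2 \<in> M" using y z q0 SM pM by auto
    have zx: "d ?x q0 \<le> d ?x z"
      using seg_dist(2)[OF S z(1) z(1)] seg_dist(2)[OF S q0 q0] z(3) sym[of ?y] M SM by auto
    define S' where "S' = {u \<in> S. d ?x y \<le> d ?x u \<and> d ?x u \<le> d ?x z}"
    have S': "seg y z S'" "q0 \<in> S'"
      using seg_sub[OF S y(1) z(1)] y(3) zx q0 unfolding S'_def by auto
    obtain A where A: "seg y (p \<tau>1) A" using geodesic M by blast
    obtain B where B: "seg (p \<tau>1) (p \<tau>2) B" using geodesic M by blast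
    obtain G where G: "seg z (p \<tau>2) G" using geodesic M by blast
    have "D0 \<le> C - 2"
    proof (cases "D0 - 1 \<le> 2 * \<delta>")
      case True
      have "0 \<le> (48 * \<delta> + 48 * E + 56) * \<delta>" using delta E by auto
      then show ?thesis using True by (simp add: C_def E_def)
    next
      case False
      obtain q1 where q1: "q1 \<in> A \<union> B \<union> G" "d q0 q1 \<le> 2 * \<delta>"
        using thin_quad[OF S'(1) A B seg_reverse[OF G] S'(2)] by blast
      \<comment> \<open>The two links stay more than \<open>D0 - 1 > 2 * \<delta>\<close> away from
        \<open>q0\<close>, so the nearby point can only lie on \<open>B\<close>.\<close>
      have "q1 \<notin> A" "q1 \<notin> G" using y(6)[OF A, of q1] z(6)[OF G, of q1] q1 False by auto
      then have q1B: "q1 \<in> B" using q1 by simp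
      define N where "N = nat \<lceil>\<bar>\<tau>1 - \<tau>2\<bar>\<rceil> + 1"
      have N: "\<bar>\<tau>1 - \<tau>2\<bar> \<le> real N" "real N \<le> \<bar>\<tau>1 - \<tau>2\<bar> + 2" "N > 0"
        unfolding N_def by linarith+
      \<comment> \<open>The four pieces have lengths at most \<open>D0 + 1\<close>,
        \<open>2 * D0 + 2\<close>, \<open>2 * D0 + 2\<close> and \<open>D0 + 1\<close>. The lower
        bound \<open>low\<close> doubles their sum into a bound for the time between
        \<open>\<tau>1\<close> and \<open>\<tau>2\<close>.\<close>
      have "d (p \<tau>1) (p \<tau>2) \<le> d (p \<tau>1) y + d y (p \<tau>2)" using M by (intro tri)
      also have "d y (p \<tau>2) \<le> d y q0 + d q0 (p \<tau>2)" using M by (intro tri)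
      also have "d q0 (p \<tau>2) \<le> d q0 z + d z (p \<tau>2)" using M by (intro tri)
      finally have "d (p \<tau>1) (p \<tau>2) \<le> 6 * D0 + 6"
        using y z sym[of y "p \<tau>1"] sym[of q0 z] M by auto
      then have N2: "real N \<le> 12 * D0 + 14" using low[OF y(2) z(2)] N by auto
      define k where "k = (LEAST k. N \<le> 2 ^ k)"
      have k1: "N \<le> 2 ^ k" unfolding k_def
        by (rule LeastI[of "\<lambda>k. N \<le> 2 ^ k" N]) (simp add: less_imp_le less_exp)
      have k2: "2 ^ k \<le> 2 * real N"
      proof (cases k)
        case 0
        then show ?thesis using N by auto
      next
        case (Suc j)
        then have "\<not> N \<le> 2 ^ j" unfolding k_def by (metis not_less_Least lessI)
        then have "2 ^ j \<le> N" by simp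
        then have "real (2 ^ j) \<le> real N" by (rule of_nat_mono)
        then show ?thesis using Suc by simp
      qed
      define c where "c = (\<lambda>i. p (\<tau>1 + (real i / real N) * (\<tau>2 - \<tau>1)))"
      have inn: "\<tau>1 + (real i / real N) * (\<tau>2 - \<tau>1) \<in> {0..\<Lambda>}" if "i \<le> N" for i
      proof -
        define a where "a = real i / real N"
        have a: "0 \<le> a" "a \<le> 1" using that N by (auto simp: a_def)
        have "\<tau>1 + a * (\<tau>2 - \<tau>1) \<in> {0..\<Lambda>}"
          using convexD_alt[of "{0..\<Lambda>}" \<tau>1 \<tau>2 a] y z a by (auto simp: algebra_simps)
        then show ?thesis by (simp add: a_def)
      qed
      have "\<exists>i\<le>N. d q1 (c i) \<le> real k * \<delta> + \<bar>K0\<bar>"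
      proof (rule log_chain[OF B])
        show "c 0 = p \<tau>1" "c N = p \<tau>2" using N by (auto simp: c_def)
        show "c i \<in> M" if "i \<le> N" for i unfolding c_def using inn[OF that] pM by blast
        show "d (c i) (c (Suc i)) \<le> \<bar>K0\<bar>" if "i < N" for i
        proof -
          have eq: "\<tau>1 + (real i / real N) * (\<tau>2 - \<tau>1) - (\<tau>1 + (real (Suc i) / real N) * (\<tau>2 - \<tau>1))
              = (\<tau>1 - \<tau>2) / real N" using N by (simp add: field_simps)
          have "\<bar>(\<tau>1 - \<tau>2) / real N\<bar> \<le> 1" using N by (simp add: field_simps)
          then have "d (c i) (c (Suc i)) \<le> K0" unfolding c_def using that eq
            by (intro up inn) auto
          then show ?thesis by simp
        qed
      qed (use k1 q1B in auto)
      then obtain i where i: "i \<le> N" "d q1 (c i) \<le> real k * \<delta> + \<bar>K0\<bar>" by blast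
      have q1M: "q1 \<in> M" using q1B B seg_subset by blast
      have "d q0 (c i) \<le> d q0 q1 + d q1 (c i)"
        by (intro tri) (use M q1M pM[OF inn[OF i(1)]] in \<open>auto simp: c_def\<close>)
      moreover have "D0 - 1 < d q0 (c i)" unfolding c_def by (rule far[OF inn[OF i(1)]])
      ultimately have D0k: "D0 \<le> real k * \<delta> + E" using q1 i by (simp add: E_def)
      have "real k ^ 2 \<le> 2 * 2 ^ k" by (rule square_le_pow2)
      also have "\<dots> \<le> 48 * D0 + 56" using k2 N2 by linarith
      also have "\<dots> \<le> 48 * (real k * \<delta> + E) + 56" using D0k by simp
      finally have sq: "real k ^ 2 \<le> 48 * \<delta> * real k + (48 * E + 56)" by (simp add: algebra_simps)
      have "real k \<le> 48 * \<delta> + 48 * E + 56"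
      proof (cases "k = 0")
        case True
        then show ?thesis using delta E by auto
      next
        case False
        then have "(48 * E + 56) * 1 \<le> (48 * E + 56) * real k" using E by (intro mult_left_mono) auto
        then have "real k * real k \<le> (48 * \<delta> + 48 * E + 56) * real k"
          using sq by (simp add: power2_eq_square algebra_simps)
        then show ?thesis using False by simp
      qed
      then have "real k * \<delta> \<le> (48 * \<delta> + 48 * E + 56) * \<delta>" using delta by (intro mult_right_mono)
      then show ?thesis using D0k by (simp add: C_def)
    qed
    then show ?thesis using near[OF q] by force
  qed
  then show ?thesis by (rule that)
qed

text \<open>The parameters of points within \<open>\<delta>\<close> of \<open>A\<close> contain 0,
  and just beyond their supremum the points must be near \<open>B\<close>. Stepping one unit ahead
  of a parameter within 1/2 of the supremum costs the summand 1 and replaces a closedness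
  argument.\<close>

lemma thin_fork:
  assumes "seg w v S" "seg a w A" "seg a v B"
  obtains u q q' where "u \<in> S" "q \<in> A" "q' \<in> B" "d u q \<le> \<delta>" "d u q' \<le> \<delta> + 1"
proof -
  obtain \<gamma> L where *: "L \<ge> 0" "\<gamma> ` {0..L} \<subseteq> M" "\<gamma> 0 = w" "\<gamma> L = v"
    "\<And>s t. s \<in> {0..L} \<Longrightarrow> t \<in> {0..L} \<Longrightarrow> d (\<gamma> s) (\<gamma> t) = \<bar>s - t\<bar>" "S = \<gamma> ` {0..L}"
    using assms(1) by (rule geodesic_segmentE) blast
  have M: "w \<in> M" "v \<in> M" "w \<in> A" "v \<in> B" using assms seg_subset by blast+
  define I where "I = {s \<in> {0..L}. \<exists>q\<in>A. d (\<gamma> s) q \<le> \<delta>}"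
  have "d (\<gamma> 0) w \<le> \<delta>" using * refl M delta by auto
  then have I0: "0 \<in> I" unfolding I_def using * M by auto
  have bdd: "bdd_above I" unfolding I_def by (auto intro: bdd_aboveI[of _ L])
  obtain s where s: "s \<in> I" "Sup I - 1 / 2 < s"
    using less_cSupD[of I "Sup I - 1/2"] I0 by fastforce
  then obtain q where q: "q \<in> A" "d (\<gamma> s) q \<le> \<delta>" and sL: "s \<in> {0..L}" unfolding I_def by auto
  have "\<exists>q'\<in>B. d (\<gamma> s) q' \<le> \<delta> + 1"
  proof (cases "s + 1 \<ge> L")
    case True
    then have "d (\<gamma> s) v \<le> \<delta> + 1" using *(5)[of s L] sL * delta by auto
    then show ?thesis using M by auto
  next
    case False
    then have t: "s + 1 \<in> {0..L}" using sL by auto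
    have "s + 1 \<notin> I" using s bdd cSup_upper[of "s+1" I] by auto
    moreover have "\<gamma> (s + 1) \<in> S" using t * by auto
    ultimately obtain q' where q': "q' \<in> B" "d (\<gamma> (s+1)) q' \<le> \<delta>"
      using thin[OF assms(1) seg_reverse[OF assms(3)] assms(2)] t unfolding I_def by blast
    have "d (\<gamma> s) q' \<le> d (\<gamma> s) (\<gamma> (s+1)) + d (\<gamma> (s+1)) q'"
      by (intro tri) (use * sL t q' assms seg_subset in blast)+
    then have "d (\<gamma> s) q' \<le> \<delta> + 1" using q' *(5)[OF sL t] by simp
    then show ?thesis using q'(1) by blast
  qed
  then show ?thesis using that[of "\<gamma> s" q] q sL * by blast
qed

text \<open>Say that \<open>u\<close> is near a point \<open>v\<close> of the side from
  \<open>x\<close> to \<open>z\<close>. Up to \<open>R + \<delta>\<close>, \<open>v\<close> is at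
  least \<open>d a x\<close> away from \<open>x\<close>, and the side has length at most
  \<open>d a y\<close>, so little more than \<open>d a y - d a x\<close> is left between
  \<open>v\<close> and \<open>z\<close>. In the application \<open>a\<close> is the base point and
  \<open>z\<close> the mixed iterate.\<close>

lemma dist_le_of_seg_meets_ball:
  assumes S: "seg x y S" "u \<in> S" and M: "a \<in> M" "z \<in> M" and au: "d a u \<le> R"
    and zx: "d z x \<le> d a y" and zy: "d z y \<le> d a x"
  shows "d z a \<le> \<bar>d a x - d a y\<bar> + 2 * R + 2 * \<delta>"
proof -
  have main: "d z a \<le> \<bar>d a x - d a y\<bar> + 2 * R + 2 * \<delta>"
    if uM: "x \<in> M" "u \<in> M" "y \<in> M" and A: "seg x z A" and v: "v \<in> A" "d u v \<le> \<delta>"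
      and zx: "d z x \<le> d a y" for x y A v
  proof -
    have vM: "v \<in> M" using A v seg_subset by blast
    have 1: "d x v + d v z = d x z" using seg_dist(2)[OF A v(1) v(1)] .
    have 2: "d x u \<le> d x v + d u v" using tri[of x v u] uM vM sym[of u v] by auto
    have 3: "d a x \<le> d x u + R" using tri[of a u x] uM M sym[of u x] au by auto
    have 4: "d z a \<le> d v z + d u v + R"
      using tri[of z v a] tri[of v u a] uM vM M sym[of z v] sym[of v u] sym[of u a] au by auto
    show ?thesis using 1 2 3 4 v zx sym[of z x] uM M by auto
  qed
  have uM: "x \<in> M" "u \<in> M" "y \<in> M" using S seg_subset by blast+
  obtain A where A: "seg x z A" using geodesic uM M by blast
  obtain B where B: "seg y z B" using geodesic uM M by blast
  obtain v where v: "v \<in> B \<union> A" "d u v \<le> \<delta>"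
    using thin[OF S(1) B seg_reverse[OF A] S(2)] by blast
  show ?thesis
  proof (cases "v \<in> A")
    case True
    show ?thesis by (rule main[OF uM A True v(2) zx])
  next
    case False
    then have "v \<in> B" using v by simp
    from main[OF uM(3,2,1) B this v(2) zy] show ?thesis by (simp add: abs_minus_commute)
  qed
qed

end

section \<open>Complex vectors\<close>

lemma norm_vector_smult: "norm (c *s x) = cmod c * norm (x :: complex^'n)"
  by (simp add: norm_vec_def norm_mult L2_set_right_distrib)

lemma scaleR_eq_smult: "r *\<^sub>R x = complex_of_real r *s (x :: complex^'n)"
  unfolding vec_eq_iff vector_scaleR_component vector_smult_component by (simp add: scaleR_conv_of_real)

lemma bounded_linear_smult_left: "bounded_linear (\<lambda>c. c *s (v :: complex^'n))"
proof (rule bounded_linearI')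
  show "(r *\<^sub>R x) *s v = r *\<^sub>R (x *s v)" for r x by (simp add: vec_eq_iff)
qed (simp add: vec_eq_iff algebra_simps)

lemma tendsto_smult [tendsto_intros]:
  fixes v :: "'a \<Rightarrow> complex^'n"
  assumes "(c \<longlongrightarrow> c') F" "(v \<longlongrightarrow> v') F"
  shows "((\<lambda>x. c x *s v x) \<longlongrightarrow> c' *s v') F"
proof -
  have "((\<lambda>x. c x * v x $ i) \<longlongrightarrow> c' * v' $ i) F" for i
    by (intro tendsto_intros assms)
  then show ?thesis by (intro vec_tendstoI) simp
qed

lemma continuous_on_smult [continuous_intros]:
  fixes v :: "'a::topological_space \<Rightarrow> complex^'n"
  shows "\<lbrakk>continuous_on S c; continuous_on S v\<rbrakk> \<Longrightarrow> continuous_on S (\<lambda>x. c x *s v x)"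
  unfolding continuous_on_def using tendsto_smult by blast

lemma has_derivative_vec_componentwise:
  fixes f :: "'a::real_normed_vector \<Rightarrow> complex^'n"
  assumes "\<And>i. ((\<lambda>x. f x $ i) has_derivative (\<lambda>h. f' h $ i)) (at x within S)"
  shows "(f has_derivative f') (at x within S)"
proof (rule has_derivative_componentwise_within[THEN iffD2], rule ballI)
  fix b :: "complex^'n" assume "b \<in> Basis"
  then obtain i u where b: "b = axis i u" by (auto simp: Basis_vec_def)
  show "((\<lambda>x. f x \<bullet> b) has_derivative (\<lambda>h. f' h \<bullet> b)) (at x within S)"
    using has_derivative_inner_left[OF assms[of i], of u] by (simp only: b inner_axis)
qed

lemma has_derivative_vec_nth:
  fixes f :: "'a::real_normed_vector \<Rightarrow> complex^'n"
  assumes "(f has_derivative f') (at x within S)"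
  shows "((\<lambda>x. f x $ i) has_derivative (\<lambda>h. f' h $ i)) (at x within S)"
  using bounded_linear.has_derivative[OF bounded_linear_vec_nth assms] .

text \<open>The complex-linear form with real part \<open>a \<bullet> x\<close>. It turns a real
  half-space containing \<open>D\<close> into a holomorphic function with values in a
  half-plane.\<close>

definition hermitian :: "complex^'n \<Rightarrow> complex^'n \<Rightarrow> complex" where
  "hermitian a x = (\<Sum>i\<in>UNIV. cnj (a $ i) * x $ i)"

lemma Re_hermitian: "Re (hermitian a x) = a \<bullet> x"
  by (simp add: hermitian_def inner_vec_def inner_complex_def)

lemma hermitian_diff: "hermitian a (x - y) = hermitian a x - hermitian a y"
  and hermitian_add: "hermitian a (x + y) = hermitian a x + hermitian a y"
  and hermitian_smult: "hermitian a (c *s x) = c * hermitian a x"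
  by (simp_all add: hermitian_def algebra_simps sum_subtractf sum.distrib sum_distrib_left)

lemma tendsto_hermitian [tendsto_intros]:
  "(f \<longlongrightarrow> l) F \<Longrightarrow> ((\<lambda>x. hermitian a (f x)) \<longlongrightarrow> hermitian a l) F"
  unfolding hermitian_def by (intro tendsto_intros)

section \<open>Analytic discs\<close>

lemma holomorphic_map_on_compose_curve:
  fixes \<phi> :: "complex \<Rightarrow> complex^'m" and f :: "complex^'m \<Rightarrow> complex^'n"
  assumes f: "holomorphic_map_on f D" and \<phi>: "\<And>i. (\<lambda>z. \<phi> z $ i) holomorphic_on S"
    and S: "open S" and sub: "\<phi> ` S \<subseteq> D"
  shows "(\<lambda>z. f (\<phi> z) $ i) holomorphic_on S"
  unfolding holomorphic_on_open[OF S]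
proof
  fix z assume z: "z \<in> S"
  define v where "v = (\<chi> i. deriv (\<lambda>z. \<phi> z $ i) z)"
  have "((\<lambda>z. \<phi> z $ i) has_field_derivative v $ i) (at z)" for i
    using holomorphic_derivI[OF \<phi> S z] by (simp add: v_def)
  then have d1: "(\<phi> has_derivative (\<lambda>h. h *s v)) (at z)"
    by (intro has_derivative_vec_componentwise) (simp add: has_field_derivative_def mult_commute_abs)
  have "\<phi> z \<in> D" using sub z by auto
  then obtain f' where f': "(f has_derivative f') (at (\<phi> z))"
    and lin: "Vector_Spaces.linear (*s) (*s) f'"
    using f unfolding holomorphic_map_on_def by blast
  have "((\<lambda>z. f (\<phi> z)) has_derivative (\<lambda>h. f' (h *s v))) (at z)"
    using has_derivative_compose[OF d1 f'] .
  then have "((\<lambda>z. f (\<phi> z) $ i) has_derivative (\<lambda>h. f' (h *s v) $ i)) (at z)"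
    by (rule has_derivative_vec_nth)
  moreover have "f' (h *s v) $ i = (f' v $ i) * h" for h
    using vec.linear_scale[OF lin] by simp
  ultimately have "((\<lambda>z. f (\<phi> z) $ i) has_field_derivative f' v $ i) (at z)"
    by (simp add: has_field_derivative_def)
  then show "\<exists>f'. ((\<lambda>z. f (\<phi> z) $ i) has_field_derivative f') (at z)" by blast
qed

lemma analytic_disc_compose:
  assumes "holomorphic_map_on f D" "f ` D \<subseteq> E" "analytic_disc D \<phi>"
  shows "analytic_disc E (\<lambda>z. f (\<phi> z))"
proof -
  have "(\<lambda>z. f (\<phi> z) $ i) holomorphic_on ball 0 1" for i
    using assms by (intro holomorphic_map_on_compose_curve[OF assms(1)]) (auto simp: analytic_disc_def)
  then show ?thesis using assms by (fastforce simp: analytic_disc_def)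
qed

lemma analytic_disc_reparam:
  assumes "analytic_disc D \<phi>" "m holomorphic_on ball 0 1" "m ` ball 0 1 \<subseteq> ball 0 1"
  shows "analytic_disc D (\<lambda>z. \<phi> (m z))"
proof -
  have "(\<lambda>z. \<phi> (m z) $ i) holomorphic_on ball 0 1" for i
    using holomorphic_on_compose_gen[OF assms(2) _ assms(3), of "\<lambda>z. \<phi> z $ i"] assms(1)
    by (simp add: analytic_disc_def o_def)
  then show ?thesis using assms by (fastforce simp: analytic_disc_def)
qed

lemma analytic_disc_affine:
  assumes "\<And>z. cmod z < 1 \<Longrightarrow> a + z *s v \<in> D"
  shows "analytic_disc D (\<lambda>z. a + z *s v)"
  using assms by (auto simp: analytic_disc_def intro!: holomorphic_intros)

section \<open>Chains of analytic discs\<close>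

lemma exp_2_artanh: "\<lbrakk>0 \<le> r; r < 1\<rbrakk> \<Longrightarrow> exp (2 * artanh r) = (1 + r) / (1 - r :: real)"
  by (simp add: artanh_def)

lemma artanh_real_nonneg: "\<lbrakk>0 \<le> r; r < 1\<rbrakk> \<Longrightarrow> 0 \<le> artanh (r :: real)"
  by (simp add: artanh_def)

lemma artanh_real_mono: "\<lbrakk>0 \<le> r; r \<le> s; s < 1\<rbrakk> \<Longrightarrow> artanh r \<le> artanh (s :: real)"
  by (simp add: artanh_def frac_le)

text \<open>Each disc is normalised to run from its centre to a real point, where the Schwarz lemma
  applies, and concatenation is a rule, so that estimates along chains become inductions.\<close>

inductive kobayashi_reach :: "(complex^'d) set \<Rightarrow> complex^'d \<Rightarrow> complex^'d \<Rightarrow> real \<Rightarrow> bool"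
  for D where
  disc: "\<lbrakk>analytic_disc D \<phi>; 0 \<le> r; r < 1\<rbrakk> \<Longrightarrow>
    kobayashi_reach D (\<phi> 0) (\<phi> (complex_of_real r)) (artanh r)"
| trans: "\<lbrakk>kobayashi_reach D x y S; kobayashi_reach D y z T\<rbrakk> \<Longrightarrow> kobayashi_reach D x z (S + T)"

lemma kobayashi_reach_mem:
  assumes "kobayashi_reach D x y S"
  shows "x \<in> D" "y \<in> D" "0 \<le> S"
  using assms by (induction) (auto simp: analytic_disc_def artanh_real_nonneg image_subset_iff)

text \<open>The disc is reparametrised by an automorphism \<open>m\<close> with
  \<open>m 0 = a\<close> and \<open>m r = b\<close>, where \<open>r\<close> is the pseudo-hyperbolic
  distance of \<open>a\<close> and \<open>b\<close>.\<close>

lemma kobayashi_reach_disc: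
  assumes "analytic_disc D \<phi>" "a \<in> ball 0 1" "b \<in> ball 0 1"
  shows "kobayashi_reach D (\<phi> a) (\<phi> b) (poincare_dist a b)"
proof -
  define q where "q = Moebius_function 0 a b"
  define r where "r = cmod q"
  \<comment> \<open>The rotation taking \<open>r\<close> to \<open>q\<close>. For
    \<open>a = b\<close> there is nothing to rotate, and the value 1 keeps \<open>u\<close>
    unimodular.\<close>
  define u where "u = (if q = 0 then 1 else q / r)"
  have ab: "cmod a < 1" "cmod b < 1" using assms by auto
  have r: "0 \<le> r" "r < 1" unfolding r_def q_def using Moebius_function_norm_lt_1[OF ab] by auto
  have u: "cmod u = 1" "u * r = q" by (auto simp: u_def r_def norm_divide)
  define m where "m = (\<lambda>z. Moebius_function 0 (-a) (u * z))"
  have m0: "m 0 = a" by (simp add: m_def Moebius_function_of_zero)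
  have mr: "m r = b" unfolding m_def u(2) q_def
    using Moebius_function_compose[of "-a" a b] ab by simp
  have 1: "(\<lambda>z. u * z) ` ball 0 1 \<subseteq> ball 0 1" using u by (auto simp: norm_mult)
  have "m holomorphic_on ball 0 1"
    unfolding m_def
    using holomorphic_on_compose_gen[OF _ Moebius_function_holomorphic 1, of "-a" 0] ab
    by (simp add: o_def holomorphic_intros)
  moreover have "m ` ball 0 1 \<subseteq> ball 0 1"
    using Moebius_function_norm_lt_1[of "-a"] ab u by (auto simp: m_def norm_mult)
  ultimately have "analytic_disc D (\<lambda>z. \<phi> (m z))" using analytic_disc_reparam assms(1) by blast
  from kobayashi_reach.disc[OF this r] have "kobayashi_reach D (\<phi> a) (\<phi> b) (artanh r)"
    by (simp add: m0 mr)
  moreover have "cmod (1 - cnj a * b) = cmod (1 - cnj b * a)"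
    by (metis complex_cnj_cnj complex_cnj_diff complex_cnj_mult complex_cnj_one complex_mod_cnj mult.commute)
  then have "artanh r = poincare_dist a b"
    by (simp add: poincare_dist_def r_def q_def Moebius_function_simple norm_divide norm_minus_commute)
  ultimately show ?thesis by simp
qed

lemma kobayashi_reach_sym:
  assumes "kobayashi_reach D x y S"
  shows "kobayashi_reach D y x S"
  using assms
proof induction
  case (disc \<phi> r)
  have "poincare_dist (complex_of_real r) 0 = artanh r"
    using disc by (simp add: poincare_dist_def)
  then show ?case using kobayashi_reach_disc[OF disc(1), of r 0] disc by simp
next
  case (trans x y S z T)
  then show ?case using kobayashi_reach.trans by (metis add.commute)
qed

lemma kobayashi_chain_imp_reach:
  assumes "kobayashi_chain D x y m \<phi> a b"
  shows "kobayashi_reach D x y (\<Sum>i<m. poincare_dist (a i) (b i))"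
proof -
  have c: "m \<ge> 1" "\<And>i. i < m \<Longrightarrow> analytic_disc D (\<phi> i) \<and> a i \<in> ball 0 1 \<and> b i \<in> ball 0 1"
      "\<phi> 0 (a 0) = x" "\<phi> (m - 1) (b (m - 1)) = y"
      "\<And>i. Suc i < m \<Longrightarrow> \<phi> i (b i) = \<phi> (Suc i) (a (Suc i))"
    using assms unfolding kobayashi_chain_def by blast+
  have "j < m \<Longrightarrow> kobayashi_reach D x (\<phi> j (b j)) (\<Sum>i<Suc j. poincare_dist (a i) (b i))" for j
  proof (induction j)
    case 0
    then show ?case using kobayashi_reach_disc[of D "\<phi> 0" "a 0" "b 0"] c(2)[of 0] c(3) by simp
  next
    case (Suc j)
    have "kobayashi_reach D (\<phi> j (b j)) (\<phi> (Suc j) (b (Suc j))) (poincare_dist (a (Suc j)) (b (Suc j)))"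
      using kobayashi_reach_disc[of D "\<phi> (Suc j)" "a (Suc j)" "b (Suc j)"] c(2)[of "Suc j"] c(5)[of j] Suc.prems
      by simp
    then show ?case using kobayashi_reach.trans[OF Suc.IH] Suc.prems by simp
  qed
  from this[of "m - 1"] show ?thesis using c(1,4) by simp
qed

lemma kobayashi_reach_imp_chain:
  assumes "kobayashi_reach D x y S"
  shows "\<exists>m \<phi> a b. S = (\<Sum>i<m. poincare_dist (a i) (b i)) \<and> kobayashi_chain D x y m \<phi> a b"
  using assms
proof induction
  case (disc \<phi> r)
  have "artanh r = (\<Sum>i<(1::nat). poincare_dist 0 (complex_of_real r))"
    using disc by (simp add: poincare_dist_def)
  moreover have "kobayashi_chain D (\<phi> 0) (\<phi> r) 1 (\<lambda>_. \<phi>) (\<lambda>_. 0) (\<lambda>_. complex_of_real r)"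
    using disc by (simp add: kobayashi_chain_def)
  ultimately show ?case by (intro exI conjI)
next
  case (trans x y S z T)
  from trans.IH obtain m \<phi> a b m' \<phi>' a' b' where
    S: "S = (\<Sum>i<m. poincare_dist (a i) (b i))" "kobayashi_chain D x y m \<phi> a b" and
    T: "T = (\<Sum>i<m'. poincare_dist (a' i) (b' i))" "kobayashi_chain D y z m' \<phi>' a' b'"
    by (elim exE conjE)
  define cc where "cc = (\<lambda>(f :: nat \<Rightarrow> complex) f' i. if i < m then f i else f' (i - m))"
  define \<psi> where "\<psi> = (\<lambda>i. if i < m then \<phi> i else \<phi>' (i - m))"
  have m: "m \<ge> 1" "m' \<ge> 1" using S T by (auto simp: kobayashi_chain_def)
  have sum: "(\<Sum>i<m+n. poincare_dist (cc a a' i) (cc b b' i)) =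
     (\<Sum>i<m. poincare_dist (a i) (b i)) + (\<Sum>i<n. poincare_dist (a' i) (b' i))" for n
    by (induction n) (auto simp: cc_def)
  have "kobayashi_chain D x z (m + m') \<psi> (cc a a') (cc b b')"
    unfolding kobayashi_chain_def
  proof (intro conjI allI impI)
    fix i
    show "analytic_disc D (\<psi> i)" "cc a a' i \<in> ball 0 1" "cc b b' i \<in> ball 0 1" if "i < m + m'"
      using S(2) T(2) that unfolding kobayashi_chain_def \<psi>_def cc_def by (auto simp del: mem_ball)
    assume i: "Suc i < m + m'"
    consider "Suc i < m" | "Suc i = m" | "Suc i > m" by linarith
    then show "\<psi> i (cc b b' i) = \<psi> (Suc i) (cc a a' (Suc i))"
    proof cases
      case 2
      then have "i = m - 1" by simp
      then show ?thesis using S(2) T(2) 2 unfolding kobayashi_chain_def \<psi>_def cc_def by auto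
    next
      case 3
      then show ?thesis using T(2) i unfolding kobayashi_chain_def \<psi>_def cc_def by (auto simp: Suc_diff_le)
    qed (use S(2) in \<open>auto simp: kobayashi_chain_def \<psi>_def cc_def\<close>)
  next
    have "m + m' - 1 - m = m' - 1" using m by simp
    then show "\<psi> (m + m' - 1) (cc b b' (m + m' - 1)) = z" "\<psi> 0 (cc a a' 0) = x" "1 \<le> m + m'"
      using S(2) T(2) m unfolding kobayashi_chain_def \<psi>_def cc_def by auto
  qed
  then show ?case using sum[of m'] S(1) T(1) by metis
qed

lemma kobayashi_dist_eq: "kobayashi_dist D x y = Inf {S. kobayashi_reach D x y S}"
proof -
  have "{\<Sum>i<m. poincare_dist (a i) (b i) | m \<phi> a b. kobayashi_chain D x y m \<phi> a b} =
      {S. kobayashi_reach D x y S}"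
    using kobayashi_chain_imp_reach kobayashi_reach_imp_chain by blast
  then show ?thesis by (simp add: kobayashi_dist_def)
qed

lemma kobayashi_dist_le:
  assumes "kobayashi_reach D x y S"
  shows "kobayashi_dist D x y \<le> S"
  unfolding kobayashi_dist_eq
  using assms kobayashi_reach_mem(3) by (intro cInf_lower) (auto intro!: bdd_belowI[of _ 0])

lemma kobayashi_reach_map:
  assumes "kobayashi_reach D x y S" "holomorphic_map_on f D" "f ` D \<subseteq> E"
  shows "kobayashi_reach E (f x) (f y) S"
  using assms(1)
proof induction
  case (disc \<phi> r)
  from kobayashi_reach.disc[OF analytic_disc_compose[OF assms(2,3) disc(1)] disc(2,3)]
  show ?case .
qed (rule kobayashi_reach.trans)

text \<open>Within a disc, the radius from 0 to \<open>r\<close> is a Poincare geodesic and can be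
  cut at \<open>tanh s\<close>. In the limit such cuts give the intermediate points from which
  geodesics are built.\<close>

lemma kobayashi_reach_between:
  assumes "kobayashi_reach D x y S" "0 \<le> s" "s \<le> S"
  shows "\<exists>z. kobayashi_reach D x z s \<and> kobayashi_reach D z y (S - s)"
  using assms
proof (induction arbitrary: s)
  case (disc \<phi> r)
  define c where "c = tanh s"
  have sc: "artanh c = s" by (simp add: c_def artanh_tanh_real)
  have c0: "0 \<le> c" using disc by (simp add: c_def)
  have c1: "c < 1" using tanh_real_bounds[of s] by (simp add: c_def)
  have "exp (2 * artanh c) \<le> exp (2 * artanh r)" using disc sc by simp
  then have "(1 + c) / (1 - c) \<le> (1 + r) / (1 - r)" using exp_2_artanh c0 c1 disc by simp
  then have cr: "c \<le> r" using c1 disc by (simp add: field_simps)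
  have "c * r < 1 * 1" by (rule mult_strict_mono') (use c0 c1 disc in auto)
  then have d: "0 < 1 - c * r" by simp
  have "poincare_dist c r = artanh \<bar>(c - r) / (1 - r * c)\<bar>"
  proof -
    have "cmod ((complex_of_real c - r) / (1 - cnj r * c)) = cmod (complex_of_real ((c - r) / (1 - r * c)))"
      by simp
    then show ?thesis unfolding poincare_dist_def norm_of_real by simp
  qed
  also have "\<bar>(c - r) / (1 - r * c)\<bar> = (r - c) / (1 - c * r)"
    using cr d by (simp add: abs_divide mult.commute)
  also have "artanh ((r - c) / (1 - c * r)) = artanh r - artanh c"
  proof -
    have "(1 + (r - c) / (1 - c * r)) / (1 - (r - c) / (1 - c * r)) =
        ((1 + r) / (1 - r)) / ((1 + c) / (1 - c))"
    proof -
      have "1 + (r - c) / (1 - c * r) = (1 + r) * (1 - c) / (1 - c * r)"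
        "1 - (r - c) / (1 - c * r) = (1 - r) * (1 + c) / (1 - c * r)"
        using d by (simp_all add: field_simps)
      then show ?thesis using d by simp
    qed
    moreover have "ln (((1 + r) / (1 - r)) / ((1 + c) / (1 - c))) = ln ((1 + r) / (1 - r)) - ln ((1 + c) / (1 - c))"
      using c0 c1 disc by (intro ln_divide_pos divide_pos_pos) linarith+
    ultimately show ?thesis by (simp only: artanh_def diff_divide_distrib)
  qed
  finally have p: "poincare_dist c r = artanh r - s" using sc by simp
  have "kobayashi_reach D (\<phi> c) (\<phi> r) (artanh r - s)"
    using kobayashi_reach_disc[OF disc(1), of c r] c0 c1 disc p by simp
  moreover have "kobayashi_reach D (\<phi> 0) (\<phi> c) s"
    using kobayashi_reach.disc[OF disc(1) c0 c1] sc by simp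
  ultimately show ?case by blast
next
  case (trans x y S z T)
  show ?case
  proof (cases "s \<le> S")
    case True
    then obtain w where "kobayashi_reach D x w s" "kobayashi_reach D w y (S - s)"
      using trans by blast
    moreover have "kobayashi_reach D w z (S - s + T)"
      using kobayashi_reach.trans calculation(2) trans.hyps(2) by blast
    ultimately show ?thesis by (metis diff_add_eq)
  next
    case False
    then obtain w where "kobayashi_reach D y w (s - S)" "kobayashi_reach D w z (T - (s - S))"
      using trans.IH(2)[of "s - S"] trans.prems by auto
    moreover have "kobayashi_reach D x w (S + (s - S))"
      using kobayashi_reach.trans calculation(1) trans.hyps(1) by blast
    moreover have "T - (s - S) = S + T - s" "S + (s - S) = s" by auto
    ultimately show ?thesis by metis
  qed
qed

section \<open>Kobayashi geometry of convex domains\<close>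

text \<open>\<open>q\<close> is the Cayley transform centred at \<open>h 0\<close>, which maps the
  half-plane to the disc with value 0 at 0. The Schwarz bound for \<open>q\<close>, solved for the
  difference, gives the factor \<open>2 * r / (1 - r)\<close>, which is
  \<open>exp (2 * artanh r) - 1\<close>.\<close>

lemma half_plane_schwarz:
  assumes h: "h holomorphic_on ball 0 1" and pos: "\<And>z. z \<in> ball 0 1 \<Longrightarrow> 0 < Re (h z)"
    and r: "0 \<le> r" "r < 1"
  shows "cmod (h (complex_of_real r) - h 0) \<le> (exp (2 * artanh r) - 1) * Re (h 0)"
proof -
  define q where "q = (\<lambda>z. (h z - h 0) / (h z + cnj (h 0)))"
  have nz: "h z + cnj (h 0) \<noteq> 0" if "z \<in> ball 0 1" for z
  proof -
    have "0 < Re (h z + cnj (h 0))" using pos[OF that] pos[of 0] by simp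
    then show ?thesis by (metis less_irrefl zero_complex.sel(1))
  qed
  have "q holomorphic_on ball 0 1" unfolding q_def by (intro holomorphic_intros h nz)
  moreover have "cmod (q z) < 1" if "cmod z < 1" for z
  proof -
    have p: "0 < Re (h z) * Re (h 0)" using pos[of z] pos[of 0] that by simp
    have "(cmod (h z - h 0))\<^sup>2 < (cmod (h z + cnj (h 0)))\<^sup>2"
      unfolding cmod_power2 using p by (simp add: power2_eq_square algebra_simps)
    then have "cmod (h z - h 0) < cmod (h z + cnj (h 0))" by (rule power2_less_imp_less) simp
    then show ?thesis using nz[of z] that by (simp add: q_def norm_divide)
  qed
  ultimately have q: "cmod (q r) \<le> r" using Schwarz_Lemma(1)[of q r] r by (simp add: q_def)
  have "h r - h 0 = q r * (h r + cnj (h 0))" using nz[of r] r by (simp add: q_def)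
  also have "h r + cnj (h 0) = (h r - h 0) + of_real (2 * Re (h 0))" by (simp add: complex_eq_iff)
  finally have "cmod (h r - h 0) = cmod (q r) * cmod ((h r - h 0) + of_real (2 * Re (h 0)))"
    by (metis norm_mult)
  also have "\<dots> \<le> r * (cmod (h r - h 0) + cmod (of_real (2 * Re (h 0))))"
    using q r by (intro mult_mono norm_triangle_ineq) auto
  also have "cmod (of_real (2 * Re (h 0))) = 2 * Re (h 0)" using pos[of 0] by (simp del: of_real_mult)
  finally have le: "cmod (h r - h 0) * (1 - r) \<le> 2 * r * Re (h 0)" by (simp add: algebra_simps)
  have eq: "exp (2 * artanh r) - 1 = 2 * r / (1 - r)"
    unfolding exp_2_artanh[OF r] using r by (simp add: field_simps)
  show ?thesis unfolding eq using le r by (simp add: pos_le_divide_eq)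
qed

text \<open>In this form the bound composes along a chain: going from \<open>x\<close> to
  \<open>y\<close> multiplies the gap \<open>c - a \<bullet> x\<close> by at most
  \<open>exp (2 * S)\<close>, and the exponentials multiply.\<close>

lemma kobayashi_reach_half_space:
  assumes "kobayashi_reach D x y S" and "\<And>x. x \<in> D \<Longrightarrow> a \<bullet> x < c"
  shows "cmod (hermitian a (x - y)) \<le> (exp (2 * S) - 1) * (c - a \<bullet> x)"
  using assms(1)
proof induction
  case (disc \<phi> r)
  define h where "h = (\<lambda>z. of_real c - hermitian a (\<phi> z))"
  have "h holomorphic_on ball 0 1" using disc(1) unfolding h_def hermitian_def analytic_disc_def
    by (intro holomorphic_intros) auto
  moreover have "0 < Re (h z)" if "z \<in> ball 0 1" for z
  proof -
    have "\<phi> z \<in> D" using disc(1) that unfolding analytic_disc_def by blast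
    then show ?thesis using assms(2) by (simp add: h_def Re_hermitian)
  qed
  ultimately have "cmod (h r - h 0) \<le> (exp (2 * artanh r) - 1) * Re (h 0)"
    using half_plane_schwarz disc by blast
  then show ?case by (simp add: h_def Re_hermitian hermitian_diff norm_minus_commute)
next
  case (trans x y S z T)
  have 1: "c - a \<bullet> y \<le> exp (2 * S) * (c - a \<bullet> x)"
  proof -
    have "a \<bullet> x - a \<bullet> y \<le> cmod (hermitian a (x - y))"
      using complex_Re_le_cmod[of "hermitian a (x - y)"] by (simp add: Re_hermitian inner_diff_right)
    then show ?thesis using trans.IH(1) by (simp add: algebra_simps)
  qed
  have "cmod (hermitian a (x - z)) \<le> cmod (hermitian a (x - y)) + cmod (hermitian a (y - z))"
    using norm_triangle_ineq[of "hermitian a (x - y)" "hermitian a (y - z)"]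
    by (simp flip: hermitian_add)
  also have "\<dots> \<le> (exp (2 * S) - 1) * (c - a \<bullet> x) + (exp (2 * T) - 1) * (c - a \<bullet> y)"
    using trans.IH by simp
  also have "\<dots> \<le> (exp (2 * S) - 1) * (c - a \<bullet> x) + (exp (2 * T) - 1) * (exp (2 * S) * (c - a \<bullet> x))"
    using 1 kobayashi_reach_mem(3)[OF trans.hyps(2)] by (intro add_left_mono mult_left_mono) auto
  also have "\<dots> = (exp (2 * (S + T)) - 1) * (c - a \<bullet> x)"
    by (simp add: algebra_simps exp_add)
  finally show ?case .
qed

text \<open>Inside the complex \<open>\<epsilon>\<close>-neighbourhood of the segment, steps of
  relative size \<open>1 / N \<le> \<epsilon> / 2\<close> are taken in affine discs of relative
  radius \<open>\<epsilon>\<close>. The resulting length depends on \<open>\<epsilon>\<close> only,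
  which makes it uniform near the boundary.\<close>

lemma kobayashi_reach_segment:
  assumes "0 < \<epsilon>"
    and sub: "\<And>t \<mu>. \<lbrakk>0 \<le> t; t \<le> 1; cmod \<mu> < \<epsilon>\<rbrakk> \<Longrightarrow> z + (of_real t + \<mu>) *s (w - z) \<in> D"
  shows "kobayashi_reach D z w (real (nat \<lceil>2 / \<epsilon>\<rceil>) * artanh (1 / (real (nat \<lceil>2 / \<epsilon>\<rceil>) * \<epsilon>)))"
proof -
  define N where "N = nat \<lceil>2 / \<epsilon>\<rceil>"
  have Npos: "0 < N" using assms(1) by (simp add: N_def)
  have "2 / \<epsilon> \<le> real N" unfolding N_def by linarith
  then have N: "2 \<le> real N * \<epsilon>" using assms(1) by (simp add: field_simps)
  define r where "r = 1 / (real N * \<epsilon>)"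
  have r: "0 \<le> r" "r < 1" using N assms(1) by (auto simp: r_def)
  define p where "p = (\<lambda>i::nat. z + of_real (real i / real N) *s (w - z))"
  have step: "kobayashi_reach D (p i) (p (Suc i)) (artanh r)" if "i < N" for i
  proof -
    have "analytic_disc D (\<lambda>\<zeta>. p i + \<zeta> *s (of_real \<epsilon> *s (w - z)))"
    proof (rule analytic_disc_affine)
      fix \<zeta> :: complex assume "cmod \<zeta> < 1"
      then have "cmod (\<zeta> * of_real \<epsilon>) < \<epsilon>" using assms(1) by (simp add: norm_mult)
      then have "z + (of_real (real i / real N) + \<zeta> * of_real \<epsilon>) *s (w - z) \<in> D"
        using that by (intro sub) auto
      moreover have "z + (of_real (real i / real N) + \<zeta> * of_real \<epsilon>) *s (w - z) =
          p i + \<zeta> *s (of_real \<epsilon> *s (w - z))"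
        by (simp add: p_def vec_eq_iff algebra_simps)
      ultimately show "p i + \<zeta> *s (of_real \<epsilon> *s (w - z)) \<in> D" by metis
    qed
    moreover have "p i + of_real r *s (of_real \<epsilon> *s (w - z)) = p (Suc i)"
    proof -
      have "r * \<epsilon> = 1 / real N" using assms(1) N by (simp add: r_def)
      then have "complex_of_real r * of_real \<epsilon> = of_real (1 / real N)" by (metis of_real_mult)
      then have "p i + of_real r *s (of_real \<epsilon> *s (w - z)) =
          z + (of_real (real i / real N) + of_real (1 / real N)) *s (w - z)"
        by (simp add: p_def vec.scale_left_distrib add.assoc)
      then show ?thesis by (simp add: p_def add_divide_distrib)
    qed
    ultimately show ?thesis using kobayashi_reach.disc[OF _ r, of D "\<lambda>\<zeta>. p i + \<zeta> *s (of_real \<epsilon> *s (w - z))"]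
      by simp
  qed
  have "i < N \<Longrightarrow> kobayashi_reach D (p 0) (p (Suc i)) (real (Suc i) * artanh r)" for i
  proof (induction i)
    case 0
    then show ?case using step[of 0] by simp
  next
    case (Suc i)
    then show ?case using kobayashi_reach.trans[OF _ step[of "Suc i"], of "p 0" "real (Suc i) * artanh r"]
      by (simp add: algebra_simps)
  qed
  from this[of "N - 1"] Npos have "kobayashi_reach D (p 0) (p N) (real N * artanh r)" by simp
  moreover have "p 0 = z" "p N = w" using Npos by (simp_all add: p_def)
  ultimately show ?thesis by (simp add: r_def N_def)
qed

lemma in_open_segment_interior:
  fixes D :: "(complex^'d) set"
  assumes "convex D" "open D" "x \<in> D" "y \<in> closure D" "0 \<le> t" "t < 1"
  shows "x + of_real t *s (y - x) \<in> D"
proof -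
  have "y - (1 - t) *\<^sub>R (y - x) \<in> interior D"
    using assms by (intro mem_interior_closure_convex_shrink) (auto simp: interior_open)
  moreover have "y - (1 - t) *\<^sub>R (y - x) = x + of_real t *s (y - x)"
    unfolding scaleR_eq_smult by (simp add: vec_eq_iff algebra_simps)
  ultimately show ?thesis using assms by (simp add: interior_open)
qed

lemma kobayashi_reach_ball:
  assumes "ball z \<epsilon> \<subseteq> D" "norm (w - z) < \<epsilon>"
  shows "kobayashi_reach D z w (artanh (norm (w - z) / \<epsilon>))"
proof -
  have e: "0 < \<epsilon>" using assms(2) norm_ge_zero[of "w - z"] by linarith
  define n where "n = norm (w - z)"
  define v where "v = (if w = z then 0 else (of_real (\<epsilon> / n) :: complex) *s (w - z))"
  have nv: "norm v \<le> \<epsilon>"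
  proof (cases "w = z")
    case False
    then have "norm v = \<bar>\<epsilon> / n\<bar> * n" unfolding v_def n_def by (simp only: if_False norm_vector_smult norm_of_real)
    then show ?thesis using e False by (simp add: n_def)
  qed (use e in \<open>simp add: v_def\<close>)
  have "analytic_disc D (\<lambda>\<zeta>. z + \<zeta> *s v)"
  proof (rule analytic_disc_affine)
    fix \<zeta> :: complex assume z: "cmod \<zeta> < 1"
    have "cmod \<zeta> * norm v \<le> cmod \<zeta> * \<epsilon>" using nv by (intro mult_left_mono) auto
    also have "\<dots> < \<epsilon>" using z e by simp
    finally have "z + \<zeta> *s v \<in> ball z \<epsilon>" by (simp add: dist_norm norm_vector_smult)
    then show "z + \<zeta> *s v \<in> D" using assms(1) by blast
  qed
  moreover have "z + of_real (n / \<epsilon>) *s v = w"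
  proof (cases "w = z")
    case False
    then have "(of_real (n / \<epsilon>) :: complex) * of_real (\<epsilon> / n) = 1"
      using e by (simp add: n_def)
    then show ?thesis using False unfolding v_def by (simp only: if_False vec.scale_scale) simp
  qed (simp add: v_def)
  ultimately show ?thesis
    using kobayashi_reach.disc[of D "\<lambda>\<zeta>. z + \<zeta> *s v" "n / \<epsilon>"] assms(2) e by (simp add: n_def)
qed

section \<open>The Kobayashi distance as a metric on a convex domain\<close>

locale cproper_convex =
  fixes D :: "(complex^'d) set"
  assumes cproper: "complex_proper_convex_domain D"
begin

lemma D_open: "open D" and D_nonempty: "D \<noteq> {}" and D_convex: "convex D"
  and no_line: "v \<noteq> 0 \<Longrightarrow> \<exists>z::complex. a + z *s v \<notin> D"
  using cproper unfolding complex_proper_convex_domain_def contains_complex_line_def by auto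

abbreviation "K \<equiv> kobayashi_dist D"

lemma reach_local:
  assumes "z \<in> D"
  obtains \<epsilon> where "\<epsilon> > 0" "\<And>w. norm (w - z) < \<epsilon> \<Longrightarrow> w \<in> D \<and> kobayashi_reach D z w (artanh (norm (w - z) / \<epsilon>))"
proof -
  obtain \<epsilon> where e: "\<epsilon> > 0" "ball z \<epsilon> \<subseteq> D" using D_open assms open_contains_ball by blast
  show ?thesis
  proof (rule that[OF e(1)])
    fix w assume w: "norm (w - z) < \<epsilon>"
    then have "w \<in> ball z \<epsilon>" by (simp add: dist_norm norm_minus_commute)
    then show "w \<in> D \<and> kobayashi_reach D z w (artanh (norm (w - z) / \<epsilon>))"
      using kobayashi_reach_ball[OF e(2) w] e(2) by blast
  qed
qed

text \<open>The set reachable from \<open>x\<close> and its complement are open by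
  \<open>reach_local\<close>, and \<open>D\<close> is connected. This makes the infimum defining
  \<open>K\<close> one over a nonempty set.\<close>

lemma reach_exists:
  assumes "x \<in> D" "y \<in> D"
  shows "\<exists>S. kobayashi_reach D x y S"
proof -
  define R where "R = {z \<in> D. \<exists>S. kobayashi_reach D x z S}"
  have x: "x \<in> R"
  proof -
    obtain \<epsilon> where "\<epsilon> > 0" "\<And>w. norm (w - x) < \<epsilon> \<Longrightarrow> w \<in> D \<and> kobayashi_reach D x w (artanh (norm (w - x) / \<epsilon>))"
      using reach_local[OF assms(1)] by blast
    from this(1) this(2)[of x] show ?thesis using assms unfolding R_def by auto
  qed
  have nb: "\<exists>\<epsilon>>0. \<forall>w. norm (w - z) < \<epsilon> \<longrightarrow> w \<in> D \<and> (w \<in> R \<longleftrightarrow> z \<in> R)" if z: "z \<in> D" for z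
  proof -
    obtain \<epsilon> where e: "\<epsilon> > 0" "\<And>w. norm (w - z) < \<epsilon> \<Longrightarrow> w \<in> D \<and> kobayashi_reach D z w (artanh (norm (w - z) / \<epsilon>))"
      using reach_local[OF z] by blast
    have "w \<in> R \<longleftrightarrow> z \<in> R" if "norm (w - z) < \<epsilon>" for w
      using e(2)[OF that] kobayashi_reach.trans kobayashi_reach_sym z unfolding R_def by blast
    then show ?thesis using e by blast
  qed
  have "openin (top_of_set D) R" "openin (top_of_set D) (D - R)"
  proof -
    have "\<forall>z\<in>R. \<exists>\<epsilon>>0. \<forall>w\<in>D. dist w z < \<epsilon> \<longrightarrow> w \<in> R"
      using nb unfolding dist_norm R_def by blast
    then show "openin (top_of_set D) R" unfolding openin_euclidean_subtopology_iff R_def by blast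
    have "\<forall>z\<in>D - R. \<exists>\<epsilon>>0. \<forall>w\<in>D. dist w z < \<epsilon> \<longrightarrow> w \<in> D - R"
      using nb unfolding dist_norm by blast
    then show "openin (top_of_set D) (D - R)" unfolding openin_euclidean_subtopology_iff by blast
  qed
  then have "openin (top_of_set D) R \<and> closedin (top_of_set D) R"
    unfolding closedin_def by (simp add: R_def Collect_mono)
  then have "R = D" using convex_connected[OF D_convex] x connected_clopen[of D] by blast
  then show ?thesis using assms unfolding R_def by blast
qed

lemma K_approx:
  assumes "x \<in> D" "y \<in> D" "K x y < S"
  obtains T where "kobayashi_reach D x y T" "T < S"
proof -
  have "\<exists>T\<in>{S. kobayashi_reach D x y S}. T < S"
    using assms reach_exists[of x y] by (intro cInf_lessD) (auto simp: kobayashi_dist_eq)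
  then show ?thesis using that by blast
qed

lemma K_greatest:
  assumes "x \<in> D" "y \<in> D" "\<And>S. kobayashi_reach D x y S \<Longrightarrow> c \<le> S"
  shows "c \<le> K x y"
  unfolding kobayashi_dist_eq using assms reach_exists[of x y] by (intro cInf_greatest) auto

lemma K_nonneg: "\<lbrakk>x \<in> D; y \<in> D\<rbrakk> \<Longrightarrow> 0 \<le> K x y"
  using K_greatest kobayashi_reach_mem(3) by blast

lemma K_le_near:
  assumes "z \<in> D"
  obtains \<epsilon> where "\<epsilon> > 0" "\<And>w. norm (w - z) < \<epsilon> \<Longrightarrow> w \<in> D \<and> K z w \<le> artanh (norm (w - z) / \<epsilon>)"
proof -
  obtain \<epsilon> where "\<epsilon> > 0" "\<And>w. norm (w - z) < \<epsilon> \<Longrightarrow> w \<in> D \<and> kobayashi_reach D z w (artanh (norm (w - z) / \<epsilon>))"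
    using reach_local[OF assms] by blast
  then show ?thesis using that kobayashi_dist_le by blast
qed

lemma K_refl:
  assumes "x \<in> D"
  shows "K x x = 0"
proof -
  obtain \<epsilon> where "\<epsilon> > 0" "\<And>w. norm (w - x) < \<epsilon> \<Longrightarrow> w \<in> D \<and> K x w \<le> artanh (norm (w - x) / \<epsilon>)"
    using K_le_near[OF assms] by blast
  from this(1) this(2)[of x] show ?thesis using K_nonneg[OF assms assms] by simp
qed

lemma K_sym: "K x y = K y x"
proof -
  have "{S. kobayashi_reach D x y S} = {S. kobayashi_reach D y x S}" using kobayashi_reach_sym by blast
  then show ?thesis by (simp add: kobayashi_dist_eq)
qed

lemma K_tri:
  assumes "x \<in> D" "y \<in> D" "z \<in> D"
  shows "K x z \<le> K x y + K y z"
proof (rule field_le_epsilon)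
  fix e :: real assume e: "e > 0"
  obtain S where S: "kobayashi_reach D x y S" "S < K x y + e / 2"
    using K_approx[of x y "K x y + e/2"] assms e by auto
  obtain T where T: "kobayashi_reach D y z T" "T < K y z + e / 2"
    using K_approx[of y z "K y z + e/2"] assms e by auto
  show "K x z \<le> K x y + K y z + e"
    using kobayashi_dist_le[OF kobayashi_reach.trans[OF S(1) T(1)]] S(2) T(2) by simp
qed

lemma K_map:
  assumes "holomorphic_map_on f D" "f ` D \<subseteq> D" "x \<in> D" "y \<in> D"
  shows "K (f x) (f y) \<le> K x y"
  by (rule K_greatest[OF assms(3,4)]) (rule kobayashi_dist_le[OF kobayashi_reach_map[OF _ assms(1,2)]])

text \<open>The chain bound is first solved for \<open>S\<close>, because a lower bound
  \<open>ln q / 2\<close> for all chain lengths passes to the infimum directly.\<close>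

lemma K_half_space:
  assumes "x \<in> D" "y \<in> D" and a: "\<And>x. x \<in> D \<Longrightarrow> a \<bullet> x < c"
  shows "cmod (hermitian a (x - y)) \<le> (exp (2 * K x y) - 1) * (c - a \<bullet> x)"
proof -
  define q where "q = cmod (hermitian a (x - y)) / (c - a \<bullet> x) + 1"
  have pos: "0 < c - a \<bullet> x" using a assms by simp
  have q: "1 \<le> q" using pos by (simp add: q_def)
  have "ln q / 2 \<le> K x y"
  proof (rule K_greatest[OF assms(1,2)])
    fix S assume "kobayashi_reach D x y S"
    from kobayashi_reach_half_space[OF this a] have "q \<le> exp (2 * S)"
      using pos by (simp add: q_def field_simps)
    then have "ln q \<le> ln (exp (2 * S))" using q by (intro ln_mono) auto
    then show "ln q / 2 \<le> S" by simp
  qed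
  then have "exp (ln q) \<le> exp (2 * K x y)" by simp
  then have "q \<le> exp (2 * K x y)" using q by simp
  then show ?thesis using pos by (simp add: q_def field_simps)
qed

lemma K_half_space_ratio:
  assumes "x \<in> D" "y \<in> D" and a: "\<And>x. x \<in> D \<Longrightarrow> a \<bullet> x < c"
  shows "c - a \<bullet> x \<le> exp (2 * K x y) * (c - a \<bullet> y)"
proof -
  have "a \<bullet> y - a \<bullet> x \<le> cmod (hermitian a (y - x))"
    using complex_Re_le_cmod[of "hermitian a (y - x)"] by (simp add: Re_hermitian inner_diff_right)
  then show ?thesis using K_half_space[OF assms(2,1) a] by (simp add: K_sym algebra_simps)
qed

section \<open>Separation by half-spaces\<close>

lemma outside_closure_halfspace:
  assumes "y \<notin> closure D"
  obtains a c where "\<And>x. x \<in> D \<Longrightarrow> a \<bullet> x < c" "c < a \<bullet> y"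
proof -
  obtain a b where ab: "a \<bullet> y < b" "\<And>x. x \<in> closure D \<Longrightarrow> b < a \<bullet> x"
    using separating_hyperplane_closed_point[of "closure D" y] D_convex assms by (auto intro: convex_closure)
  show ?thesis by (rule that[of "- a" "- b"]) (use ab closure_subset in \<open>auto\<close>)
qed

text \<open>Boundary points are included, hence only \<open>c \<le> a \<bullet> y\<close>. On
  \<open>D\<close> the inequality is strict because a small step in direction \<open>a\<close> stays
  in the open set \<open>D\<close>.\<close>

lemma outside_halfspace:
  assumes "y \<notin> D"
  obtains a c where "\<And>x. x \<in> D \<Longrightarrow> a \<bullet> x < c" "c \<le> a \<bullet> y"
proof -
  have "\<exists>a b. a \<noteq> 0 \<and> (\<forall>x\<in>D. a \<bullet> x \<le> b) \<and> (\<forall>x\<in>{y}. b \<le> a \<bullet> x)"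
    by (rule separating_hyperplane_sets) (use D_convex D_nonempty assms in auto)
  then obtain a b where ab: "a \<noteq> 0" "\<forall>x\<in>D. a \<bullet> x \<le> b" "b \<le> a \<bullet> y" by auto
  have "a \<bullet> x < b" if x: "x \<in> D" for x
  proof -
    obtain e where e: "e > 0" "ball x e \<subseteq> D" using D_open x open_contains_ball by blast
    define x' where "x' = x + (e / (2 * norm a)) *\<^sub>R a"
    have "x' \<in> ball x e" using e ab(1) by (simp add: x'_def dist_norm)
    then have "a \<bullet> x' \<le> b" using e ab by blast
    moreover have "a \<bullet> x' = a \<bullet> x + e / (2 * norm a) * (a \<bullet> a)" by (simp add: x'_def inner_add_right)
    moreover have "0 < e / (2 * norm a) * (a \<bullet> a)" using e ab(1) by simp
    ultimately show ?thesis by linarith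
  qed
  then show ?thesis using that ab(3) by blast
qed

text \<open>If all these functionals vanished at \<open>v\<close>, the closure and hence \<open>D\<close> would contain a complex
  line in direction \<open>v\<close>.\<close>

lemma halfspaces_separate:
  assumes "\<And>a c. (\<And>x. x \<in> D \<Longrightarrow> a \<bullet> x < c) \<Longrightarrow> hermitian a v = 0"
  shows "v = 0"
proof (rule ccontr)
  assume v: "v \<noteq> 0"
  obtain p where p: "p \<in> D" using D_nonempty by blast
  have cl: "p + z *s v \<in> closure D" for z
  proof (rule ccontr)
    assume "p + z *s v \<notin> closure D"
    then obtain a c where a: "\<And>x. x \<in> D \<Longrightarrow> a \<bullet> x < c" "c < a \<bullet> (p + z *s v)"
      using outside_closure_halfspace by blast
    have "a \<bullet> (p + z *s v) = a \<bullet> p + Re (z * hermitian a v)"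
      by (simp add: inner_add_right Re_hermitian flip: hermitian_smult)
    then show False using assms[OF a(1)] a(2) a(1)[OF p] by simp
  qed
  have "p + z *s v \<in> D" for z
  proof -
    have "p + of_real (1/2) *s (p + (2 * z) *s v - p) \<in> D"
      by (rule in_open_segment_interior[OF D_convex D_open p cl]) auto
    then show ?thesis by (simp add: vec_eq_iff)
  qed
  then show False using no_line[OF v] by blast
qed

lemma K_eq_0D:
  assumes "x \<in> D" "y \<in> D" "K x y = 0"
  shows "x = y"
proof -
  have "x - y = 0"
    by (rule halfspaces_separate) (use K_half_space[OF assms(1,2)] assms(3) in fastforce)
  then show ?thesis by simp
qed

lemma K_continuous: "z \<in> D \<Longrightarrow> continuous_on D (K z)"
  unfolding continuous_on_iff
proof (intro ballI allI impI)
  fix w and e :: real assume z: "z \<in> D" and w: "w \<in> D" and e: "0 < (e::real)"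
  obtain \<epsilon> where \<epsilon>: "\<epsilon> > 0" "\<And>u. norm (u - w) < \<epsilon> \<Longrightarrow> u \<in> D \<and> K w u \<le> artanh (norm (u - w) / \<epsilon>)"
    using K_le_near[OF w] by blast
  define r where "r = tanh (e / 2)"
  have r: "0 < r" "r < 1" using e tanh_real_bounds[of "e/2"] by (auto simp: r_def)
  show "\<exists>d>0. \<forall>x'\<in>D. dist x' w < d \<longrightarrow> dist (K z x') (K z w) < e"
  proof (intro exI[of _ "\<epsilon> * r"] conjI ballI impI)
    fix u assume u: "u \<in> D" "dist u w < \<epsilon> * r"
    have "norm (u - w) / \<epsilon> \<le> r" using u \<epsilon>(1) by (simp add: dist_norm field_simps)
    moreover have "\<epsilon> * r < \<epsilon> * 1" using r \<epsilon> by (intro mult_strict_left_mono) auto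
    then have "norm (u - w) < \<epsilon>" using u by (simp add: dist_norm)
    ultimately have "K w u \<le> artanh r"
      using \<epsilon> artanh_real_mono[of "norm (u - w) / \<epsilon>" r] r by fastforce
    then have "K w u < e" using e by (simp add: r_def artanh_tanh_real)
    then show "dist (K z u) (K z w) < e"
      using K_tri[OF z w u(1)] K_tri[OF z u(1) w] K_sym[of u w] by (simp add: dist_real_def)
  qed (use r \<epsilon> in auto)
qed

section \<open>Properness, the Euclidean topology and geodesics\<close>

lemma K_tendsto_0:
  assumes "z \<in> D" "\<And>n. w n \<in> D" "w \<longlonglongrightarrow> z"
  shows "(\<lambda>n. K z (w n)) \<longlonglongrightarrow> 0"
  using continuous_on_tendsto_compose[OF K_continuous[OF assms(1)] assms(3,1)] assms(2) K_refl[OF assms(1)]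
  by simp

text \<open>If the ball were unbounded, normalised differences \<open>u n\<close> would accumulate
  at a unit vector \<open>l\<close>. For each half-space containing \<open>D\<close>,
  \<open>K_half_space\<close> keeps \<open>hermitian a (z n - p)\<close> bounded, so all these forms
  vanish at \<open>l\<close>, against \<open>halfspaces_separate\<close>.\<close>

lemma K_ball_bounded:
  assumes "p \<in> D"
  shows "bounded {z \<in> D. K p z \<le> R}"
proof (rule ccontr)
  assume "\<not> ?thesis"
  then have "\<forall>n::nat. \<exists>z. z \<in> D \<and> K p z \<le> R \<and> real n + 1 < norm (z - p)"
  proof (intro allI)
    fix n :: nat assume nb: "\<not> bounded {z \<in> D. K p z \<le> R}"
    show "\<exists>z. z \<in> D \<and> K p z \<le> R \<and> real n + 1 < norm (z - p)"
    proof (rule ccontr)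
      assume "\<not> ?thesis"
      then have "{z \<in> D. K p z \<le> R} \<subseteq> cball p (real n + 1)"
        by (auto simp: dist_norm norm_minus_commute not_less)
      then show False using nb bounded_cball bounded_subset by blast
    qed
  qed
  then obtain z where z: "\<And>n. z n \<in> D" "\<And>n. K p (z n) \<le> R" "\<And>n::nat. real n + 1 < norm (z n - p)"
    by metis
  define u where "u = (\<lambda>n. of_real (1 / norm (z n - p)) *s (z n - p))"
  have zpos: "0 < norm (z n - p)" for n using z(3)[of n] by linarith
  have "u n \<in> sphere 0 1" for n
  proof -
    have "norm (u n) = 1 / norm (z n - p) * norm (z n - p)" unfolding u_def norm_vector_smult
      by (simp only: norm_of_real) simp
    then show ?thesis using zpos[of n] by simp
  qed
  then obtain l r where l: "l \<in> sphere 0 1" "strict_mono r" "(u \<circ> r) \<longlonglongrightarrow> l"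
    using seq_compactE[OF compact_imp_seq_compact[OF compact_sphere[of 0 1]], of u] by blast
  have "l = 0"
  proof (rule halfspaces_separate)
    fix a c assume a: "\<And>x. x \<in> D \<Longrightarrow> a \<bullet> x < c"
    define B where "B = (exp (2 * R) - 1) * (c - a \<bullet> p)"
    have B: "cmod (hermitian a (u n)) \<le> B / (real n + 1)" for n
    proof -
      have "cmod (hermitian a (p - z n)) \<le> (exp (2 * K p (z n)) - 1) * (c - a \<bullet> p)"
        by (rule K_half_space[OF assms z(1) a])
      also have "\<dots> \<le> B" unfolding B_def using z(2)[of n] a[OF assms] by (intro mult_right_mono) auto
      finally have h: "cmod (hermitian a (z n - p)) \<le> B" by (simp add: hermitian_diff norm_minus_commute)
      have "cmod (hermitian a (u n)) = cmod (hermitian a (z n - p)) / norm (z n - p)"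
        unfolding u_def hermitian_smult norm_mult norm_of_real by simp
      also have "\<dots> \<le> B / (real n + 1)"
        using h z(3)[of n] order_trans[OF norm_ge_zero h] by (intro frac_le) auto
      finally show ?thesis .
    qed
    have "(\<lambda>n. B / (real n + 1)) \<longlonglongrightarrow> 0" by real_asymp
    then have "(\<lambda>n. hermitian a (u n)) \<longlonglongrightarrow> 0"
      by (rule Lim_null_comparison[rotated]) (simp add: B)
    then have "(\<lambda>n. hermitian a ((u \<circ> r) n)) \<longlonglongrightarrow> 0"
      using LIMSEQ_subseq_LIMSEQ[OF _ l(2)] by (fastforce simp: o_def)
    then show "hermitian a l = 0" using tendsto_hermitian[OF l(3)] LIMSEQ_unique by blast
  qed
  then show False using l(1) by simp
qed

text \<open>At a limit outside \<open>D\<close> a supporting half-space would have a gap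
  \<open>c - a \<bullet> z n\<close> with limit at most 0, while \<open>K_half_space_ratio\<close>
  keeps it above a positive constant.\<close>

lemma K_ball_compact:
  assumes p: "p \<in> D"
  shows "compact {z \<in> D. K p z \<le> R}"
  unfolding compact_eq_bounded_closed
proof
  show "bounded {z \<in> D. K p z \<le> R}" by (rule K_ball_bounded[OF p])
  show "closed {z \<in> D. K p z \<le> R}" unfolding closed_sequential_limits
  proof (intro allI impI, elim conjE)
    fix z l assume z: "\<forall>n. z n \<in> {z \<in> D. K p z \<le> R}" and l: "z \<longlonglongrightarrow> l"
    have "l \<in> D"
    proof (rule ccontr)
      assume "l \<notin> D"
      then obtain a c where a: "\<And>x. x \<in> D \<Longrightarrow> a \<bullet> x < c" "c \<le> a \<bullet> l" using outside_halfspace by blast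
      have "c - a \<bullet> p \<le> exp (2 * R) * (c - a \<bullet> z n)" for n
      proof -
        have zn: "z n \<in> D" "K p (z n) \<le> R" using z by auto
        have "c - a \<bullet> p \<le> exp (2 * K p (z n)) * (c - a \<bullet> z n)"
          by (rule K_half_space_ratio[OF p zn(1) a(1)])
        also have "\<dots> \<le> exp (2 * R) * (c - a \<bullet> z n)"
          using zn a(1)[OF zn(1)] by (intro mult_right_mono) auto
        finally show ?thesis .
      qed
      then have ev: "\<exists>N. \<forall>n\<ge>N. c - a \<bullet> p \<le> exp (2 * R) * (c - a \<bullet> z n)" by blast
      have "(\<lambda>n. exp (2 * R) * (c - a \<bullet> z n)) \<longlonglongrightarrow> exp (2 * R) * (c - a \<bullet> l)"
        by (intro tendsto_intros l)
      then have "c - a \<bullet> p \<le> exp (2 * R) * (c - a \<bullet> l)"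
        using ev by (rule LIMSEQ_le_const)
      also have "\<dots> \<le> 0" using a(2) by (simp add: mult_nonneg_nonpos)
      finally show False using a(1)[OF p] by simp
    qed
    moreover have "(\<lambda>n. K p (z n)) \<longlonglongrightarrow> K p l"
      using continuous_on_tendsto_compose[OF K_continuous[OF p] l \<open>l \<in> D\<close>] z by simp
    then have "K p l \<le> R" using z by (intro LIMSEQ_le_const2) auto
    ultimately show "l \<in> {z \<in> D. K p z \<le> R}" by simp
  qed
qed

text \<open>On the compact set \<open>C\<close>, a unit \<open>K\<close>-ball without a Euclidean
  ball around \<open>z\<close>, the continuous function \<open>K z\<close> is bounded away from 0.
  So \<open>K\<close> induces the Euclidean topology.\<close>

lemma tendsto_of_K:
  assumes z: "z \<in> D" and w: "\<And>n. w n \<in> D" and lim: "(\<lambda>n. K z (w n)) \<longlonglongrightarrow> 0"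
  shows "w \<longlonglongrightarrow> z"
proof (rule tendstoI)
  fix e :: real assume e: "e > 0"
  define C where "C = {u \<in> D. K z u \<le> 1} - ball z e"
  have C: "compact C" unfolding C_def by (intro compact_diff K_ball_compact z) auto
  have "\<exists>m>0. \<forall>u\<in>C. m \<le> K z u"
  proof (cases "C = {}")
    case False
    have "continuous_on C (K z)" using K_continuous[OF z] by (rule continuous_on_subset) (auto simp: C_def)
    then obtain u where u: "u \<in> C" "\<forall>v\<in>C. K z u \<le> K z v"
      using continuous_attains_inf[OF C False] by blast
    have "z \<noteq> u" "u \<in> D" using u e by (auto simp: C_def)
    then have "0 < K z u" using K_nonneg[OF z] K_eq_0D[OF z] by force
    then show ?thesis using u by blast
  qed (use zero_less_one in blast)
  then obtain m where m: "m > 0" "\<And>u. u \<in> C \<Longrightarrow> m \<le> K z u" by blast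
  have "\<forall>\<^sub>F n in sequentially. K z (w n) < min m 1"
    using order_tendstoD(2)[OF lim, of "min m 1"] m by simp
  then show "\<forall>\<^sub>F n in sequentially. dist (w n) z < e"
  proof eventually_elim
    case (elim n)
    then have "w n \<notin> C" using m(2)[of "w n"] by force
    then show ?case using elim w[of n] by (auto simp: C_def dist_commute)
  qed
qed

text \<open>Almost optimal chains are cut at length \<open>s\<close>, and the cut points accumulate
  because \<open>K\<close>-balls are compact. If such a chain is shorter than \<open>s\<close>, the
  end \<open>y\<close> itself serves.\<close>

lemma K_between:
  assumes x: "x \<in> D" and y: "y \<in> D" and st: "0 \<le> s" "0 \<le> t" "K x y \<le> s + t"
  shows "\<exists>z\<in>D. K x z \<le> s \<and> K z y \<le> t"
proof -
  have "\<exists>z\<in>D. K x z \<le> s \<and> K z y \<le> t + 1 / real (Suc n)" for n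
  proof -
    obtain S where S: "kobayashi_reach D x y S" "S < s + t + 1 / real (Suc n)"
      using K_approx[OF x y, of "s + t + 1 / real (Suc n)"] st(3) by (smt (verit) divide_pos_pos of_nat_0_less_iff zero_less_Suc)
    show ?thesis
    proof (cases "s \<le> S")
      case True
      then obtain z where z: "kobayashi_reach D x z s" "kobayashi_reach D z y (S - s)"
        using kobayashi_reach_between[OF S(1) st(1)] by blast
      then show ?thesis
        using kobayashi_dist_le[OF z(1)] kobayashi_dist_le[OF z(2)] S(2) kobayashi_reach_mem(2)[OF z(1)] by force
    next
      case False
      have "K x y \<le> s" using kobayashi_dist_le[OF S(1)] False by simp
      moreover have "K y y \<le> t + 1 / real (Suc n)" using K_refl[OF y] st by simp
      ultimately show ?thesis using y by blast
    qed
  qed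
  then obtain z where z: "\<And>n. z n \<in> D" "\<And>n. K x (z n) \<le> s" "\<And>n. K (z n) y \<le> t + 1 / real (Suc n)"
    by metis
  have "\<forall>n. z n \<in> {u \<in> D. K x u \<le> s}" using z by simp
  then obtain l r where l: "l \<in> {u \<in> D. K x u \<le> s}" "strict_mono r" "(z \<circ> r) \<longlonglongrightarrow> l"
    using seq_compactE[OF compact_imp_seq_compact[OF K_ball_compact[OF x, of s]]] by blast
  have "(\<lambda>n. K y ((z \<circ> r) n)) \<longlonglongrightarrow> K y l"
    using continuous_on_tendsto_compose[OF K_continuous[OF y] l(3)] l(1) z(1) by simp
  moreover have "(\<lambda>n. t + 1 / real (Suc n)) \<longlonglongrightarrow> t" by real_asymp
  then have "((\<lambda>n. t + 1 / real (Suc n)) \<circ> r) \<longlonglongrightarrow> t" using l(2) LIMSEQ_subseq_LIMSEQ by blast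
  ultimately have "K y l \<le> t"
    by (rule LIMSEQ_le) (use z(3) K_sym in \<open>auto intro!: exI[of _ 0]\<close>)
  then show ?thesis using l(1) K_sym by auto
qed

text \<open>Maximal 1-Lipschitz relations between \<open>{0..L}\<close> and \<open>D\<close> are total: to extend one to \<open>t\<close>, finitely
  many conditions are implied by the two nearest to \<open>t\<close>, and the closed balls are compact.\<close>

lemma geodesic_exists:
  assumes x: "x \<in> D" and y: "y \<in> D"
  shows "\<exists>S. geodesic_segment D K x y S"
proof -
  define L where "L = K x y"
  have L: "0 \<le> L" using K_nonneg x y by (simp add: L_def)
  define \<A> where "\<A> = {R. R \<subseteq> {0..L} \<times> D \<and> (0, x) \<in> R \<and> (L, y) \<in> R \<and>
      (\<forall>a\<in>R. \<forall>b\<in>R. K (snd a) (snd b) \<le> \<bar>fst a - fst b\<bar>)}"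
  have "{(0, x), (L, y)} \<in> \<A>"
    using x y L K_refl K_sym[of x y] by (auto simp: \<A>_def L_def)
  moreover have "\<Union>\<C> \<in> \<A>" if "\<C> \<noteq> {}" "subset.chain \<A> \<C>" for \<C>
  proof -
    have C: "\<C> \<subseteq> \<A>" "\<And>R R'. R \<in> \<C> \<Longrightarrow> R' \<in> \<C> \<Longrightarrow> R \<subseteq> R' \<or> R' \<subseteq> R"
      using that(2) by (auto simp: subset.chain_def)
    have "K (snd a) (snd b) \<le> \<bar>fst a - fst b\<bar>" if "a \<in> R" "b \<in> R'" "R \<in> \<C>" "R' \<in> \<C>" for a b R R'
      using C that unfolding \<A>_def by blast
    then show ?thesis using C(1) that(1) unfolding \<A>_def by blast
  qed
  ultimately obtain R where R: "R \<in> \<A>" and max: "\<And>R'. R' \<in> \<A> \<Longrightarrow> R \<subseteq> R' \<Longrightarrow> R' = R"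
    using subset_Zorn_nonempty[of \<A>] by (metis empty_iff)
  have Rsub: "R \<subseteq> {0..L} \<times> D" and R0: "(0, x) \<in> R" and RL: "(L, y) \<in> R"
    and Lip: "\<And>a b. a \<in> R \<Longrightarrow> b \<in> R \<Longrightarrow> K (snd a) (snd b) \<le> \<bar>fst a - fst b\<bar>"
    using R unfolding \<A>_def by auto
  have total: "\<exists>z. (t, z) \<in> R" if t: "t \<in> {0..L}" for t
  proof -
    define F where "F = (\<lambda>a. {z \<in> D. K (snd a) z \<le> \<bar>t - fst a\<bar>})"
    have cF: "compact (F a)" if "a \<in> R" for a
      unfolding F_def using that Rsub by (intro K_ball_compact) auto
    have "F (0, x) \<inter> (\<Inter>a\<in>R. F a) \<noteq> {}"
    proof (rule compact_imp_fip_image)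
      show "compact (F (0, x))" using cF R0 by blast
      show "closed (F a)" if "a \<in> R" for a using cF that compact_imp_closed by blast
      fix I assume I: "finite I" "I \<subseteq> R"
      \<comment> \<open>\<open>A\<close> and \<open>B\<close> collect the entries before and after
        \<open>t\<close>; the two end pairs are inserted so that neither is empty and the nearest
        entries \<open>a\<close> and \<open>b\<close> exist.\<close>
      define A where "A = insert (0, x) {a \<in> I. fst a \<le> t}"
      define B where "B = insert (L, y) {a \<in> I. t \<le> fst a}"
      have AB: "A \<subseteq> R" "B \<subseteq> R" "finite A" "finite B" using I R0 RL by (auto simp: A_def B_def)
      have "Max (fst ` A) \<in> fst ` A" using AB by (intro Max_in) (auto simp: A_def)
      then obtain a where a: "a \<in> A" "fst a = Max (fst ` A)" by auto
      then have amax: "\<And>a'. a' \<in> A \<Longrightarrow> fst a' \<le> fst a" using AB by simp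
      have "Min (fst ` B) \<in> fst ` B" using AB by (intro Min_in) (auto simp: B_def)
      then obtain b where b: "b \<in> B" "fst b = Min (fst ` B)" by auto
      then have bmin: "\<And>b'. b' \<in> B \<Longrightarrow> fst b \<le> fst b'" using AB by simp
      have le: "fst a \<le> t" "t \<le> fst b" using a(1) b(1) t by (auto simp: A_def B_def)
      have abR: "a \<in> R" "b \<in> R" using a b AB by auto
      then have abD: "snd a \<in> D" "snd b \<in> D" using Rsub by auto
      obtain z where z: "z \<in> D" "K (snd a) z \<le> t - fst a" "K z (snd b) \<le> fst b - t"
        using K_between[OF abD, of "t - fst a" "fst b - t"] Lip[OF abR] le by auto
      have "z \<in> F c" if c: "c \<in> insert (0, x) I" for c
      proof -
        have cR: "c \<in> R" "snd c \<in> D" using c I R0 Rsub by auto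
        have "K (snd c) z \<le> \<bar>t - fst c\<bar>"
        proof (cases "fst c \<le> t")
          case True
          then have "c \<in> A" using c by (auto simp: A_def)
          then have "fst c \<le> fst a" by (rule amax)
          then show ?thesis using Lip[OF cR(1) abR(1)] K_tri[OF cR(2) abD(1) z(1)] z(2) le by auto
        next
          case False
          then have "c \<in> B" using c t by (auto simp: B_def)
          then have "fst b \<le> fst c" by (rule bmin)
          then show ?thesis
            using Lip[OF cR(1) abR(2)] K_tri[OF cR(2) abD(2) z(1)] z(3) le K_sym[of z] by auto
        qed
        then show ?thesis using z(1) by (simp add: F_def)
      qed
      then show "F (0, x) \<inter> (\<Inter>a\<in>I. F a) \<noteq> {}" by blast
    qed
    then obtain z where z: "\<And>a. a \<in> R \<Longrightarrow> z \<in> F a" by blast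
    then have zD: "z \<in> D" using R0 by (auto simp: F_def)
    have "insert (t, z) R \<in> \<A>"
      using R z zD t K_refl[OF zD] K_sym unfolding \<A>_def F_def by (auto simp: abs_minus_commute)
    then have "insert (t, z) R = R" by (rule max) blast
    then show ?thesis by blast
  qed
  define \<gamma> where "\<gamma> = (\<lambda>t. SOME z. (t, z) \<in> R)"
  have \<gamma>: "(t, \<gamma> t) \<in> R" if "t \<in> {0..L}" for t
    unfolding \<gamma>_def using total[OF that] by (rule someI_ex)
  have \<gamma>D: "\<gamma> t \<in> D" if "t \<in> {0..L}" for t using \<gamma>[OF that] Rsub by auto
  have \<gamma>L: "K (\<gamma> s) (\<gamma> t) \<le> \<bar>s - t\<bar>" if "s \<in> {0..L}" "t \<in> {0..L}" for s t
    using Lip[OF \<gamma>[OF that(1)] \<gamma>[OF that(2)]] by simp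
  have \<gamma>0: "\<gamma> 0 = x"
  proof (rule K_eq_0D)
    show "K (\<gamma> 0) x = 0" using Lip[OF \<gamma>[of 0] R0] L K_nonneg[OF \<gamma>D[of 0] x] by auto
  qed (use \<gamma>D L x in auto)
  have \<gamma>1: "\<gamma> L = y"
  proof (rule K_eq_0D)
    show "K (\<gamma> L) y = 0" using Lip[OF \<gamma>[of L] RL] L K_nonneg[OF \<gamma>D[of L] y] by auto
  qed (use \<gamma>D L y in auto)
  \<comment> \<open>A 1-Lipschitz curve on an interval of length \<open>K x y\<close> from
    \<open>x\<close> to \<open>y\<close> cannot shorten any of its parts, so it is an
    isometry.\<close>
  have ge: "t - s \<le> K (\<gamma> s) (\<gamma> t)" if st: "s \<in> {0..L}" "t \<in> {0..L}" "s \<le> t" for s t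
  proof -
    have "L \<le> K x (\<gamma> s) + K (\<gamma> s) (\<gamma> t) + K (\<gamma> t) y"
      using K_tri[OF x \<gamma>D[OF st(1)] y] K_tri[OF \<gamma>D[OF st(1)] \<gamma>D[OF st(2)] y] by (simp add: L_def)
    moreover have "K x (\<gamma> s) \<le> s" using \<gamma>L[of 0 s] st L \<gamma>0 by auto
    moreover have "K (\<gamma> t) y \<le> L - t" using \<gamma>L[of t L] st L \<gamma>1 by auto
    ultimately show ?thesis by simp
  qed
  have "K (\<gamma> s) (\<gamma> t) = \<bar>s - t\<bar>" if "s \<in> {0..L}" "t \<in> {0..L}" for s t
    using ge[of s t] ge[of t s] \<gamma>L[of s t] that K_sym[of "\<gamma> s" "\<gamma> t"] by (cases "s \<le> t") auto
  then have "geodesic_segment D K x y (\<gamma> ` {0..L})"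
    unfolding geodesic_segment_def using L \<gamma>0 \<gamma>1 \<gamma>D by (intro exI[of _ \<gamma>] exI[of _ L]) auto
  then show ?thesis by blast
qed

text \<open>A half-space excluding \<open>p n + l *s (p' n - p n)\<close> would contradict
  \<open>K_half_space\<close>, because its gap at \<open>p n\<close> would be too small for the
  change of the form between \<open>p n\<close> and \<open>p' n\<close>. With distinct boundary
  limits, this is how complex discs in the boundary arise.\<close>

lemma disc_in_closure:
  assumes p: "\<And>n. p n \<in> D" "\<And>n. p' n \<in> D" "\<And>n. K (p n) (p' n) \<le> C"
    and lim: "p \<longlonglongrightarrow> \<xi>" "p' \<longlonglongrightarrow> \<eta>" and l: "cmod l * (exp (2 * C) - 1) < 1"
  shows "\<xi> + l *s (\<eta> - \<xi>) \<in> closure D"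
proof -
  have "p n + l *s (p' n - p n) \<in> closure D" for n
  proof (rule ccontr)
    assume "\<not> ?thesis"
    then obtain a c where a: "\<And>x. x \<in> D \<Longrightarrow> a \<bullet> x < c" "c < a \<bullet> (p n + l *s (p' n - p n))"
      using outside_closure_halfspace by blast
    have "c - a \<bullet> p n < Re (l * hermitian a (p' n - p n))"
    proof -
      have "a \<bullet> (l *s (p' n - p n)) = Re (l * hermitian a (p' n - p n))"
        by (simp only: Re_hermitian[symmetric] hermitian_smult)
      then show ?thesis using a(2) unfolding inner_add_right by linarith
    qed
    also have "\<dots> \<le> cmod l * cmod (hermitian a (p n - p' n))"
      using complex_Re_le_cmod[of "l * hermitian a (p' n - p n)"]
      by (simp add: norm_mult hermitian_diff norm_minus_commute)
    also have "\<dots> \<le> cmod l * ((exp (2 * K (p n) (p' n)) - 1) * (c - a \<bullet> p n))"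
      by (intro mult_left_mono K_half_space p a(1)) auto
    also have "\<dots> \<le> cmod l * ((exp (2 * C) - 1) * (c - a \<bullet> p n))"
      using p(3)[of n] a(1)[OF p(1)[of n]] by (intro mult_left_mono mult_right_mono) auto
    also have "\<dots> = (cmod l * (exp (2 * C) - 1)) * (c - a \<bullet> p n)" by simp
    also have "\<dots> < 1 * (c - a \<bullet> p n)"
      using l a(1)[OF p(1)[of n]] by (intro mult_strict_right_mono) auto
    finally show False by simp
  qed
  moreover have "(\<lambda>n. p n + l *s (p' n - p n)) \<longlonglongrightarrow> \<xi> + l *s (\<eta> - \<xi>)"
    by (intro tendsto_intros lim)
  ultimately show ?thesis by (rule closed_sequentially[OF closed_closure])
qed

text \<open>The balls fill the cone over \<open>ball p r\<close> with apex \<open>b\<close>. The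
  point \<open>q\<close> of the proof is the preimage of \<open>x\<close> under the homothety with
  centre \<open>b\<close> and ratio \<open>1 - s\<close>.\<close>

lemma ball_in_cone:
  assumes "ball p r \<subseteq> D" "b \<in> closure D" "0 \<le> s" "s < 1"
  shows "ball (p + of_real s *s (b - p)) ((1 - s) * r) \<subseteq> D"
proof
  fix x assume x: "x \<in> ball (p + of_real s *s (b - p)) ((1 - s) * r)"
  define v where "v = x - (p + of_real s *s (b - p))"
  define q where "q = p + of_real (1 / (1 - s)) *s v"
  have "norm v < (1 - s) * r" using x by (simp add: v_def dist_norm norm_minus_commute)
  then have "\<bar>1 / (1 - s)\<bar> * norm v < r" using assms by (simp add: field_simps)
  then have "q \<in> ball p r" by (simp add: q_def dist_norm norm_vector_smult del: of_real_divide)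
  then have "q + of_real s *s (b - q) \<in> D"
    using assms D_convex D_open by (intro in_open_segment_interior) auto
  moreover have "q + of_real s *s (b - q) = x"
  proof -
    have "q + of_real s *s (b - q) = p + of_real s *s (b - p) + (of_real (1 - s) * of_real (1 / (1 - s))) *s v"
      by (simp add: q_def vec_eq_iff algebra_simps del: of_real_divide)
    also have "(of_real (1 - s) * of_real (1 / (1 - s)) :: complex) = 1"
      using assms by (simp flip: of_real_mult)
    finally show ?thesis by (simp add: v_def)
  qed
  ultimately show "x \<in> D" by simp
qed

text \<open>The length found in \<open>kobayashi_reach_segment\<close>, named because only its
  dependence on the relative width \<open>\<epsilon>\<close> matters from here on.\<close>

definition chain_bound :: "real \<Rightarrow> real" where
  "chain_bound \<epsilon> = real (nat \<lceil>2 / \<epsilon>\<rceil>) * artanh (1 / (real (nat \<lceil>2 / \<epsilon>\<rceil>) * \<epsilon>))"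

lemma K_le_chain_bound:
  assumes "0 < \<epsilon>"
    and "\<And>t \<mu>. \<lbrakk>0 \<le> t; t \<le> 1; cmod \<mu> < \<epsilon>\<rbrakk> \<Longrightarrow> z + (of_real t + \<mu>) *s (w - z) \<in> D"
  shows "K z w \<le> chain_bound \<epsilon>"
  using kobayashi_dist_le[OF kobayashi_reach_segment[OF assms]] by (simp add: chain_bound_def)

text \<open>By \<open>ball_in_cone\<close> there is room \<open>(1 - t) * r\<close> around every
  point up to parameter \<open>t\<close>, and the step has length
  \<open>(t - s) * norm (b - p)\<close>. The condition on \<open>\<epsilon>\<close> compares the
  two.\<close>

lemma K_straight_step:
  assumes ball: "ball p r \<subseteq> D" and b: "b \<in> closure D" and st: "0 \<le> s" "s \<le> t" "t < 1"
    and \<epsilon>: "0 < \<epsilon>" "\<epsilon> * ((t - s) * norm (b - p)) \<le> (1 - t) * r"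
    and r: "0 < r"
  shows "K (p + of_real s *s (b - p)) (p + of_real t *s (b - p)) \<le> chain_bound \<epsilon>"
proof (rule K_le_chain_bound[OF \<epsilon>(1)])
  fix \<theta> :: real and \<mu> :: complex assume \<theta>: "0 \<le> \<theta>" "\<theta> \<le> 1" and \<mu>: "cmod \<mu> < \<epsilon>"
  define s' where "s' = s + \<theta> * (t - s)"
  have "\<theta> * (t - s) \<le> 1 * (t - s)" using \<theta> st by (intro mult_right_mono) auto
  then have s': "0 \<le> s'" "s' \<le> t" using \<theta> st by (auto simp: s'_def)
  define x where "x = (\<mu> * of_real (t - s)) *s (b - p)"
  have eq: "p + of_real s *s (b - p) + (of_real \<theta> + \<mu>) *s
      (p + of_real t *s (b - p) - (p + of_real s *s (b - p))) = p + of_real s' *s (b - p) + x"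
    by (simp add: s'_def x_def vec_eq_iff algebra_simps)
  have "norm x = cmod \<mu> * ((t - s) * norm (b - p))"
    unfolding x_def norm_vector_smult norm_mult norm_of_real using st by simp
  also have "\<dots> \<le> \<epsilon> * ((t - s) * norm (b - p))" using \<mu> st by (intro mult_right_mono) auto
  finally have nx: "norm x \<le> (1 - t) * r" using \<epsilon>(2) by simp
  \<comment> \<open>For \<open>x = 0\<close>, which covers \<open>s = t\<close> and
    \<open>b = p\<close>, the strict inequality for \<open>\<mu>\<close> may be lost on
    multiplication, and strictness comes from \<open>s' < 1\<close> instead.\<close>
  have "norm x < (1 - s') * r"
  proof (cases "x = 0")
    case True
    then show ?thesis using s' st r by simp
  next
    case False
    then have "t - s > 0" "norm (b - p) > 0" using st by (auto simp: x_def)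
    then have "norm x < \<epsilon> * ((t - s) * norm (b - p))"
      unfolding \<open>norm x = cmod \<mu> * ((t - s) * norm (b - p))\<close> using \<mu> by (intro mult_strict_right_mono) auto
    also have "\<dots> \<le> (1 - t) * r" by (rule \<epsilon>)
    also have "\<dots> \<le> (1 - s') * r" using s' r by (intro mult_right_mono) auto
    finally show ?thesis .
  qed
  then have "p + of_real s' *s (b - p) + x \<in> ball (p + of_real s' *s (b - p)) ((1 - s') * r)"
    by (simp add: dist_norm)
  then have "p + of_real s' *s (b - p) + x \<in> D"
    using ball_in_cone[OF ball b s'(1)] s' st by auto
  then show "p + of_real s *s (b - p) + (of_real \<theta> + \<mu>) *s
      (p + of_real t *s (b - p) - (p + of_real s *s (b - p))) \<in> D"
    unfolding eq .
qed

end

locale hyperbolic_domain = cproper_convex D + geodesic_hyperbolic D "kobayashi_dist D" \<delta>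
  for D :: "(complex^'d) set" and \<delta>

lemma gromov_hyperbolic_domain:
  assumes "complex_proper_convex_domain D" "gromov_hyperbolic D (kobayashi_dist D)"
  obtains \<delta> where "hyperbolic_domain D \<delta>"
proof -
  interpret cproper_convex D by unfold_locales (rule assms)
  obtain \<delta> where "\<delta> \<ge> 0" and thin: "\<forall>x y z A B C.
        geodesic_segment D K x y A \<and> geodesic_segment D K y z B \<and> geodesic_segment D K z x C \<longrightarrow>
        (\<forall>p\<in>A. \<exists>q\<in>B \<union> C. K p q \<le> \<delta>)"
    using assms(2) unfolding gromov_hyperbolic_def by blast
  have "hyperbolic_domain D \<delta>"
  proof unfold_locales
    show "\<exists>S. geodesic_segment D K x y S" if "x \<in> D" "y \<in> D" for x y using geodesic_exists that .
    show "\<exists>q\<in>B \<union> C. K p q \<le> \<delta>" if "geodesic_segment D K x y A" "geodesic_segment D K y z B"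
      "geodesic_segment D K z x C" "p \<in> A" for x y z p A B C using thin that by blast
  qed (use \<open>\<delta> \<ge> 0\<close> K_nonneg K_refl K_sym K_tri in auto)
  then show ?thesis by (rule that)
qed

section \<open>Straight segments compared with geodesics\<close>

context hyperbolic_domain
begin

text \<open>The segment from \<open>p\<close> through \<open>w\<close> to a boundary point
  \<open>b\<close> is a quasi-geodesic with constants uniform for bounded \<open>w\<close>: the cone
  over a ball at \<open>p\<close> gives the upper bound, and a supporting half-space at
  \<open>b\<close>, whose gap decays like \<open>exp (- \<tau>)\<close>, gives the lower
  bound.\<close>

lemma straight_near_geodesic:
  assumes p: "p \<in> D"
  obtains C where "\<And>w S q. \<lbrakk>w \<in> D; norm (w - p) \<le> R; seg p w S; q \<in> S\<rbrakk> \<Longrightarrow>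
    \<exists>t\<in>{0..1}. p + of_real t *s (w - p) \<in> D \<and> K q (p + of_real t *s (w - p)) \<le> C"
proof -
  obtain r where r: "r > 0" "ball p r \<subseteq> D" using D_open p open_contains_ball by blast
  define R' where "R' = \<bar>R\<bar> + 1"
  have R': "R' > 0" "R \<le> R'" by (auto simp: R'_def)
  \<comment> \<open>In one unit of time the room around the segment shrinks by at most the factor
    \<open>exp (-1)\<close>, and \<open>norm (b - p) \<le> 2 * R'\<close>.\<close>
  define K0 where "K0 = chain_bound (r * exp (-1) / (2 * R'))"
  obtain C where C: "\<And>p \<Lambda> S q. \<lbrakk>0 \<le> \<Lambda>; \<And>\<tau>. \<tau> \<in> {0..\<Lambda>} \<Longrightarrow> p \<tau> \<in> D;
      \<And>\<tau> \<tau>'. \<lbrakk>\<tau> \<in> {0..\<Lambda>}; \<tau>' \<in> {0..\<Lambda>}; \<bar>\<tau> - \<tau>'\<bar> \<le> 1\<rbrakk> \<Longrightarrow> K (p \<tau>) (p \<tau>') \<le> K0;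
      \<And>\<tau> \<tau>'. \<lbrakk>\<tau> \<in> {0..\<Lambda>}; \<tau>' \<in> {0..\<Lambda>}\<rbrakk> \<Longrightarrow> \<bar>\<tau> - \<tau>'\<bar> / 2 \<le> K (p \<tau>) (p \<tau>');
      seg (p 0) (p \<Lambda>) S; q \<in> S\<rbrakk> \<Longrightarrow> \<exists>\<tau>\<in>{0..\<Lambda>}. K q (p \<tau>) \<le> C"
    by (rule geodesic_near_quasi_geodesic[of K0]) blast
  define C' where "C' = max C (chain_bound (r / (2 * R')))"
  have "\<exists>t\<in>{0..1}. p + of_real t *s (w - p) \<in> D \<and> K q (p + of_real t *s (w - p)) \<le> C'"
    if w: "w \<in> D" "norm (w - p) \<le> R" and S: "seg p w S" "q \<in> S" for w S q
  proof (cases "p + of_real 2 *s (w - p) \<in> closure D")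
    case True
    \<comment> \<open>Here \<open>w\<close> is the midpoint of \<open>p\<close> and a point
      \<open>b\<close> of the closure, so \<open>K p w\<close> is bounded and the whole geodesic
      stays near \<open>p\<close>.\<close>
    define b where "b = p + of_real 2 *s (w - p)"
    have nb: "norm (b - p) \<le> 2 * R'" 
    proof -
      have "norm (b - p) = 2 * norm (w - p)"
        unfolding b_def add_diff_cancel_left' norm_vector_smult norm_of_real by simp
      then show ?thesis using w R' by simp
    qed
    have "K (p + of_real 0 *s (b - p)) (p + of_real (1/2) *s (b - p)) \<le> chain_bound (r / (2 * R'))"
    proof (rule K_straight_step[OF r(2)])
      have "r / (2 * R') * ((1 / 2 - 0) * norm (b - p)) \<le> r / (2 * R') * ((1 / 2 - 0) * (2 * R'))"
        using nb r R' by (intro mult_left_mono) auto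
      then show "r / (2 * R') * ((1 / 2 - 0) * norm (b - p)) \<le> (1 - 1 / 2) * r" using R' by simp
    qed (use True b_def r R' in auto)
    moreover have "p + of_real (1/2) *s (b - p) = w" by (simp add: b_def vec_eq_iff)
    ultimately have "K p w \<le> C'" by (simp add: C'_def)
    moreover have qD: "q \<in> D" using S seg_subset by blast
    ultimately have "K q p \<le> C'" using seg_dist(2)[OF S(1,2,2)] K_nonneg[OF qD w(1)] K_sym[of p q] by simp
    then show ?thesis using p by (intro bexI[of _ 0]) auto
  next
    case False
    define u where "u = p + of_real 2 *s (w - p)"
    have "closed_segment w u \<inter> frontier D \<noteq> {}"
      by (rule connected_Int_frontier) (use w False closure_subset in \<open>auto simp: u_def\<close>)
    then obtain b where b: "b \<in> closed_segment w u" "b \<in> frontier D" by blast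
    have bcl: "b \<in> closure D" "b \<notin> D" using b D_open by (auto simp: frontier_def interior_open)
    obtain s where s: "0 \<le> s" "s \<le> 1" "b = (1 - s) *\<^sub>R w + s *\<^sub>R u" using b unfolding in_segment by blast
    define T where "T = 1 + s"
    have bT: "b - p = of_real T *s (w - p)"
      unfolding s(3) T_def u_def scaleR_eq_smult by (simp add: vec_eq_iff algebra_simps)
    have "T \<noteq> 1" using bT bcl w by auto
    then have T: "1 < T" "T \<le> 2" using s by (auto simp: T_def)
    have nb: "norm (b - p) \<le> 2 * R'"
    proof -
      have "norm (b - p) = T * norm (w - p)" unfolding bT norm_vector_smult using T by simp
      also have "\<dots> \<le> 2 * R'" using T w R' by (intro mult_mono) auto
      finally show ?thesis .
    qed
    \<comment> \<open>At time \<open>\<tau>\<close> the fraction \<open>exp (- \<tau>)\<close> of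
      the way to \<open>b\<close> remains, and \<open>\<Lambda>\<close> is the time at which
      \<open>w\<close> is reached.\<close>
    define c where "c = (\<lambda>\<tau>. p + of_real (1 - exp (- \<tau>)) *s (b - p))"
    define \<Lambda> where "\<Lambda> = - ln (1 - 1 / T)"
    have T1: "0 < 1 - 1 / T" "1 - 1 / T \<le> 1" using T by auto
    have L0: "0 \<le> \<Lambda>" using T1 by (simp add: \<Lambda>_def)
    have eL: "exp (- \<Lambda>) = 1 - 1 / T" using T1 by (simp add: \<Lambda>_def)
    have c0: "c 0 = p" by (simp add: c_def)
    have cL: "c \<Lambda> = w"
    proof -
      have "complex_of_real (1 / T) * of_real T = 1" using T by (simp flip: of_real_mult)
      then show ?thesis unfolding c_def eL bT by (simp only: vec.scale_scale) simp
    qed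
    have cD: "c \<tau> \<in> D" if "\<tau> \<in> {0..\<Lambda>}" for \<tau>
      unfolding c_def using that bcl p by (intro in_open_segment_interior[OF D_convex D_open]) auto
    have up: "K (c \<tau>) (c \<tau>') \<le> K0" if "\<tau> \<in> {0..\<Lambda>}" "\<tau> \<le> \<tau>'" "\<tau>' \<le> \<tau> + 1" for \<tau> \<tau>'
      unfolding c_def K0_def
    proof (rule K_straight_step[OF r(2) bcl(1)])
      have "r * exp (-1) / (2 * R') * ((1 - exp (-\<tau>') - (1 - exp (-\<tau>))) * norm (b - p))
          \<le> r * exp (-1) / (2 * R') * (exp (-\<tau>) * (2 * R'))"
        using nb r R' that by (intro mult_left_mono mult_mono) auto
      also have "\<dots> = r * (exp (-1) * exp (-\<tau>))" using R' by simp
      also have "exp (-1) * exp (-\<tau>) = exp (- (\<tau> + 1))" by (simp flip: exp_add)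
      also have "r * exp (- (\<tau> + 1)) \<le> r * exp (-\<tau>')" using that r by simp
      finally show "r * exp (-1) / (2 * R') * ((1 - exp (-\<tau>') - (1 - exp (-\<tau>))) * norm (b - p))
          \<le> (1 - (1 - exp (-\<tau>'))) * r" by (simp add: mult.commute)
    qed (use that r R' in auto)
    obtain a k where "\<And>x. x \<in> D \<Longrightarrow> a \<bullet> x < k" "k \<le> a \<bullet> b" using outside_halfspace[OF bcl(2)] by blast
    then have a: "\<And>x. x \<in> D \<Longrightarrow> a \<bullet> x < a \<bullet> b" by fastforce
    have ac: "a \<bullet> b - a \<bullet> c \<tau> = exp (-\<tau>) * (a \<bullet> b - a \<bullet> p)" for \<tau>
      unfolding c_def scaleR_eq_smult[symmetric] by (simp add: inner_add_right inner_diff_right algebra_simps)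
    have low: "(\<tau>' - \<tau>) / 2 \<le> K (c \<tau>) (c \<tau>')" if "\<tau> \<in> {0..\<Lambda>}" "\<tau>' \<in> {0..\<Lambda>}" for \<tau> \<tau>'
    proof -
      have "exp (-\<tau>) * (a \<bullet> b - a \<bullet> p) \<le> (exp (2 * K (c \<tau>) (c \<tau>')) * exp (-\<tau>')) * (a \<bullet> b - a \<bullet> p)"
        using K_half_space_ratio[OF cD[OF that(1)] cD[OF that(2)] a] ac by simp
      then have "exp (-\<tau>) \<le> exp (2 * K (c \<tau>) (c \<tau>') + (-\<tau>'))"
        unfolding exp_add using a[OF p] by simp
      then show ?thesis by simp
    qed
    have "\<exists>\<tau>\<in>{0..\<Lambda>}. K q (c \<tau>) \<le> C"
    proof (rule C[OF L0 cD])
      show "K (c \<tau>) (c \<tau>') \<le> K0" if "\<tau> \<in> {0..\<Lambda>}" "\<tau>' \<in> {0..\<Lambda>}" "\<bar>\<tau> - \<tau>'\<bar> \<le> 1" for \<tau> \<tau>'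
        using up[of \<tau> \<tau>'] up[of \<tau>' \<tau>] that K_sym[of "c \<tau>" "c \<tau>'"] by (cases "\<tau> \<le> \<tau>'") auto
      show "\<bar>\<tau> - \<tau>'\<bar> / 2 \<le> K (c \<tau>) (c \<tau>')" if "\<tau> \<in> {0..\<Lambda>}" "\<tau>' \<in> {0..\<Lambda>}" for \<tau> \<tau>'
        using low[OF that] low[OF that(2,1)] K_sym[of "c \<tau>" "c \<tau>'"] by (cases "\<tau> \<le> \<tau>'") auto
    qed (use S c0 cL in auto)
    then obtain \<tau> where \<tau>: "\<tau> \<in> {0..\<Lambda>}" "K q (c \<tau>) \<le> C" by blast
    define t where "t = (1 - exp (-\<tau>)) * T"
    have ct: "c \<tau> = p + of_real t *s (w - p)" unfolding c_def bT t_def by simp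
    have "exp (-\<Lambda>) \<le> exp (-\<tau>)" using \<tau> by simp
    then have "1 - exp (-\<tau>) \<le> 1 / T" using eL by simp
    then have "t \<le> 1" using T by (simp add: t_def field_simps)
    moreover have "0 \<le> t" using \<tau> T by (simp add: t_def)
    ultimately show ?thesis using \<tau> ct cD[OF \<tau>(1)] by (intro bexI[of _ t]) (auto simp: C'_def)
  qed
  then show ?thesis by (rule that)
qed

section \<open>Geodesics escaping to infinity\<close>

text \<open>A \<open>K\<close>-isometric curve is continuous for the Euclidean topology, in which
  spheres and components are taken later.\<close>

lemma geodesic_connected:
  assumes "seg x y S"
  shows "connected S"
proof -
  obtain \<gamma> L where *: "L \<ge> 0" "\<gamma> ` {0..L} \<subseteq> D" "\<gamma> 0 = x" "\<gamma> L = y"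
    "\<And>s t. s \<in> {0..L} \<Longrightarrow> t \<in> {0..L} \<Longrightarrow> K (\<gamma> s) (\<gamma> t) = \<bar>s - t\<bar>" "S = \<gamma> ` {0..L}"
    using assms by (rule geodesic_segmentE) blast
  have "continuous_on {0..L} \<gamma>" unfolding continuous_on_sequentially
  proof (intro allI ballI impI, elim conjE)
    fix f a assume a: "a \<in> {0..L}" and f: "\<forall>n. f n \<in> {0..L}" "f \<longlonglongrightarrow> a"
    show "(\<gamma> \<circ> f) \<longlonglongrightarrow> \<gamma> a"
    proof (rule tendsto_of_K)
      show "\<gamma> a \<in> D" "\<And>n. (\<gamma> \<circ> f) n \<in> D" using *(2) a f(1) by auto
      have "(\<lambda>n. \<bar>a - f n\<bar>) \<longlonglongrightarrow> \<bar>a - a\<bar>" by (intro tendsto_intros f(2))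
      then show "(\<lambda>n. K (\<gamma> a) ((\<gamma> \<circ> f) n)) \<longlonglongrightarrow> 0" using *(5)[OF a] f(1) by simp
    qed
  qed
  then show ?thesis unfolding *(6) by (rule connected_continuous_image) simp
qed

text \<open>As long as \<open>t j \<le> 1 - e\<close>, \<open>K_straight_step\<close> with end point
  \<open>w j\<close> bounds the distance from \<open>p\<close>, against the linear growth in
  \<open>far\<close>. Hence \<open>t j\<close> tends to 1.\<close>

lemma straight_points_tendsto:
  assumes p: "p \<in> D" and w: "\<And>j. w j \<in> D" "w \<longlonglongrightarrow> \<xi>" and t: "\<And>j. t j \<in> {0..1}"
    and far: "\<And>j. real j - c \<le> K p (p + of_real (t j) *s (w j - p))"
  shows "(\<lambda>j. p + of_real (t j) *s (w j - p)) \<longlonglongrightarrow> \<xi>"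
proof -
  obtain r where r: "r > 0" "ball p r \<subseteq> D" using D_open p open_contains_ball by blast
  have "(\<lambda>j. w j - p) \<longlonglongrightarrow> \<xi> - p" by (intro tendsto_intros w)
  then have "bounded (range (\<lambda>j. w j - p))" by (rule convergent_imp_bounded)
  then obtain R where R: "R > 0" "\<And>j. norm (w j - p) \<le> R" unfolding bounded_pos by auto
  have "t \<longlonglongrightarrow> 1"
  proof (rule LIMSEQ_I)
    fix e :: real assume e: "e > 0"
    define M where "M = chain_bound (e * r / R)"
    have "norm (t j - 1) < e" if j: "j \<ge> nat \<lceil>M + c\<rceil> + 1" for j
    proof (rule ccontr)
      assume "\<not> ?thesis"
      then have te: "t j \<le> 1 - e" using t[of j] by auto
      have "K (p + of_real 0 *s (w j - p)) (p + of_real (t j) *s (w j - p)) \<le> M"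
        unfolding M_def
      proof (rule K_straight_step[OF r(2)])
        have "t j * norm (w j - p) \<le> 1 * R" using t[of j] R by (intro mult_mono) auto
        then have "e * r / R * ((t j - 0) * norm (w j - p)) \<le> e * r / R * R"
          using e r R by (intro mult_left_mono) auto
        also have "\<dots> = e * r" using R by simp
        also have "\<dots> \<le> (1 - t j) * r" using te r by (intro mult_right_mono) auto
        finally show "e * r / R * ((t j - 0) * norm (w j - p)) \<le> (1 - t j) * r" .
      qed (use w(1)[of j] closure_subset t[of j] te e r R in auto)
      moreover have "M + c < real j" using j by linarith
      ultimately show False using far[of j] by simp
    qed
    then show "\<exists>no. \<forall>n\<ge>no. norm (t n - 1) < e" by blast
  qed
  then have "(\<lambda>j. p + of_real (t j) *s (w j - p)) \<longlonglongrightarrow> p + of_real 1 *s (\<xi> - p)"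
    by (intro tendsto_intros w)
  then show ?thesis by simp
qed

text \<open>The index \<open>j\<close> is also the radius of the ball avoided. Subsegments of later
  members, suitably reindexed, are therefore escaping again, and no separate sequence of radii is
  carried along.\<close>

definition escaping :: "complex^'d \<Rightarrow> (nat \<Rightarrow> complex^'d) \<Rightarrow> (nat \<Rightarrow> complex^'d) \<Rightarrow> (nat \<Rightarrow> (complex^'d) set) \<Rightarrow> bool"
  where "escaping p w v S \<longleftrightarrow> (\<forall>j. seg (w j) (v j) (S j) \<and> (\<forall>u\<in>S j. real j \<le> K p u))"

lemma escapingD:
  assumes "escaping p w v S"
  shows "seg (w j) (v j) (S j)" "u \<in> S j \<Longrightarrow> real j \<le> K p u"
    "w j \<in> D" "v j \<in> D" "w j \<in> S j" "v j \<in> S j" "u \<in> S j \<Longrightarrow> u \<in> D"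
proof -
  have s: "seg (w j) (v j) (S j)" and u: "\<forall>u\<in>S j. real j \<le> K p u" using assms unfolding escaping_def by auto
  show "seg (w j) (v j) (S j)" "w j \<in> D" "v j \<in> D" "w j \<in> S j" "v j \<in> S j" using s seg_subset[OF s] by auto
  show "u \<in> S j \<Longrightarrow> real j \<le> K p u" "u \<in> S j \<Longrightarrow> u \<in> D" using u seg_subset(1)[OF s] by auto
qed

lemma escaping_sub:
  assumes S: "escaping p w v S" and r: "\<And>j. j \<le> r j" and w': "\<And>j. w' j \<in> S (r j)" "\<And>j. v' j \<in> S (r j)"
  obtains S' where "escaping p w' v' S'"
proof -
  have "\<exists>S'. S' \<subseteq> S (r j) \<and> seg (w' j) (v' j) S'" for j
    using seg_sub'[OF escapingD(1)[OF S] w'] by blast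
  then obtain S' where S': "\<And>j. S' j \<subseteq> S (r j)" "\<And>j. seg (w' j) (v' j) (S' j)" by metis
  have "real j \<le> K p u" if "u \<in> S' j" for u j
  proof -
    have "real (r j) \<le> K p u" using S'(1) that escapingD(2)[OF S] by blast
    then show ?thesis using r[of j] by linarith
  qed
  then show ?thesis using that S' unfolding escaping_def by blast
qed

lemma escaping_limit_boundary:
  assumes p: "p \<in> D" and S: "escaping p w v S" and w: "w \<longlonglongrightarrow> \<xi>"
  shows "\<xi> \<in> closure D" "\<xi> \<notin> D"
proof -
  show "\<xi> \<in> closure D" using escapingD(3)[OF S] w unfolding closure_sequential by blast
  show "\<xi> \<notin> D"
  proof
    assume "\<xi> \<in> D"
    have "(\<lambda>j. K p (w j)) \<longlonglongrightarrow> K p \<xi>"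
      using continuous_on_tendsto_compose[OF K_continuous[OF p] w \<open>\<xi> \<in> D\<close>] escapingD(3)[OF S] by simp
    then have "bounded (range (\<lambda>j. K p (w j)))" by (rule convergent_imp_bounded)
    then obtain B where B: "\<And>j. \<bar>K p (w j)\<bar> \<le> B" unfolding bounded_iff by auto
    have "real j \<le> B" for j using B[of j] escapingD(2)[OF S escapingD(5)[OF S], of j] by linarith
    then show False using reals_Archimedean2[of B] by (meson not_less)
  qed
qed

text \<open>By \<open>thin_fork\<close> some point of \<open>S j\<close> is near both geodesics from
  \<open>p\<close> to \<open>w j\<close> and \<open>v j\<close>, hence near both straight segments.
  The nearby points on these segments are far from \<open>p\<close>, so they tend to
  \<open>\<xi>\<close> and \<open>\<eta>\<close>, at bounded distance from each other, and
  \<open>disc_in_closure\<close> applies.\<close>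

lemma escaping_disc:
  assumes p: "p \<in> D" and S: "escaping p w v S" and w: "w \<longlonglongrightarrow> \<xi>" and v: "v \<longlonglongrightarrow> \<eta>"
  obtains c where "c > 0" "\<And>l. cmod l < c \<Longrightarrow> \<xi> + l *s (\<eta> - \<xi>) \<in> closure D"
proof -
  have bd: "\<exists>R. \<forall>j. norm (f j - p) \<le> R" if "f \<longlonglongrightarrow> l" for f :: "nat \<Rightarrow> complex^'d" and l
  proof -
    have "(\<lambda>j. f j - p) \<longlonglongrightarrow> l - p" by (intro tendsto_intros that)
    then have "bounded (range (\<lambda>j. f j - p))" by (rule convergent_imp_bounded)
    then show ?thesis unfolding bounded_iff by auto
  qed
  obtain R1 R2 where R12: "\<And>j. norm (w j - p) \<le> R1" "\<And>j. norm (v j - p) \<le> R2"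
    using bd[OF w] bd[OF v] by blast
  obtain C where C: "\<And>x S q. \<lbrakk>x \<in> D; norm (x - p) \<le> max R1 R2; seg p x S; q \<in> S\<rbrakk> \<Longrightarrow>
    \<exists>t\<in>{0..1}. p + of_real t *s (x - p) \<in> D \<and> K q (p + of_real t *s (x - p)) \<le> C"
    using straight_near_geodesic[OF p, of "max R1 R2"] by blast
  define C' where "C' = \<delta> + 1 + C"
  have "\<exists>t\<in>{0..1}. \<exists>t'\<in>{0..1}. p + of_real t *s (w j - p) \<in> D \<and> p + of_real t' *s (v j - p) \<in> D \<and>
      K (p + of_real t *s (w j - p)) (p + of_real t' *s (v j - p)) \<le> 2 * C' \<and>
      real j - C' \<le> K p (p + of_real t *s (w j - p)) \<and> real j - C' \<le> K p (p + of_real t' *s (v j - p))" for j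
  proof -
    have wv: "w j \<in> D" "v j \<in> D" using escapingD[OF S] by auto
    obtain A B where A: "seg p (w j) A" and B: "seg p (v j) B" using geodesic p wv by blast
    obtain u q q' where u: "u \<in> S j" and q: "q \<in> A" "K u q \<le> \<delta>" and q': "q' \<in> B" "K u q' \<le> \<delta> + 1"
      using thin_fork[OF escapingD(1)[OF S] A B] by metis
    obtain t where t: "t \<in> {0..1}" "p + of_real t *s (w j - p) \<in> D" "K q (p + of_real t *s (w j - p)) \<le> C"
      using C[OF wv(1) _ A q(1)] R12(1)[of j] by (meson max.coboundedI1)
    obtain t' where t': "t' \<in> {0..1}" "p + of_real t' *s (v j - p) \<in> D" "K q' (p + of_real t' *s (v j - p)) \<le> C"
      using C[OF wv(2) _ B q'(1)] R12(2)[of j] by (meson max.coboundedI2)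
    have D: "u \<in> D" "q \<in> D" "q' \<in> D" using u q q' A B escapingD(7)[OF S] seg_subset by blast+
    have far: "real j \<le> K p u" using escapingD(2)[OF S u] .
    have 1: "K u (p + of_real t *s (w j - p)) \<le> C'" using K_tri[OF D(1,2) t(2)] t q by (simp add: C'_def)
    have 2: "K u (p + of_real t' *s (v j - p)) \<le> C'" using K_tri[OF D(1,3) t'(2)] t' q' by (simp add: C'_def)
    show ?thesis
    proof (rule bexI[of _ t], rule bexI[of _ t'], intro conjI)
      show "K (p + of_real t *s (w j - p)) (p + of_real t' *s (v j - p)) \<le> 2 * C'"
        using K_tri[OF t(2) D(1) t'(2)] 1 2 K_sym[of u "p + of_real t *s (w j - p)"] by simp
      show "real j - C' \<le> K p (p + of_real t *s (w j - p))"
        using K_tri[OF p t(2) D(1)] 1 far K_sym[of u "p + of_real t *s (w j - p)"] by simp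
      show "real j - C' \<le> K p (p + of_real t' *s (v j - p))"
        using K_tri[OF p t'(2) D(1)] 2 far K_sym[of u "p + of_real t' *s (v j - p)"] by simp
    qed (use t t' in auto)
  qed
  then obtain t t' where t: "\<And>j. t j \<in> {0..1}" "\<And>j. t' j \<in> {0..1}"
      "\<And>j. p + of_real (t j) *s (w j - p) \<in> D" "\<And>j. p + of_real (t' j) *s (v j - p) \<in> D"
      "\<And>j. K (p + of_real (t j) *s (w j - p)) (p + of_real (t' j) *s (v j - p)) \<le> 2 * C'"
      "\<And>j. real j - C' \<le> K p (p + of_real (t j) *s (w j - p))"
      "\<And>j. real j - C' \<le> K p (p + of_real (t' j) *s (v j - p))" by metis
  have l1: "(\<lambda>j. p + of_real (t j) *s (w j - p)) \<longlonglongrightarrow> \<xi>"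
    by (rule straight_points_tendsto[OF p escapingD(3)[OF S] w t(1,6)])
  have l2: "(\<lambda>j. p + of_real (t' j) *s (v j - p)) \<longlonglongrightarrow> \<eta>"
    by (rule straight_points_tendsto[OF p escapingD(4)[OF S] v t(2,7)])
  have "0 \<le> K (p + of_real (t 0) *s (w 0 - p)) (p + of_real (t' 0) *s (v 0 - p))"
    by (rule K_nonneg[OF t(3,4)])
  then have "0 \<le> 2 * C'" using t(5)[of 0] by linarith
  then have e: "0 \<le> exp (2 * (2 * C')) - 1" by simp
  show ?thesis
  proof (rule that[of "1 / exp (2 * (2 * C'))"])
    fix l assume "cmod l < 1 / exp (2 * (2 * C'))"
    then have "cmod l * exp (2 * (2 * C')) < 1" by (simp add: field_simps)
    then have "cmod l * (exp (2 * (2 * C')) - 1) < 1"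
      by (simp add: right_diff_distrib) (smt (verit) norm_ge_zero)
    then show "\<xi> + l *s (\<eta> - \<xi>) \<in> closure D"
      by (rule disc_in_closure[OF t(3,4,5) l1 l2])
  qed simp
qed

text \<open>If \<open>\<xi> \<noteq> \<eta>\<close>, both would lie in the relative interior of the face \<open>A\<close> cut out of \<open>closure D\<close> by a
  complex line. All points of this relative interior are the same point at infinity, and hence so is
  each of its relative boundary points \<open>\<alpha>\<close>; but then \<open>escaping_disc\<close> shows that \<open>\<alpha>\<close> is in the
  relative interior.\<close>

lemma escaping_limits_eq:
  assumes p: "p \<in> D" and S: "escaping p w v S" and w: "w \<longlonglongrightarrow> \<xi>" and v: "v \<longlonglongrightarrow> \<eta>"
  shows "\<xi> = \<eta>"
proof (rule ccontr)
  assume ne: "\<xi> \<noteq> \<eta>"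
  define z where "z = \<eta> - \<xi>"
  have z: "z \<noteq> 0" using ne by (simp add: z_def)
  have xi: "\<xi> \<in> closure D" "\<xi> \<notin> D" using escaping_limit_boundary[OF p S w] by auto
  \<comment> \<open>The face in the coordinate of the complex line: 0 stands for
    \<open>\<xi>\<close> and 1 for \<open>\<eta>\<close>.\<close>
  define A where "A = {l::complex. \<xi> + l *s z \<in> closure D}"
  have clcv: "closed (closure D)" "convex (closure D)" using D_convex convex_closure by auto
  have convA: "a + of_real s * (b - a) \<in> A" if "a \<in> A" "b \<in> A" "0 \<le> s" "s \<le> 1" for a b s
  proof -
    have "(1 - s) *\<^sub>R (\<xi> + a *s z) + s *\<^sub>R (\<xi> + b *s z) \<in> closure D"
      using that clcv(2) unfolding A_def by (intro convexD) auto
    then show ?thesis unfolding A_def scaleR_eq_smult by (simp add: vec_eq_iff algebra_simps)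
  qed
  obtain c where "c > 0" "\<And>l. cmod l < c \<Longrightarrow> \<xi> + l *s (\<eta> - \<xi>) \<in> closure D"
    using escaping_disc[OF p S w v] by blast
  then have c: "c > 0" "\<And>l. cmod l < c \<Longrightarrow> l \<in> A" by (auto simp: A_def z_def)
  \<comment> \<open>Not even the closure contains a complex line: on a line the real part of a form
    bounding \<open>D\<close> would be bounded above, which forces the form to vanish in its
    direction.\<close>
  have "\<exists>l1. l1 \<notin> A"
  proof (rule ccontr)
    assume "\<not> ?thesis"
    then have all: "\<And>l. \<xi> + l *s z \<in> closure D" by (auto simp: A_def)
    have "z = 0"
    proof (rule halfspaces_separate)
      fix a k assume a: "\<And>x. x \<in> D \<Longrightarrow> a \<bullet> x < k"
      have "D \<subseteq> {x. a \<bullet> x \<le> k}" using a by force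
      then have "closure D \<subseteq> {x. a \<bullet> x \<le> k}" by (rule closure_minimal) (rule closed_halfspace_le)
      then have cl: "a \<bullet> (\<xi> + l *s z) \<le> k" for l using all[of l] by blast
      have "a \<bullet> (l *s z) = Re (l * hermitian a z)" for l
        by (simp only: Re_hermitian[symmetric] hermitian_smult)
      then have le: "a \<bullet> \<xi> + Re (l * hermitian a z) \<le> k" for l
        using cl[of l] by (simp add: inner_add_right)
      show "hermitian a z = 0"
      proof (rule ccontr)
        assume h: "hermitian a z \<noteq> 0"
        show False using le[of "of_real (k - a \<bullet> \<xi> + 1) / hermitian a z"] h by simp
      qed
    qed
    then show False using z by simp
  qed
  then obtain l1 where l1: "l1 \<notin> A" by blast
  \<comment> \<open>\<open>s0\<close> is the last parameter on the way to \<open>l1\<close> that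
    stays in \<open>A\<close>, so \<open>l0\<close> is a boundary point of \<open>A\<close>.\<close>
  define I where "I = {s \<in> {0..1}. of_real s * l1 \<in> A}"
  define s0 where "s0 = Sup I"
  have "0 \<in> A" using c by simp
  then have I0: "0 \<in> I" by (simp add: I_def)
  have Ib: "bdd_above I" by (auto simp: I_def intro: bdd_aboveI[of _ 1])
  have "closed I"
  proof -
    have "continuous_on {0..1} (\<lambda>s::real. \<xi> + (of_real s * l1) *s z)" by (intro continuous_intros)
    then have "closed ({0..1} \<inter> (\<lambda>s::real. \<xi> + (of_real s * l1) *s z) -` closure D)"
      by (rule continuous_closed_preimage) auto
    moreover have "I = {0..1} \<inter> (\<lambda>s::real. \<xi> + (of_real s * l1) *s z) -` closure D"
      by (auto simp: I_def A_def)
    ultimately show ?thesis by simp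
  qed
  then have s0I: "s0 \<in> I" unfolding s0_def using I0 Ib by (intro closed_contains_Sup) auto
  have s0: "0 \<le> s0" "s0 \<le> 1" "of_real s0 * l1 \<in> A" using s0I by (auto simp: I_def)
  have "s0 \<noteq> 1" using s0 l1 by auto
  then have s01: "s0 < 1" using s0 by simp
  have max: "of_real s * l1 \<notin> A" if "s0 < s" "s \<le> 1" for s
  proof
    assume "of_real s * l1 \<in> A"
    then have "s \<in> I" using that s0 by (simp add: I_def)
    then have "s \<le> s0" unfolding s0_def using Ib by (rule cSup_upper)
    then show False using that by simp
  qed
  have l1nz: "l1 \<noteq> 0" using l1 \<open>0 \<in> A\<close> by auto
  have s0pos: "0 < s0"
  proof (rule ccontr)
    assume "\<not> 0 < s0"
    then have "s0 = 0" using s0 by simp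
    define s where "s = min 1 (c / (2 * cmod l1))"
    have "0 < s" "s \<le> 1" using c l1nz by (auto simp: s_def)
    moreover have "s * cmod l1 < c"
    proof -
      have "s * cmod l1 \<le> c / (2 * cmod l1) * cmod l1" by (intro mult_right_mono) (auto simp: s_def)
      also have "\<dots> < c" using c l1nz by simp
      finally show ?thesis .
    qed
    then have "of_real s * l1 \<in> A" using \<open>0 < s\<close> by (intro c(2)) (simp add: norm_mult)
    ultimately show False using max[of s] \<open>s0 = 0\<close> by simp
  qed
  define l0 where "l0 = of_real s0 * l1"
  have l0: "l0 \<in> A" "l0 \<noteq> 0" using s0 s0pos l1nz by (auto simp: l0_def)
  define a where "a = (\<lambda>s::real. \<xi> + (of_real s * l0) *s z)"
  define \<sigma> where "\<sigma> = (\<lambda>s t. p + of_real t *s (a s - p))"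
  have aA: "of_real s * l0 \<in> A" if "0 \<le> s" "s \<le> 1" for s
    using convA[OF \<open>0 \<in> A\<close> l0(1) that] by simp
  have acl: "a s \<in> closure D" if "0 \<le> s" "s \<le> 1" for s
    using aA[OF that] by (simp add: a_def A_def)
  have \<sigma>D: "\<sigma> s t \<in> D" if "0 \<le> s" "s \<le> 1" "0 \<le> t" "t < 1" for s t
    unfolding \<sigma>_def using that by (intro in_open_segment_interior D_convex D_open p acl)
  \<comment> \<open>\<open>A\<close> contains the convex hull of the disc of radius \<open>c\<close>
    around 0 and of \<open>l0\<close>, which leaves width proportional to \<open>1 - s\<close>
    around the segment from 0 to \<open>s * l0\<close>. The bound is uniform while both points
    approach the boundary with \<open>t\<close>.\<close>
  have bound: "\<exists>C. \<forall>t. 0 \<le> t \<and> t < 1 \<longrightarrow> K (\<sigma> 0 t) (\<sigma> s t) \<le> C" if s: "0 \<le> s" "s < 1" for s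
  proof (intro exI allI impI)
    define \<epsilon> where "\<epsilon> = c * (1 - s) / cmod l0"
    have \<epsilon>: "\<epsilon> > 0" using c s l0 by (simp add: \<epsilon>_def)
    fix t :: real assume t: "0 \<le> t \<and> t < 1"
    show "K (\<sigma> 0 t) (\<sigma> s t) \<le> chain_bound \<epsilon>"
    proof (rule K_le_chain_bound[OF \<epsilon>])
      fix \<theta> :: real and \<mu> :: complex assume \<theta>: "0 \<le> \<theta>" "\<theta> \<le> 1" and \<mu>: "cmod \<mu> < \<epsilon>"
      have \<theta>s: "\<theta> * s \<le> 1 * s" "0 \<le> \<theta> * s" using \<theta> s mult_right_mono[of \<theta> 1 s] by auto
      \<comment> \<open>Chosen such that the required parameter is the point of the segment from
        \<open>\<beta>\<close> to \<open>l0\<close> at \<open>\<theta> * s\<close>.\<close>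
      define \<beta> where "\<beta> = \<mu> * of_real s * l0 / of_real (1 - \<theta> * s)"
      have "cmod \<beta> < c"
      proof -
        have "cmod \<mu> * cmod l0 < c * (1 - s)" using \<mu> l0 by (simp add: \<epsilon>_def field_simps)
        moreover have "cmod \<mu> * s * cmod l0 \<le> cmod \<mu> * 1 * cmod l0"
          using s by (intro mult_right_mono mult_left_mono) auto
        moreover have "c * (1 - s) \<le> c * (1 - \<theta> * s)" using c \<theta>s by (intro mult_left_mono) auto
        ultimately have lt: "cmod \<mu> * s * cmod l0 < c * (1 - \<theta> * s)" by linarith
        have eq: "cmod \<beta> = cmod \<mu> * s * cmod l0 / (1 - \<theta> * s)"
          unfolding \<beta>_def norm_divide norm_mult norm_of_real using s \<theta>s by simp
        have "0 < 1 - \<theta> * s" using s \<theta>s by simp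
        then show ?thesis unfolding eq using lt by (simp add: pos_divide_less_eq)
      qed
      then have "\<beta> \<in> A" by (rule c(2))
      then have "\<beta> + of_real (\<theta> * s) * (l0 - \<beta>) \<in> A" using \<theta>s s by (intro convA l0) auto
      moreover have "\<beta> + of_real (\<theta> * s) * (l0 - \<beta>) = (of_real \<theta> + \<mu>) * of_real s * l0"
      proof -
        have nz: "complex_of_real (1 - \<theta> * s) \<noteq> 0" unfolding of_real_eq_0_iff using \<theta>s s by linarith
        have "\<beta> + of_real (\<theta> * s) * (l0 - \<beta>) = \<beta> * of_real (1 - \<theta> * s) + of_real (\<theta> * s) * l0"
          by (simp add: algebra_simps)
        also have "\<beta> * of_real (1 - \<theta> * s) = \<mu> * of_real s * l0" unfolding \<beta>_def using nz by simp
        finally show ?thesis by (simp add: algebra_simps)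
      qed
      ultimately have "(of_real \<theta> + \<mu>) * of_real s * l0 \<in> A" by (simp only:)
      then have "\<xi> + ((of_real \<theta> + \<mu>) * of_real s * l0) *s z \<in> closure D"
        by (simp only: A_def mem_Collect_eq)
      then have "p + of_real t *s (\<xi> + ((of_real \<theta> + \<mu>) * of_real s * l0) *s z - p) \<in> D"
        using t by (intro in_open_segment_interior D_convex D_open p) auto
      moreover have "p + of_real t *s (\<xi> + ((of_real \<theta> + \<mu>) * of_real s * l0) *s z - p) =
          \<sigma> 0 t + (of_real \<theta> + \<mu>) *s (\<sigma> s t - \<sigma> 0 t)"
        by (simp add: \<sigma>_def a_def vec_eq_iff algebra_simps)
      ultimately show "\<sigma> 0 t + (of_real \<theta> + \<mu>) *s (\<sigma> s t - \<sigma> 0 t) \<in> D" by simp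
    qed
  qed
  define sn where "sn = (\<lambda>n. 1 - 1 / (real n + 2))"
  have sn: "0 \<le> sn n" "sn n < 1" for n by (auto simp: sn_def field_simps)
  have "\<exists>C. \<forall>t. 0 \<le> t \<and> t < 1 \<longrightarrow> K (\<sigma> 0 t) (\<sigma> (sn n) t) \<le> C" for n by (rule bound[OF sn])
  then obtain Cn where Cn: "\<And>n t. 0 \<le> t \<Longrightarrow> t < 1 \<Longrightarrow> K (\<sigma> 0 t) (\<sigma> (sn n) t) \<le> Cn n" by metis
  \<comment> \<open>The bounds \<open>Cn n\<close> may blow up as \<open>sn n\<close> tends to 1.
    Choosing \<open>t\<close> after \<open>Cn n\<close> puts \<open>\<sigma> 0 t\<close> so far out
    that the geodesic, of length at most \<open>Cn n\<close>, stays at distance at least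
    \<open>n\<close> from \<open>p\<close>.\<close>
  have "\<exists>t. 1 - 1 / (real n + 1) \<le> t \<and> t < 1 \<and> Cn n + real n \<le> K p (\<sigma> 0 t)" for n
  proof (rule ccontr)
    assume no: "\<not> ?thesis"
    define t where "t = (\<lambda>m. 1 - 1 / (real n + 1 + real m))"
    have t: "1 - 1 / (real n + 1) \<le> t m" "t m < 1" "0 \<le> t m" for m
      by (auto simp: t_def field_simps)
    have "\<sigma> 0 (t m) \<in> {x \<in> D. K p x \<le> Cn n + real n}" for m
      using no t[of m] \<sigma>D[of 0 "t m"] by force
    moreover have "t \<longlonglongrightarrow> 1" unfolding t_def by real_asymp
    then have "(\<lambda>m. \<sigma> 0 (t m)) \<longlonglongrightarrow> p + of_real 1 *s (a 0 - p)"
      unfolding \<sigma>_def by (intro tendsto_intros)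
    ultimately have "p + of_real 1 *s (a 0 - p) \<in> {x \<in> D. K p x \<le> Cn n + real n}"
      by (rule closed_sequentially[OF compact_imp_closed[OF K_ball_compact[OF p]]])
    then show False using xi by (simp add: a_def)
  qed
  then obtain tn where tn: "\<And>n. 1 - 1 / (real n + 1) \<le> tn n" "\<And>n. tn n < 1"
      "\<And>n. Cn n + real n \<le> K p (\<sigma> 0 (tn n))" by metis
  have tn0: "0 \<le> tn n" for n
  proof -
    have "0 \<le> 1 - 1 / (real n + 1)" by (simp add: field_simps)
    then show ?thesis using tn(1)[of n] by linarith
  qed
  define w' where "w' = (\<lambda>n. \<sigma> (sn n) (tn n))"
  define v' where "v' = (\<lambda>n. \<sigma> 0 (tn n))"
  have wD: "w' n \<in> D" "v' n \<in> D" for n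
    unfolding w'_def v'_def using sn[of n] tn(2)[of n] tn0[of n] by (auto intro!: \<sigma>D)
  have "\<forall>n. \<exists>S. seg (w' n) (v' n) S" using geodesic wD by blast
  then obtain S' where S': "\<And>n. seg (w' n) (v' n) (S' n)" by metis
  have esc: "escaping p w' v' S'" unfolding escaping_def
  proof (intro allI conjI ballI S')
    fix n u assume u: "u \<in> S' n"
    have uD: "u \<in> D" using seg_subset[OF S'] u by blast
    have "K u (v' n) \<le> K (w' n) (v' n)" using seg_dist(2)[OF S' u u] K_nonneg[OF wD(1) uD, of n] by simp
    also have "\<dots> \<le> Cn n" using Cn[OF tn0 tn(2), of n n] K_sym by (simp add: w'_def v'_def)
    finally have "K u (v' n) \<le> Cn n" .
    moreover have "Cn n + real n \<le> K p (v' n)" using tn(3)[of n] by (simp add: v'_def)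
    ultimately show "real n \<le> K p u" using K_tri[OF p uD wD(2)[of n]] by linarith
  qed
  have tn1: "tn \<longlonglongrightarrow> 1"
  proof (rule tendsto_sandwich[of "\<lambda>n. 1 - 1 / (real n + 1)" _ _ "\<lambda>_. 1"])
    show "(\<lambda>n. 1 - 1 / (real n + 1)) \<longlonglongrightarrow> 1" by real_asymp
    show "\<forall>\<^sub>F n in sequentially. tn n \<le> 1" using tn(2) by (simp add: less_imp_le)
  qed (use tn(1) in auto)
  have sn1: "sn \<longlonglongrightarrow> 1" unfolding sn_def by real_asymp
  have "w' \<longlonglongrightarrow> p + of_real 1 *s (\<xi> + (of_real 1 * l0) *s z - p)"
    unfolding w'_def \<sigma>_def a_def by (intro tendsto_intros tn1 sn1)
  then have w': "w' \<longlonglongrightarrow> \<xi> + l0 *s z" by simp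
  have "v' \<longlonglongrightarrow> p + of_real 1 *s (a 0 - p)"
    unfolding v'_def \<sigma>_def by (intro tendsto_intros tn1)
  then have v': "v' \<longlonglongrightarrow> \<xi>" by (simp add: a_def)
  obtain c' where c': "c' > 0" "\<And>l. cmod l < c' \<Longrightarrow> (\<xi> + l0 *s z) + l *s (\<xi> - (\<xi> + l0 *s z)) \<in> closure D"
    using escaping_disc[OF p esc w' v'] by blast
  \<comment> \<open>The disc around \<open>l0\<close> contains \<open>(1 + k) * l0\<close>, which
    lies beyond the last point of \<open>A\<close> on the ray. The second bound for \<open>k\<close>
    keeps \<open>s0 * (1 + k) \<le> 1\<close>, where \<open>max\<close> applies.\<close>
  define k where "k = min (c' / 2) (1 / s0 - 1)"
  have k: "0 < k" "k < c'" "k \<le> 1 / s0 - 1" using c' s0pos s01 by (auto simp: k_def)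
  have "(\<xi> + l0 *s z) + (- of_real k) *s (\<xi> - (\<xi> + l0 *s z)) \<in> closure D"
    using k by (intro c') simp
  moreover have "(\<xi> + l0 *s z) + (- of_real k) *s (\<xi> - (\<xi> + l0 *s z)) = \<xi> + (of_real (s0 * (1 + k)) * l1) *s z"
    by (simp add: l0_def vec_eq_iff algebra_simps)
  ultimately have "of_real (s0 * (1 + k)) * l1 \<in> A" by (simp only: A_def mem_Collect_eq)
  moreover have "s0 < s0 * (1 + k)" using k s0pos by simp
  moreover have "s0 * (1 + k) \<le> 1"
  proof -
    have "s0 * (1 + k) \<le> s0 * (1 / s0)" using k s0pos by (intro mult_left_mono) auto
    then show ?thesis using s0pos by simp
  qed
  ultimately show False using max by blast
qed

text \<open>Late geodesics cross the sphere of radius \<open>norm \<xi> + 1\<close>. The crossing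
  points accumulate at some \<open>\<eta>\<close> different from \<open>\<xi>\<close>, and the
  pieces up to them contradict \<open>escaping_limits_eq\<close>.\<close>

lemma escaping_not_unbounded:
  assumes p: "p \<in> D" and S: "escaping p w v S" and w: "w \<longlonglongrightarrow> \<xi>"
    and v: "filterlim (\<lambda>j. norm (v j)) at_top sequentially"
  shows False
proof -
  define R where "R = norm \<xi> + 1"
  have "(\<lambda>j. norm (w j)) \<longlonglongrightarrow> norm \<xi>" by (intro tendsto_intros w)
  then have "\<forall>\<^sub>F j in sequentially. norm (w j) < R" by (rule order_tendstoD) (simp add: R_def)
  moreover have "\<forall>\<^sub>F j in sequentially. R \<le> norm (v j)" using v by (simp add: filterlim_at_top)
  ultimately have "\<forall>\<^sub>F j in sequentially. norm (w j) < R \<and> R \<le> norm (v j)" by eventually_elim simp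
  then obtain N where N: "\<And>j. j \<ge> N \<Longrightarrow> norm (w j) < R \<and> R \<le> norm (v j)"
    unfolding eventually_sequentially by blast
  have "\<exists>u\<in>S (j + N). norm u = R" for j
  proof -
    have "connected (norm ` S (j + N))"
      by (intro connected_continuous_image continuous_intros geodesic_connected[OF escapingD(1)[OF S]])
    then have "R \<in> norm ` S (j + N)"
      by (rule connectedD_interval[OF _ imageI[OF escapingD(5)[OF S]] imageI[OF escapingD(6)[OF S]]])
        (use N[of "j + N"] in auto)
    then show ?thesis by auto
  qed
  then obtain u where u: "\<And>j. u j \<in> S (j + N)" "\<And>j. norm (u j) = R" by metis
  have "\<forall>n. u n \<in> sphere 0 R" using u by simp
  then obtain \<eta> q where q: "\<eta> \<in> sphere 0 R" "strict_mono q" "(u \<circ> q) \<longlonglongrightarrow> \<eta>"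
    using seq_compactE[OF compact_imp_seq_compact[OF compact_sphere[of 0 R]]] by blast
  have jq: "j \<le> q j + N" for j using seq_suble[OF q(2), of j] by simp
  obtain S' where S': "escaping p (\<lambda>j. w (q j + N)) (\<lambda>j. u (q j)) S'"
    by (rule escaping_sub[OF S jq, of "\<lambda>j. w (q j + N)" "\<lambda>j. u (q j)"]) (use escapingD(5)[OF S] u(1) in auto)
  have "filterlim (\<lambda>j. q j + N) sequentially sequentially"
    using jq by (auto simp: filterlim_at_top eventually_sequentially intro: order_trans)
  then have "(\<lambda>j. w (q j + N)) \<longlonglongrightarrow> \<xi>" by (rule filterlim_compose[OF w])
  then have "\<xi> = \<eta>" using escaping_limits_eq[OF p S'] q(3) by (simp add: o_def)
  then show False using q(1) by (simp add: R_def)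
qed

text \<open>A geodesic between different components of the complement of \<open>C\<close> meets
  \<open>C\<close>. The meeting points accumulate in \<open>C\<close> while \<open>v\<close> runs to
  infinity, against \<open>escaping_not_unbounded\<close>.\<close>

lemma escaping_same_component:
  assumes p: "p \<in> D" and S: "escaping p w v S" and C: "compact C"
    and U: "U \<in> components (closure D - C)" and V: "V \<in> components (closure D - C)"
    and w: "\<forall>\<^sub>F j in sequentially. w j \<in> U" and v: "\<forall>\<^sub>F j in sequentially. v j \<in> V"
    and inf: "filterlim (\<lambda>j. norm (v j)) at_top sequentially"
  shows "U = V"
proof (rule ccontr)
  assume "U \<noteq> V"
  have "\<forall>\<^sub>F j in sequentially. w j \<in> U \<and> v j \<in> V" using w v by eventually_elim simp
  then obtain N where N: "\<And>j. j \<ge> N \<Longrightarrow> w j \<in> U \<and> v j \<in> V"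
    unfolding eventually_sequentially by blast
  have "\<exists>u\<in>S (j + N). u \<in> C" for j
  proof (rule ccontr)
    assume "\<not> ?thesis"
    then have "S (j + N) \<subseteq> closure D - C" using escapingD(7)[OF S] closure_subset by blast
    moreover have "U \<inter> S (j + N) \<noteq> {}" "V \<inter> S (j + N) \<noteq> {}"
      using N[of "j + N"] escapingD(5,6)[OF S, of "j + N"] by auto
    ultimately have "S (j + N) \<subseteq> U" "S (j + N) \<subseteq> V"
      using components_maximal[OF U geodesic_connected[OF escapingD(1)[OF S, of "j + N"]]]
        components_maximal[OF V geodesic_connected[OF escapingD(1)[OF S, of "j + N"]]] by blast+
    then show False using components_nonoverlap[OF U V] \<open>U \<noteq> V\<close> escapingD(5)[OF S] by blast
  qed
  then obtain u where u: "\<And>j. u j \<in> S (j + N)" "\<forall>j. u j \<in> C" by metis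
  obtain \<eta> q where q: "\<eta> \<in> C" "strict_mono q" "(u \<circ> q) \<longlonglongrightarrow> \<eta>"
    using seq_compactE[OF compact_imp_seq_compact[OF C] u(2)] by blast
  have jq: "j \<le> q j + N" for j using seq_suble[OF q(2), of j] by simp
  obtain S' where S': "escaping p (\<lambda>j. u (q j)) (\<lambda>j. v (q j + N)) S'"
    by (rule escaping_sub[OF S jq, of "\<lambda>j. u (q j)" "\<lambda>j. v (q j + N)"]) (use escapingD(6)[OF S] u(1) in auto)
  have "filterlim (\<lambda>j. q j + N) sequentially sequentially"
    using jq by (auto simp: filterlim_at_top eventually_sequentially intro: order_trans)
  then have "filterlim (\<lambda>j. norm (v (q j + N))) at_top sequentially" by (rule filterlim_compose[OF inf])
  then show False using escaping_not_unbounded[OF p S'] q(3) by (simp add: o_def)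
qed

end

section \<open>Convergence in the end compactification\<close>

text \<open>A relatively open subset of \<open>X\<close> contains no ends, so it is open in the
  compactification as well.\<close>

lemma limitin_Pt:
  fixes X :: "'a::metric_space set"
  assumes lim: "limitin (end_compactification X Q) (\<lambda>n. Pt (x n)) (Pt l) F"
  shows "(x \<longlongrightarrow> l) F"
proof (rule tendstoI)
  fix e :: real assume e: "e > 0"
  define W where "W = Pt ` (X \<inter> ball l e)"
  have "Pt -` W = X \<inter> ball l e" by (auto simp: W_def)
  then have "openin (end_compactification X Q) W"
    unfolding openin_end_compactification by (auto simp: W_def openin_open)
  moreover have "Pt l \<in> W"
    using limitin_topspace[OF lim] e by (auto simp: W_def topspace_end_compactification)
  ultimately have "\<forall>\<^sub>F n in F. Pt (x n) \<in> W" using lim unfolding limitin_def by blast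
  then show "\<forall>\<^sub>F n in F. dist (x n) l < e"
    by eventually_elim (auto simp: W_def dist_commute)
qed

text \<open>Components of the relatively open set \<open>X - Q k\<close> are open because convex
  sets are locally connected. An end in the neighbourhood has the same neighbourhood of level
  \<open>k\<close>.\<close>

lemma openin_end_nbhd:
  fixes X :: "'a::euclidean_space set"
  assumes X: "convex X" and Q: "compact_exhaustion X Q" and U: "U \<in> ends X Q"
  shows "openin (end_compactification X Q) (end_nbhd X Q U k)"
proof -
  have Uk: "U k \<in> components (X - Q k)" using U by (simp add: ends_def)
  have "compact (Q k)" using Q by (simp add: compact_exhaustion_def)
  then have op: "openin (top_of_set X) (X - Q k)"
    using compact_imp_closed by (auto simp: openin_open intro!: exI[of _ "- Q k"])
  have "locally connected X" using X by (rule convex_imp_locally_connected)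
  then have "locally connected (X - Q k)" using op by (rule locally_open_subset)
  then have "openin (top_of_set (X - Q k)) (U k)"
    using Uk by (rule openin_components_locally_connected)
  then have opU: "openin (top_of_set X) (U k)" using op openin_trans by blast
  have "Pt -` end_nbhd X Q U k = U k" by (auto simp: end_nbhd_def)
  moreover have "end_nbhd X Q U k \<subseteq> Pt ` X \<union> End ` ends X Q"
    using in_components_subset[OF Uk] by (auto simp: end_nbhd_def)
  moreover have "\<exists>j. end_nbhd X Q V j \<subseteq> end_nbhd X Q U k" if "End V \<in> end_nbhd X Q U k" for V
  proof -
    have "\<forall>j\<le>k. V j = U j" using that by (auto simp: end_nbhd_def)
    then have "end_nbhd X Q V k = end_nbhd X Q U k" by (simp add: end_nbhd_def)
    then show ?thesis by blast
  qed
  ultimately show ?thesis unfolding openin_end_compactification using opU by auto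
qed

lemma compact_subset_exhaustion:
  assumes Q: "compact_exhaustion X Q" and C: "compact C" "C \<subseteq> X"
  obtains k where "C \<subseteq> Q k"
proof -
  define G where "G = (\<lambda>n. (top_of_set X) interior_of (Q (Suc n)))"
  have Qn: "Q n \<subseteq> G n" and un: "(\<Union>n. Q n) = X" for n
    using Q by (auto simp: compact_exhaustion_def G_def)
  have GQ: "G n \<subseteq> Q (Suc n)" for n by (simp add: G_def interior_of_subset)
  have "\<exists>O'. open O' \<and> G n = X \<inter> O'" for n
    using openin_interior_of[of "top_of_set X" "Q (Suc n)"] unfolding G_def openin_open .
  then obtain O' where O': "\<And>n. open (O' n)" "\<And>n. G n = X \<inter> O' n" by metis
  have "C \<subseteq> (\<Union>n\<in>UNIV. O' n)" using C(2) un Qn O'(2) by blast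
  then obtain I where I: "finite I" "C \<subseteq> (\<Union>n\<in>I. O' n)"
    by (rule compactE_image[OF C(1), of UNIV O', rotated]) (use O'(1) in auto)
  have "Q n \<subseteq> Q (Suc n)" for n using Qn[of n] GQ[of n] by blast
  then have mono: "Q m \<subseteq> Q n" if "m \<le> n" for m n using that by (rule lift_Suc_mono_le)
  have "C \<subseteq> Q (Suc (Max (insert 0 I)))"
  proof
    fix x assume x: "x \<in> C"
    then obtain n where n: "n \<in> I" "x \<in> O' n" using I by blast
    then have "x \<in> Q (Suc n)" using O'(2)[of n] GQ[of n] x C by blast
    moreover have "n \<le> Max (insert 0 I)" using I n by simp
    ultimately show "x \<in> Q (Suc (Max (insert 0 I)))" using mono[of "Suc n" "Suc (Max (insert 0 I))"] by auto
  qed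
  then show ?thesis by (rule that)
qed

lemma limitin_End:
  fixes X :: "'a::euclidean_space set"
  assumes X: "convex X" "closed X" and Q: "compact_exhaustion X Q"
    and lim: "limitin (end_compactification X Q) (\<lambda>n. Pt (x n)) (End U) F"
  shows "U \<in> ends X Q" "\<forall>\<^sub>F n in F. x n \<in> U k" "filterlim (\<lambda>n. norm (x n)) at_top F"
proof -
  show U: "U \<in> ends X Q"
    using limitin_topspace[OF lim] by (auto simp: topspace_end_compactification)
  have ev: "\<forall>\<^sub>F n in F. x n \<in> U k" for k
  proof -
    have "End U \<in> end_nbhd X Q U k" using U by (simp add: end_nbhd_def)
    then have "\<forall>\<^sub>F n in F. Pt (x n) \<in> end_nbhd X Q U k"
      using lim openin_end_nbhd[OF X(1) Q U] unfolding limitin_def by blast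
    then show ?thesis by eventually_elim (auto simp: end_nbhd_def)
  qed
  then show "\<forall>\<^sub>F n in F. x n \<in> U k" .
  show "filterlim (\<lambda>n. norm (x n)) at_top F" unfolding filterlim_at_top
  proof
    fix R :: real
    have "compact (X \<inter> cball 0 R)" using X(2) by (simp add: closed_Int_compact)
    then obtain k where k: "X \<inter> cball 0 R \<subseteq> Q k" using compact_subset_exhaustion[OF Q] by blast
    have "U k \<subseteq> X - Q k" using U by (auto simp: ends_def dest: in_components_subset)
    show "\<forall>\<^sub>F n in F. R \<le> norm (x n)"
      using ev[of k]
    proof (rule eventually_mono)
      fix n assume "x n \<in> U k"
      then have "x n \<in> X" "x n \<notin> Q k" using \<open>U k \<subseteq> X - Q k\<close> by auto
      then have "x n \<notin> cball 0 R" using k by blast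
      then show "R \<le> norm (x n)" by simp
    qed
  qed
qed

text \<open>A failure produces an escaping family. Two points are excluded by
  \<open>escaping_limits_eq\<close>, a point and an end by \<open>escaping_not_unbounded\<close>,
  and two ends by \<open>escaping_same_component\<close> at every level.\<close>

lemma (in hyperbolic_domain) visibility:
  assumes p: "p \<in> D" and Q: "compact_exhaustion (closure D) Q"
    and x: "\<And>n. x n \<in> D" "limitin (end_compactification (closure D) Q) (\<lambda>n. Pt (x n)) \<xi> sequentially"
    and y: "\<And>n. y n \<in> D" "limitin (end_compactification (closure D) Q) (\<lambda>n. Pt (y n)) \<eta> sequentially"
    and ne: "\<xi> \<noteq> \<eta>"
  obtains R N where "\<And>n m S. \<lbrakk>n \<ge> N; m \<ge> N; seg (x n) (y m) S\<rbrakk> \<Longrightarrow> \<exists>u\<in>S. K p u \<le> R"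
proof -
  let ?T = "end_compactification (closure D) Q"
  have X: "convex (closure D)" "closed (closure D)" using D_convex convex_closure by auto
  \<comment> \<open>A single \<open>j\<close> serves as index threshold and as radius, so that the
    negation yields \<open>escaping\<close> directly.\<close>
  have "\<exists>j. \<forall>n m S. n \<ge> j \<longrightarrow> m \<ge> j \<longrightarrow> seg (x n) (y m) S \<longrightarrow> (\<exists>u\<in>S. K p u \<le> real j)"
  proof (rule ccontr)
    assume "\<not> ?thesis"
    then have "\<forall>j. \<exists>n m S. n \<ge> j \<and> m \<ge> j \<and> seg (x n) (y m) S \<and> (\<forall>u\<in>S. real j \<le> K p u)"
      by (meson linorder_linear)
    then obtain n m S where n: "\<And>j. j \<le> n j" and m: "\<And>j. j \<le> m j"
      and S: "\<And>j. seg (x (n j)) (y (m j)) (S j)" "\<And>j u. u \<in> S j \<Longrightarrow> real j \<le> K p u" by metis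
    have esc: "escaping p (\<lambda>j. x (n j)) (\<lambda>j. y (m j)) S" using S by (simp add: escaping_def)
    have esc': "escaping p (\<lambda>j. y (m j)) (\<lambda>j. x (n j)) S"
      using S seg_reverse by (simp add: escaping_def)
    have fl: "filterlim r sequentially sequentially" if "\<And>j. j \<le> r j" for r :: "nat \<Rightarrow> nat"
      using that by (auto simp: filterlim_at_top eventually_sequentially intro: order_trans)
    have sub: "limitin ?T (\<lambda>j. Pt (z (r j))) l sequentially"
      if "limitin ?T (\<lambda>n. Pt (z n)) l sequentially" "\<And>j. j \<le> r j" for z l and r :: "nat \<Rightarrow> nat"
      using that(1) eventually_compose_filterlim[OF _ fl[OF that(2)]] unfolding limitin_def by fastforce
    have lx: "limitin ?T (\<lambda>j. Pt (x (n j))) \<xi> sequentially" by (rule sub[OF x(2) n])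
    have ly: "limitin ?T (\<lambda>j. Pt (y (m j))) \<eta> sequentially" by (rule sub[OF y(2) m])
    show False
    proof (cases \<xi>)
      case xi: (Pt a)
      show ?thesis
      proof (cases \<eta>)
        case (Pt b)
        then show ?thesis using escaping_limits_eq[OF p esc] limitin_Pt lx ly xi ne by metis
      next
        case (End V)
        show ?thesis
          using escaping_not_unbounded[OF p esc] limitin_Pt[OF lx[unfolded xi]]
            limitin_End(3)[OF X Q ly[unfolded End]] by blast
      qed
    next
      case xi: (End U)
      note lU = limitin_End[OF X Q lx[unfolded xi]]
      show ?thesis
      proof (cases \<eta>)
        case (Pt b)
        show ?thesis
          using escaping_not_unbounded[OF p esc'] limitin_Pt[OF ly[unfolded Pt]] lU(3) by blast
      next
        case (End V)
        note lV = limitin_End[OF X Q ly[unfolded End]]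
        have "U k = V k" for k
        proof (rule escaping_same_component[OF p esc _ _ _ lU(2) lV(2,3)])
          show "compact (Q k)" using Q by (simp add: compact_exhaustion_def)
          show "U k \<in> components (closure D - Q k)" "V k \<in> components (closure D - Q k)"
            using lU(1) lV(1) by (auto simp: ends_def)
        qed
        then show ?thesis using ne xi End by auto
      qed
    qed
  qed
  then show ?thesis using that by metis
qed

section \<open>Holomorphic maps of several variables\<close>

abbreviation clinear :: "(complex^'m \<Rightarrow> complex^'n) \<Rightarrow> bool" where
  "clinear \<equiv> Vector_Spaces.linear (*s) (*s)"

lemma clinearI:
  assumes "\<And>x y. f (x + y) = f x + f y" "\<And>c x. f (c *s x) = c *s f x"
  shows "clinear f"
  by unfold_locales (simp_all add: assms)

lemma clinear_simps:
  assumes "clinear f"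
  shows "f (x + y) = f x + f y" "f (x - y) = f x - f y" "f (c *s x) = c *s f x" "f 0 = 0"
  using vec.linear_add[OF assms] vec.linear_diff[OF assms] vec.linear_scale[OF assms] vec.linear_0[OF assms]
  by simp_all

lemma clinear_bounded_linear:
  fixes f :: "complex^'m \<Rightarrow> complex^'n"
  assumes "clinear f"
  shows "bounded_linear f"
proof -
  have "linear f"
    by (rule linearI) (simp_all add: clinear_simps[OF assms] scaleR_eq_smult)
  then show ?thesis by (simp add: linear_conv_bounded_linear)
qed

lemma clinear_compose: "\<lbrakk>clinear f; clinear g\<rbrakk> \<Longrightarrow> clinear (\<lambda>x. f (g x))"
  by (rule clinearI) (simp_all add: clinear_simps)

lemma clinear_inv:
  assumes "clinear f" "bij f"
  shows "clinear (inv f)"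
proof (rule clinearI)
  have f: "f (inv f x) = x" for x using assms(2) by (simp add: bij_is_surj surj_f_inv_f)
  have g: "inv f (f x) = x" for x using assms(2) by (simp add: bij_is_inj)
  show "inv f (x + y) = inv f x + inv f y" for x y
    using g[of "inv f x + inv f y"] by (simp add: clinear_simps[OF assms(1)] f)
  show "inv f (c *s x) = c *s inv f x" for c x
    using g[of "c *s inv f x"] by (simp add: clinear_simps[OF assms(1)] f)
qed

lemma holomorphic_map_onI:
  assumes "\<And>x. x \<in> S \<Longrightarrow> (f has_derivative f' x) (at x)" "\<And>x. x \<in> S \<Longrightarrow> clinear (f' x)"
  shows "holomorphic_map_on f S"
  using assms unfolding holomorphic_map_on_def by blast

lemma holomorphic_map_onE:
  assumes "holomorphic_map_on f S"
  obtains f' where "\<And>x. x \<in> S \<Longrightarrow> (f has_derivative f' x) (at x)" "\<And>x. x \<in> S \<Longrightarrow> clinear (f' x)"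
  using assms unfolding holomorphic_map_on_def by metis

lemma holomorphic_map_on_continuous:
  assumes "holomorphic_map_on f S"
  shows "continuous_on S f"
proof -
  obtain f' where "\<And>x. x \<in> S \<Longrightarrow> (f has_derivative f' x) (at x)"
    using assms by (rule holomorphic_map_onE) blast
  then show ?thesis
    by (meson continuous_at_imp_continuous_on has_derivative_continuous)
qed

lemma holomorphic_map_on_compose:
  assumes "holomorphic_map_on f T" "holomorphic_map_on g S" "g ` S \<subseteq> T"
  shows "holomorphic_map_on (\<lambda>x. f (g x)) S"
proof -
  obtain f' where f': "\<And>x. x \<in> T \<Longrightarrow> (f has_derivative f' x) (at x)" "\<And>x. x \<in> T \<Longrightarrow> clinear (f' x)"
    using assms(1) by (rule holomorphic_map_onE) blast
  obtain g' where g': "\<And>x. x \<in> S \<Longrightarrow> (g has_derivative g' x) (at x)" "\<And>x. x \<in> S \<Longrightarrow> clinear (g' x)"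
    using assms(2) by (rule holomorphic_map_onE) blast
  show ?thesis
  proof (rule holomorphic_map_onI)
    fix x assume x: "x \<in> S"
    then have gx: "g x \<in> T" using assms(3) by blast
    show "((\<lambda>x. f (g x)) has_derivative (\<lambda>h. f' (g x) (g' x h))) (at x)"
      by (rule has_derivative_compose[OF g'(1)[OF x] f'(1)[OF gx]])
    show "clinear (\<lambda>h. f' (g x) (g' x h))" by (rule clinear_compose[OF f'(2)[OF gx] g'(2)[OF x]])
  qed
qed

lemma holomorphic_map_on_id: "holomorphic_map_on (\<lambda>x. x) S"
  by (rule holomorphic_map_onI[where f'="\<lambda>_ h. h"]) (auto intro: clinearI)

lemma holomorphic_map_on_funpow:
  assumes "holomorphic_map_on f D" "f ` D \<subseteq> D"
  shows "holomorphic_map_on (f ^^ n) D" "(f ^^ n) ` D \<subseteq> D"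
proof -
  have "holomorphic_map_on (f ^^ n) D \<and> (f ^^ n) ` D \<subseteq> D"
  proof (induction n)
    case 0
    then show ?case using holomorphic_map_on_id[of D] by (simp add: id_def)
  next
    case (Suc n)
    then show ?case using holomorphic_map_on_compose[OF assms(1), of "f ^^ n" D] assms(2) by (auto simp: o_def)
  qed
  then show "holomorphic_map_on (f ^^ n) D" "(f ^^ n) ` D \<subseteq> D" by auto
qed

lemma funpow_commute_on:
  assumes comm: "\<And>x. x \<in> D \<Longrightarrow> f (g x) = g (f x)" and "f ` D \<subseteq> D" "g ` D \<subseteq> D" "x \<in> D"
  shows "(f ^^ n) ((g ^^ m) x) = (g ^^ m) ((f ^^ n) x)"
proof -
  have fD: "(f ^^ n) y \<in> D" and gD: "(g ^^ n) y \<in> D" if "y \<in> D" for n y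
    using that assms(2,3) by (induction n) auto
  have "f ((g ^^ m) y) = (g ^^ m) (f y)" if "y \<in> D" for y
    using that by (induction m) (simp_all add: comm gD)
  then show ?thesis using \<open>x \<in> D\<close> by (induction n) (simp_all add: fD)
qed

section \<open>Cauchy estimates and limits of holomorphic maps\<close>

lemma cmod_hermitian_le: "cmod (hermitian a x) \<le> norm a * norm x"
proof (cases "hermitian a x = 0")
  case False
  define c where "c = cnj (hermitian a x) / cmod (hermitian a x)"
  have c: "cmod c = 1" using False by (simp add: c_def norm_divide)
  have "c * hermitian a x = of_real (cmod (hermitian a x))"
    using False by (simp add: c_def mult.commute complex_norm_square[symmetric] power2_eq_square)
  then have "cmod (hermitian a x) = Re (hermitian a (c *s x))" by (simp add: hermitian_smult)
  also have "\<dots> = a \<bullet> (c *s x)" by (simp add: Re_hermitian)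
  also have "\<dots> \<le> norm a * norm (c *s x)" by (rule norm_cauchy_schwarz)
  finally show ?thesis using c by (simp add: norm_vector_smult)
qed simp

lemma bounded_linear_hermitian: "bounded_linear (hermitian a)"
proof (rule bounded_linear_intro[of _ "norm a"])
  show "norm (hermitian a x) \<le> norm x * norm a" for x
    using cmod_hermitian_le[of a x] by (simp add: mult.commute)
qed (simp_all add: hermitian_add scaleR_eq_smult hermitian_smult scaleR_conv_of_real)

text \<open>Two maps at two points are compared at once: with equal points this gives convergence of
  derivatives, with equal maps their continuity. Pairing with the difference \<open>a\<close> itself
  reduces it to a function \<open>F\<close> of one variable with derivative
  \<open>hermitian a a\<close>, and Cauchy's inequality is applied on the radius
  \<open>r / norm h\<close>.\<close>

lemma cauchy_derivative_bound:
  fixes f :: "complex^'m \<Rightarrow> complex^'n"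
  assumes f: "holomorphic_map_on f S" "open S" "cball x r \<subseteq> S" "(f has_derivative f') (at x)" "clinear f'"
    and g: "holomorphic_map_on g T" "open T" "cball y r \<subseteq> T" "(g has_derivative g') (at y)" "clinear g'"
    and r: "0 < r" and bound: "\<And>v. norm v \<le> r \<Longrightarrow> norm (f (x + v) - g (y + v)) \<le> B"
  shows "norm (f' h - g' h) \<le> B / r * norm h"
proof (cases "f' h - g' h = 0")
  case True
  have "0 \<le> B" using bound[of 0] r order_trans[OF norm_ge_zero] by fastforce
  then show ?thesis using True r by simp
next
  case False
  define a where "a = f' h - g' h"
  have h: "h \<noteq> 0" using False clinear_simps(4)[OF f(5)] clinear_simps(4)[OF g(5)] by auto
  have line: "((\<lambda>\<zeta>. x + \<zeta> *s h) has_derivative (\<lambda>\<zeta>. \<zeta> *s h)) (at \<zeta>)" for x :: "complex^'m" and \<zeta>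
    by (auto intro!: derivative_eq_intros bounded_linear.has_derivative[OF bounded_linear_smult_left])
  define F where "F = (\<lambda>\<zeta>. hermitian a (f (x + \<zeta> *s h) - g (y + \<zeta> *s h)))"
  define U where "U = {\<zeta>. x + \<zeta> *s h \<in> S} \<inter> {\<zeta>. y + \<zeta> *s h \<in> T}"
  have U: "open U"
  proof -
    have "continuous_on UNIV (\<lambda>\<zeta>. x + \<zeta> *s h)" for x by (intro continuous_intros)
    then have "open ((\<lambda>\<zeta>. x + \<zeta> *s h) -` S)" "open ((\<lambda>\<zeta>. y + \<zeta> *s h) -` T)"
      using f(2) g(2) continuous_open_vimage by (metis continuous_on_open_vimage open_UNIV Int_UNIV_right)+
    then show ?thesis unfolding U_def vimage_def by (rule open_Int)
  qed
  have hol: "F holomorphic_on U"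
  proof -
    have 1: "(\<lambda>\<zeta>. f (x + \<zeta> *s h) $ i) holomorphic_on U" for i
      by (rule holomorphic_map_on_compose_curve[OF f(1) _ U])
        (auto simp: U_def intro!: holomorphic_intros)
    have 2: "(\<lambda>\<zeta>. g (y + \<zeta> *s h) $ i) holomorphic_on U" for i
      by (rule holomorphic_map_on_compose_curve[OF g(1) _ U])
        (auto simp: U_def intro!: holomorphic_intros)
    show ?thesis unfolding F_def hermitian_def using 1 2 by (intro holomorphic_intros) (auto intro!: holomorphic_intros)
  qed
  have dF: "(F has_field_derivative hermitian a a) (at 0)"
  proof -
    have df: "(f has_derivative f') (at (x + 0 *s h))" and dg: "(g has_derivative g') (at (y + 0 *s h))"
      using f(4) g(4) by simp_all
    have "((\<lambda>\<zeta>. f (x + \<zeta> *s h) - g (y + \<zeta> *s h)) has_derivative (\<lambda>\<zeta>. f' (\<zeta> *s h) - g' (\<zeta> *s h))) (at 0)"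
      by (intro has_derivative_diff has_derivative_compose[OF line df] has_derivative_compose[OF line dg])
    then have "(F has_derivative (\<lambda>\<zeta>. hermitian a (f' (\<zeta> *s h) - g' (\<zeta> *s h)))) (at 0)"
      unfolding F_def by (rule bounded_linear.has_derivative[OF bounded_linear_hermitian])
    moreover have "hermitian a (f' (\<zeta> *s h) - g' (\<zeta> *s h)) = hermitian a a * \<zeta>" for \<zeta>
      by (simp add: a_def clinear_simps[OF f(5)] clinear_simps[OF g(5)] hermitian_diff hermitian_smult algebra_simps)
    ultimately show ?thesis by (simp add: has_field_derivative_def)
  qed
  define \<rho> where "\<rho> = r / norm h"
  have \<rho>: "0 < \<rho>" using r h by (simp add: \<rho>_def)
  have small: "norm (\<zeta> *s h) \<le> r" if "cmod \<zeta> \<le> \<rho>" for \<zeta>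
  proof -
    have "cmod \<zeta> * norm h \<le> \<rho> * norm h" using that by (intro mult_right_mono) auto
    then show ?thesis using h by (simp add: norm_vector_smult \<rho>_def)
  qed
  have sub: "cball 0 \<rho> \<subseteq> U"
  proof
    fix \<zeta> :: complex assume "\<zeta> \<in> cball 0 \<rho>"
    then have "norm (\<zeta> *s h) \<le> r" using small by simp
    then have "x + \<zeta> *s h \<in> cball x r" "y + \<zeta> *s h \<in> cball y r" by (simp_all add: dist_norm)
    then show "\<zeta> \<in> U" using f(3) g(3) unfolding U_def by blast
  qed
  have "cmod ((deriv ^^ 1) F 0) \<le> fact 1 * (norm a * B) / \<rho> ^ 1"
  proof (rule Cauchy_inequality)
    show "F holomorphic_on ball 0 \<rho>" using hol sub holomorphic_on_subset ball_subset_cball by blast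
    show "continuous_on (cball 0 \<rho>) F" using hol sub holomorphic_on_subset holomorphic_on_imp_continuous_on by blast
    fix \<zeta> :: complex assume "cmod (0 - \<zeta>) = \<rho>"
    then have "norm (f (x + \<zeta> *s h) - g (y + \<zeta> *s h)) \<le> B" by (intro bound small) simp
    then have "norm a * norm (f (x + \<zeta> *s h) - g (y + \<zeta> *s h)) \<le> norm a * B" by (rule mult_left_mono) simp
    then show "cmod (F \<zeta>) \<le> norm a * B" unfolding F_def using cmod_hermitian_le order_trans by blast
  qed (rule \<rho>)
  then have "cmod (hermitian a a) \<le> norm a * B / \<rho>" using DERIV_imp_deriv[OF dF] by simp
  moreover have "norm a * norm a \<le> cmod (hermitian a a)"
    using complex_Re_le_cmod[of "hermitian a a"] by (simp add: Re_hermitian dot_square_norm power2_eq_square)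
  ultimately have "norm a * norm a \<le> norm a * (B / r * norm h)" by (simp add: \<rho>_def)
  then have "norm a \<le> B / r * norm h"
    by (rule mult_left_le_imp_le) (use False in \<open>simp add: a_def\<close>)
  then show ?thesis by (simp add: a_def)
qed

text \<open>Weierstrass' theorem. By the Cauchy bound the derivatives are uniformly Cauchy on a
  smaller ball, and their limit inherits complex linearity.\<close>

lemma holomorphic_map_on_limit:
  fixes f :: "nat \<Rightarrow> complex^'m \<Rightarrow> complex^'n"
  assumes S: "open S" and f: "\<And>n. holomorphic_map_on (f n) S"
    and lim: "\<And>C. \<lbrakk>compact C; C \<subseteq> S\<rbrakk> \<Longrightarrow> uniform_limit C f g sequentially"
  shows "holomorphic_map_on g S"
proof -
  have "\<exists>g'. (g has_derivative g') (at x0) \<and> clinear g'" if x0: "x0 \<in> S" for x0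
  proof -
    obtain e where e: "e > 0" "cball x0 e \<subseteq> S" using S x0 open_contains_cball by blast
    define r where "r = e / 2"
    have r: "r > 0" "cball x0 (2 * r) \<subseteq> S" using e by (simp_all add: r_def)
    have cb: "cball x r \<subseteq> cball x0 (2 * r)" if "x \<in> ball x0 r" for x
    proof
      fix y assume "y \<in> cball x r"
      then show "y \<in> cball x0 (2 * r)" using that dist_triangle[of x0 y x] by (simp add: dist_commute)
    qed
    have bS: "x \<in> S" if "x \<in> ball x0 r" for x using cb[OF that] r by force
    have "\<exists>F. \<forall>x\<in>S. (f n has_derivative F x) (at x) \<and> clinear (F x)" for n
      using f[of n] unfolding holomorphic_map_on_def by (intro bchoice) blast
    then obtain f' where f': "\<And>n x. x \<in> S \<Longrightarrow> (f n has_derivative f' n x) (at x)"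
        "\<And>n x. x \<in> S \<Longrightarrow> clinear (f' n x)" by metis
    have diff: "norm (f' n x h - f' m x h) \<le> 2 * d / r * norm h"
      if nm: "\<forall>y\<in>cball x0 (2 * r). norm (f n y - g y) \<le> d" "\<forall>y\<in>cball x0 (2 * r). norm (f m y - g y) \<le> d"
        and x: "x \<in> ball x0 r" for n m x h d
    proof (rule cauchy_derivative_bound[OF f S _ f'(1) f'(2) f S _ f'(1) f'(2) r(1)])
      show "cball x r \<subseteq> S" "cball x r \<subseteq> S" using cb[OF x] r by auto
      fix v :: "complex^'m" assume "norm v \<le> r"
      then have "x + v \<in> cball x r" by (simp add: dist_norm)
      then have y: "x + v \<in> cball x0 (2 * r)" using cb[OF x] by blast
      have "norm (f n (x + v) - f m (x + v)) \<le> norm (f n (x + v) - g (x + v)) + norm (f m (x + v) - g (x + v))"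
        using norm_triangle_ineq4[of "f n (x + v) - g (x + v)" "f m (x + v) - g (x + v)"] by simp
      also have "\<dots> \<le> 2 * d" using nm[THEN bspec, OF y] by simp
      finally show "norm (f n (x + v) - f m (x + v)) \<le> 2 * d" .
    qed (use bS x in auto)
    have ev: "\<exists>N. \<forall>n\<ge>N. \<forall>y\<in>cball x0 (2 * r). norm (f n y - g y) \<le> d" if "d > 0" for d
    proof -
      have "\<forall>\<^sub>F n in sequentially. \<forall>y\<in>cball x0 (2 * r). dist (f n y) (g y) < d"
        using uniform_limitD[OF lim[OF compact_cball r(2)] that] .
      then show ?thesis unfolding eventually_sequentially dist_norm by (meson less_imp_le)
    qed
    have cau: "\<exists>N. \<forall>n\<ge>N. \<forall>m\<ge>N. \<forall>x\<in>ball x0 r. \<forall>h. norm (f' n x h - f' m x h) \<le> d * norm h" if "d > 0" for d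
    proof -
      obtain N where N: "\<forall>n\<ge>N. \<forall>y\<in>cball x0 (2 * r). norm (f n y - g y) \<le> d * r / 2"
        using ev[of "d * r / 2"] \<open>d > 0\<close> r(1) by (metis half_gt_zero mult_pos_pos)
      have "norm (f' n x h - f' m x h) \<le> 2 * (d * r / 2) / r * norm h" if "n \<ge> N" "m \<ge> N" "x \<in> ball x0 r" for n m x h
        by (rule diff) (use N that in auto)
      then show ?thesis using r by (intro exI[of _ N]) auto
    qed
    have conv: "convergent (\<lambda>n. f' n x h)" if x: "x \<in> ball x0 r" for x h
      unfolding Cauchy_convergent_iff[symmetric]
    proof (rule CauchyI)
      fix d :: real assume d: "d > 0"
      define d' where "d' = d / (norm h + 1)"
      have nh: "0 < norm h + 1" using norm_ge_zero[of h] by linarith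
      then have "d' > 0" using d by (simp add: d'_def)
      then obtain N where N: "\<forall>n\<ge>N. \<forall>m\<ge>N. \<forall>x\<in>ball x0 r. \<forall>h. norm (f' n x h - f' m x h) \<le> d' * norm h"
        using cau by blast
      have "d' * norm h < d" using d nh by (simp add: d'_def divide_less_eq)
      then show "\<exists>M. \<forall>m\<ge>M. \<forall>n\<ge>M. norm (f' m x h - f' n x h) < d"
        using N x by (meson le_less_trans)
    qed
    define g' where "g' = (\<lambda>x h. lim (\<lambda>n. f' n x h))"
    have g': "(\<lambda>n. f' n x h) \<longlonglongrightarrow> g' x h" if "x \<in> ball x0 r" for x h
      unfolding g'_def using conv[OF that] by (simp add: convergent_LIMSEQ_iff)
    have "\<exists>G. \<forall>x\<in>ball x0 r. (\<lambda>n. f n x) \<longlonglongrightarrow> G x \<and> (G has_derivative g' x) (at x within ball x0 r)"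
    proof (rule has_derivative_sequence[where f'=f'])
      show "(f n has_derivative f' n x) (at x within ball x0 r)" if "x \<in> ball x0 r" for n x
        using f'(1) bS[OF that] has_derivative_at_withinI by blast
      show "\<forall>\<^sub>F n in sequentially. \<forall>x\<in>ball x0 r. \<forall>h. norm (f' n x h - g' x h) \<le> d * norm h" if d: "d > 0" for d
      proof -
        obtain N where N: "\<forall>n\<ge>N. \<forall>m\<ge>N. \<forall>x\<in>ball x0 r. \<forall>h. norm (f' n x h - f' m x h) \<le> d * norm h"
          using cau[OF d] by blast
        have "norm (f' n x h - g' x h) \<le> d * norm h" if n: "n \<ge> N" and x: "x \<in> ball x0 r" for n x h
        proof (rule LIMSEQ_le_const2)
          show "(\<lambda>m. norm (f' n x h - f' m x h)) \<longlonglongrightarrow> norm (f' n x h - g' x h)"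
            by (intro tendsto_intros g' x)
          show "\<exists>N. \<forall>m\<ge>N. norm (f' n x h - f' m x h) \<le> d * norm h" using N n x by blast
        qed
        then show ?thesis unfolding eventually_sequentially by blast
      qed
      show "(\<lambda>n. f n x0) \<longlonglongrightarrow> g x0"
        using tendsto_uniform_limitI[OF lim[of "{x0}"]] x0 by simp
    qed (use r in auto)
    then obtain G where G: "\<And>x. x \<in> ball x0 r \<Longrightarrow> (\<lambda>n. f n x) \<longlonglongrightarrow> G x"
        "\<And>x. x \<in> ball x0 r \<Longrightarrow> (G has_derivative g' x) (at x within ball x0 r)" by blast
    have Gg: "G x = g x" if "x \<in> ball x0 r" for x
      using G(1)[OF that] tendsto_uniform_limitI[OF lim[of "{x}"]] bS[OF that] LIMSEQ_unique by force
    have x0b: "x0 \<in> ball x0 r" using r by simp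
    have "(G has_derivative g' x0) (at x0)"
      using G(2)[OF x0b] at_within_open[OF x0b open_ball] by simp
    then have "(g has_derivative g' x0) (at x0)"
      by (rule has_derivative_transform_within_open[OF _ open_ball x0b Gg])
    moreover have "clinear (g' x0)"
    proof (rule clinearI)
      show "g' x0 (u + v) = g' x0 u + g' x0 v" for u v
      proof (rule LIMSEQ_unique[OF g'[OF x0b]])
        show "(\<lambda>n. f' n x0 (u + v)) \<longlonglongrightarrow> g' x0 u + g' x0 v"
          unfolding clinear_simps(1)[OF f'(2)[OF x0]] by (intro tendsto_intros g' x0b)
      qed
      show "g' x0 (c *s u) = c *s g' x0 u" for c u
      proof (rule LIMSEQ_unique[OF g'[OF x0b]])
        show "(\<lambda>n. f' n x0 (c *s u)) \<longlonglongrightarrow> c *s g' x0 u"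
          unfolding clinear_simps(3)[OF f'(2)[OF x0]] by (intro tendsto_intros g' x0b)
      qed
    qed
    ultimately show ?thesis by blast
  qed
  then show ?thesis unfolding holomorphic_map_on_def by blast
qed

text \<open>The inverse function theorem asks for a continuous derivative, while
  \<open>holomorphic_map_on\<close> only provides a derivative at each point. The Cauchy bound for
  \<open>f\<close> at two points turns uniform continuity of \<open>f\<close> into continuity of the
  derivative.\<close>

lemma holomorphic_map_on_C1:
  fixes f :: "complex^'m \<Rightarrow> complex^'n"
  assumes S: "open S" and f: "holomorphic_map_on f S"
  obtains f' where "\<And>x. x \<in> S \<Longrightarrow> (f has_derivative blinfun_apply (f' x)) (at x)"
    "\<And>x. x \<in> S \<Longrightarrow> clinear (blinfun_apply (f' x))" "continuous_on S f'"
proof -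
  obtain F where F: "\<And>x. x \<in> S \<Longrightarrow> (f has_derivative F x) (at x)" "\<And>x. x \<in> S \<Longrightarrow> clinear (F x)"
    using f by (rule holomorphic_map_onE) blast
  define f' where "f' = (\<lambda>x. Blinfun (F x))"
  have f': "blinfun_apply (f' x) = F x" if "x \<in> S" for x
    unfolding f'_def using clinear_bounded_linear[OF F(2)[OF that]] by (simp add: bounded_linear_Blinfun_apply)
  have "continuous_on S f'" unfolding continuous_on_iff
  proof (intro ballI allI impI)
    fix x and e :: real assume x: "x \<in> S" and e: "e > 0"
    obtain q where q: "q > 0" "cball x q \<subseteq> S" using S x open_contains_cball by blast
    define r where "r = q / 2"
    have r: "r > 0" "cball x (2 * r) \<subseteq> S" using q by (simp_all add: r_def)
    have "uniformly_continuous_on (cball x (2 * r)) f"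
      by (rule compact_uniformly_continuous[OF continuous_on_subset[OF holomorphic_map_on_continuous[OF f] r(2)] compact_cball])
    then obtain d where d: "d > 0" "\<And>u v. u \<in> cball x (2*r) \<Longrightarrow> v \<in> cball x (2*r) \<Longrightarrow> dist v u < d \<Longrightarrow> dist (f v) (f u) < e / 2 * r"
      by (rule uniformly_continuous_onE[of _ _ "e / 2 * r"]) (use e r in auto)
    show "\<exists>d>0. \<forall>y\<in>S. dist y x < d \<longrightarrow> dist (f' y) (f' x) < e"
    proof (intro exI[of _ "min d r"] conjI ballI impI)
      fix y assume y: "y \<in> S" "dist y x < min d r"
      have in2: "y + v \<in> cball x (2 * r)" if "norm v \<le> r" for v
        using norm_triangle_ineq[of "y - x" v] that y(2)
        by (simp add: dist_norm norm_minus_commute[of x] add_diff_eq diff_add_eq)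
      have "norm (F y h - F x h) \<le> e / 2 * r / r * norm h" for h
      proof (rule cauchy_derivative_bound[OF f S _ F(1,2)[OF y(1)] f S _ F(1,2)[OF x] r(1)])
        show "cball x r \<subseteq> S" using r subset_cball[of r "2 * r" x] by auto
        show "cball y r \<subseteq> S"
        proof
          fix z assume "z \<in> cball y r"
          then have "norm (z - y) \<le> r" by (simp add: dist_norm norm_minus_commute)
          from in2[OF this] show "z \<in> S" using r by auto
        qed
        fix v :: "complex^'m" assume v: "norm v \<le> r"
        have "dist (f (y + v)) (f (x + v)) < e / 2 * r"
          by (rule d(2)) (use in2[OF v] v y(2) r in \<open>auto simp: dist_norm\<close>)
        then show "norm (f (y + v) - f (x + v)) \<le> e / 2 * r" by (simp add: dist_norm)
      qed
      then have "norm (f' y - f' x) \<le> e / 2"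
        using r e by (intro norm_blinfun_bound) (simp_all add: blinfun.diff_left f' x y(1))
      then show "dist (f' y) (f' x) < e" using e by (simp add: dist_norm)
    qed (use d r in auto)
  qed
  then show ?thesis using that[of f'] F f' by simp
qed

section \<open>Holomorphic retracts are submanifolds\<close>

lemma clinear_add: "\<lbrakk>clinear f; clinear g\<rbrakk> \<Longrightarrow> clinear (\<lambda>x. f x + g x)"
  by (rule clinearI) (simp_all add: clinear_simps vec.scale_right_distrib)

lemma clinear_diff: "\<lbrakk>clinear f; clinear g\<rbrakk> \<Longrightarrow> clinear (\<lambda>x. f x - g x)"
  by (rule clinearI) (simp_all add: clinear_simps vec.scale_right_diff_distrib)

text \<open>\<open>C\<close> sends the coordinate axes to a basis that extends one of
  \<open>R\<close>, with \<open>J\<close> indexing the latter; \<open>T\<close> is its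
  inverse.\<close>

lemma subspace_straighten:
  fixes R :: "(complex^'d) set"
  assumes R: "vec.subspace R"
  obtains T and J :: "'d set" where "clinear T" "bij T" "card J = vec.dim R"
    "T ` R = {y. \<forall>i. i \<notin> J \<longrightarrow> y $ i = 0}"
proof -
  obtain B1 where B1: "B1 \<subseteq> R" "vec.independent B1" "R \<subseteq> vec.span B1" "card B1 = vec.dim R"
    using vec.basis_exists by blast
  have spanB1: "vec.span B1 = R" using B1 R vec.span_minimal by blast
  obtain B2 where B2: "B1 \<subseteq> B2" "vec.independent B2" "UNIV \<subseteq> vec.span B2"
    using vec.maximal_independent_subset_extend[of B1 UNIV] B1(2) by auto
  have fin: "finite B2" using B2(2) vec.finiteI_independent by blast
  then have fin1: "finite B1" using B2(1) finite_subset by blast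
  have "card B2 = vec.dim (UNIV :: (complex^'d) set)"
  proof -
    have "vec.span B2 = vec.span UNIV" using B2(3) by auto
    from vec.dim_eq_card[OF this B2(2)] show ?thesis by simp
  qed
  then have "card B2 = CARD('d)" by (simp add: card_cart_basis)
  then obtain e :: "'d \<Rightarrow> complex^'d" where e: "bij_betw e UNIV B2"
    using finite_same_card_bij[of "UNIV :: 'd set" B2] fin by auto
  define J where "J = e -` B1"
  have eJ: "bij_betw e J B1"
    using e B2(1) unfolding J_def bij_betw_def by (auto simp: inj_on_def)
  define C where "C = (\<lambda>y :: complex^'d. \<Sum>i\<in>UNIV. y $ i *s e i)"
  have linC: "clinear C"
    by (rule clinearI) (simp_all add: C_def vec.scale_left_distrib sum.distrib vec.scale_sum_right)
  have surjC: "surj C"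
    unfolding surj_def
  proof
    fix x
    have "x \<in> vec.span B2" using B2(3) by blast
    then obtain u where u: "x = (\<Sum>v\<in>B2. u v *s v)" unfolding vec.span_finite[OF fin] by blast
    have "C (\<chi> i. u (e i)) = (\<Sum>i\<in>UNIV. u (e i) *s e i)" by (simp add: C_def)
    also have "\<dots> = x" unfolding u by (rule sum.reindex_bij_betw[OF e])
    finally show "\<exists>y. x = C y" by metis
  qed
  have injC: "inj C" using vec.linear_surjective_imp_injective[OF linC surjC] by simp
  have bijC: "bij C" using injC surjC by (rule bijI)
  have CJ: "C ` {y. \<forall>i. i \<notin> J \<longrightarrow> y $ i = 0} = R"
  proof (intro equalityI subsetI)
    fix x assume "x \<in> C ` {y. \<forall>i. i \<notin> J \<longrightarrow> y $ i = 0}"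
    then obtain y where y: "x = C y" "\<And>i. i \<notin> J \<Longrightarrow> y $ i = 0" by auto
    have "y $ i *s e i \<in> R" for i
    proof (cases "i \<in> J")
      case True
      then have "e i \<in> R" using B1(1) by (auto simp: J_def)
      then show ?thesis by (rule vec.subspace_scale[OF R])
    next
      case False
      then show ?thesis using y(2) vec.subspace_0[OF R] by simp
    qed
    then show "x \<in> R" unfolding y(1) C_def by (intro vec.subspace_sum[OF R])
  next
    fix x assume "x \<in> R"
    then have "x \<in> vec.span B1" using spanB1 by simp
    then obtain u where u: "x = (\<Sum>v\<in>B1. u v *s v)" unfolding vec.span_finite[OF fin1] by blast
    define y where "y = (\<chi> i. if i \<in> J then u (e i) else 0)"
    have "C y = (\<Sum>i\<in>UNIV. if i \<in> J then u (e i) *s e i else 0)"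
      unfolding C_def by (intro sum.cong) (auto simp: y_def)
    also have "\<dots> = (\<Sum>i\<in>J. u (e i) *s e i)" by (simp add: sum.If_cases)
    also have "\<dots> = x" unfolding u by (rule sum.reindex_bij_betw[OF eJ])
    finally have "x = C y" by simp
    moreover have "\<forall>i. i \<notin> J \<longrightarrow> y $ i = 0" by (simp add: y_def)
    ultimately show "x \<in> C ` {y. \<forall>i. i \<notin> J \<longrightarrow> y $ i = 0}" by blast
  qed
  show ?thesis
  proof (rule that)
    show "clinear (inv C)" by (rule clinear_inv[OF linC bijC])
    show "bij (inv C)" using bijC by (rule bij_imp_bij_inv)
    show "card J = vec.dim R" using bij_betw_same_card[OF eJ] B1(4) by simp
    show "inv C ` R = {y. \<forall>i. i \<notin> J \<longrightarrow> y $ i = 0}"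
      unfolding CJ[symmetric] image_image using injC by simp
  qed
qed

text \<open>On its range \<open>A\<close> is the identity, so a vector there that is killed by
  \<open>B\<close> has norm at most \<open>c\<close> times its norm. Hence \<open>B\<close> is
  injective on the range of \<open>A\<close>.\<close>

lemma projection_dim_le:
  fixes A B :: "complex^'d \<Rightarrow> complex^'d"
  assumes A: "clinear A" "\<And>x. A (A x) = A x" and B: "clinear B"
    and near: "\<And>x. norm (A x - B x) \<le> c * norm x" "c < 1"
  shows "vec.dim (range A) \<le> vec.dim (range B)"
proof -
  have sub: "vec.subspace (range A)"
    by (rule vec.linear_subspace_image[OF A(1) vec.subspace_UNIV])
  have "inj_on B (vec.span (range A))"
  proof (rule inj_onI)
    fix x y assume "x \<in> vec.span (range A)" "y \<in> vec.span (range A)" and eq: "B x = B y"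
    then have "x \<in> range A" "y \<in> range A" using sub by (simp_all add: vec.span_eq_iff[THEN iffD2])
    then have xy: "A x = x" "A y = y" using A(2) by auto
    have "norm (x - y) = norm (A (x - y) - B (x - y))"
      using xy eq by (simp add: clinear_simps[OF A(1)] clinear_simps[OF B])
    also have "\<dots> \<le> c * norm (x - y)" by (rule near)
    finally have "(1 - c) * norm (x - y) \<le> 0" by (simp add: algebra_simps)
    then have "norm (x - y) \<le> 0" using near(2) by (simp add: mult_le_0_iff)
    then show "x = y" by simp
  qed
  then have "vec.dim (B ` range A) = vec.dim (range A)" by (rule vec.dim_image_eq[OF B])
  moreover have "vec.dim (B ` range A) \<le> vec.dim (range B)" by (rule vec.dim_subset) auto
  ultimately show ?thesis by simp
qed

text \<open>Near a point of the retract, Cartan's map \<open>x \<mapsto> A (\<rho> x) + (I - A) (x - \<rho> x)\<close>, with \<open>A\<close> the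
  derivative of \<open>\<rho>\<close> there, has derivative \<open>I\<close> and conjugates \<open>\<rho>\<close> to the linear projection \<open>A\<close>.\<close>

lemma retract_chart:
  fixes \<rho> :: "complex^'d \<Rightarrow> complex^'d"
  assumes D: "open D" and hol: "holomorphic_map_on \<rho> D" and maps: "\<rho> ` D \<subseteq> D"
    and idem: "\<And>x. x \<in> D \<Longrightarrow> \<rho> (\<rho> x) = \<rho> x" and p: "p \<in> \<rho> ` D"
    and A: "(\<rho> has_derivative A) (at p)" "clinear A"
  shows "\<exists>U V \<phi> \<psi>. \<exists>J :: 'd set.
        open U \<and> p \<in> U \<and> open V \<and> card J = vec.dim (range A) \<and>
        holomorphic_map_on \<phi> U \<and> holomorphic_map_on \<psi> V \<and>
        \<phi> ` U = V \<and> \<psi> ` V = U \<and> (\<forall>x\<in>U. \<psi> (\<phi> x) = x) \<and> (\<forall>y\<in>V. \<phi> (\<psi> y) = y) \<and>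
        \<phi> ` (U \<inter> \<rho> ` D) = {y \<in> V. \<forall>i. i \<notin> J \<longrightarrow> y $ i = 0}"
proof -
  have pD: "p \<in> D" and rp: "\<rho> p = p" using p maps idem by auto
  have AA: "A (A x) = A x" for x
  proof -
    have A': "(\<rho> has_derivative A) (at (\<rho> p))" using A(1) rp by simp
    have "((\<lambda>x. \<rho> (\<rho> x)) has_derivative (\<lambda>h. A (A h))) (at p)"
      by (rule has_derivative_compose[OF A(1) A'])
    then have "(\<rho> has_derivative (\<lambda>h. A (A h))) (at p)"
      by (rule has_derivative_transform_within_open[OF _ D pD idem])
    then have "(\<lambda>h. A (A h)) = A" by (rule has_derivative_unique[OF _ A(1)])
    then show ?thesis by metis
  qed
  note Als = clinear_simps[OF A(2)]
  have subA: "vec.subspace (range A)"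
    by (rule vec.linear_subspace_image[OF A(2) vec.subspace_UNIV])
  obtain T and J :: "'d set" where T: "clinear T" "bij T" and J: "card J = vec.dim (range A)"
      "T ` range A = {y. \<forall>i. i \<notin> J \<longrightarrow> y $ i = 0}"
    by (rule subspace_straighten[OF subA])
  note Tls = clinear_simps[OF T(1)]
  have injT: "T x = T y \<longleftrightarrow> x = y" for x y using T(2) by (simp add: bij_is_inj inj_eq)
  define \<phi> where "\<phi> = (\<lambda>x. A (\<rho> x - p) + ((x - \<rho> x) - A (x - \<rho> x)))"
  define \<Phi> where "\<Phi> = (\<lambda>x. T (\<phi> x))"
  obtain r' where r': "\<And>x. x \<in> D \<Longrightarrow> (\<rho> has_derivative blinfun_apply (r' x)) (at x)"
    "\<And>x. x \<in> D \<Longrightarrow> clinear (blinfun_apply (r' x))" "continuous_on D r'"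
    using holomorphic_map_on_C1[OF D hol] by blast
  have r'p: "blinfun_apply (r' p) = A" using has_derivative_unique[OF r'(1)[OF pD] A(1)] .
  have blA: "bounded_linear A" and blT: "bounded_linear T" and blTi: "bounded_linear (inv T)"
    using A(2) T clinear_inv by (auto intro: clinear_bounded_linear)
  define \<Phi>' where "\<Phi>' = (\<lambda>x. Blinfun T o\<^sub>L ((Blinfun A o\<^sub>L r' x) + ((id_blinfun - r' x) - (Blinfun A o\<^sub>L (id_blinfun - r' x)))))"
  have \<Phi>'_apply: "blinfun_apply (\<Phi>' x) h = T (A (r' x h) + ((h - r' x h) - A (h - r' x h)))" for x h
    by (simp add: \<Phi>'_def blinfun.add_left blinfun.diff_left bounded_linear_Blinfun_apply blA blT)
  have d\<Phi>: "(\<Phi> has_derivative blinfun_apply (\<Phi>' x)) (at x)" if x: "x \<in> D" for x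
  proof -
    have "(\<Phi> has_derivative (\<lambda>h. T (A (r' x h) + ((h - r' x h) - A (h - r' x h))))) (at x)"
      unfolding \<Phi>_def \<phi>_def
      by (rule derivative_eq_intros bounded_linear.has_derivative[OF blT] bounded_linear.has_derivative[OF blA] r'(1)[OF x] refl | simp)+
    then show ?thesis using \<Phi>'_apply by presburger
  qed
  have c\<Phi>: "continuous_on D \<Phi>'" unfolding \<Phi>'_def by (intro continuous_intros r'(3))
  have lin\<Phi>: "clinear (blinfun_apply (\<Phi>' x))" if "x \<in> D" for x
  proof -
    have "clinear (\<lambda>h. T (A (r' x h) + ((h - r' x h) - A (h - r' x h))))"
      by (intro clinear_compose[OF T(1)] clinear_add clinear_diff clinear_compose[OF A(2)] r'(2)[OF that])
        (auto intro: clinearI)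
    then show ?thesis unfolding \<Phi>'_apply[symmetric] .
  qed
  \<comment> \<open>At \<open>p\<close> the derivative is \<open>T\<close>, since
    \<open>A A + (I - A) (I - A) = I\<close> for the projection \<open>A\<close>.\<close>
  have invT: "Blinfun (inv T) o\<^sub>L \<Phi>' p = id_blinfun"
  proof (rule blinfun_eqI)
    fix h
    have "blinfun_apply (\<Phi>' p) h = T h" unfolding \<Phi>'_apply r'p by (simp add: Als AA)
    then show "blinfun_apply (Blinfun (inv T) o\<^sub>L \<Phi>' p) h = blinfun_apply id_blinfun h"
      using T(2) by (simp add: bounded_linear_Blinfun_apply[OF blTi] bij_is_inj)
  qed
  obtain U' V' \<psi> \<psi>' where U': "open U'" "U' \<subseteq> D" "p \<in> U'" and V': "open V'" "\<Phi> p \<in> V'"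
    and hom: "homeomorphism U' V' \<Phi> \<psi>"
    and \<psi>': "\<And>y. y \<in> V' \<Longrightarrow> (\<psi> has_derivative \<psi>' y) (at y)"
      "\<And>y. y \<in> V' \<Longrightarrow> \<psi>' y = inv (blinfun_apply (\<Phi>' (\<psi> y)))"
      "\<And>y. y \<in> V' \<Longrightarrow> bij (blinfun_apply (\<Phi>' (\<psi> y)))"
  proof (rule inverse_function_theorem[OF D _ c\<Phi> pD invT])
    show "(\<Phi> has_derivative blinfun_apply (\<Phi>' x)) (at x)" if "x \<in> D" for x by (rule d\<Phi>[OF that])
  qed (rule that; assumption)
  have inv: "\<And>x. x \<in> U' \<Longrightarrow> \<psi> (\<Phi> x) = x" "\<And>y. y \<in> V' \<Longrightarrow> \<Phi> (\<psi> y) = y" "\<Phi> ` U' = V'" "\<psi> ` V' = U'"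
    using hom by (auto simp: homeomorphism_def)
  \<comment> \<open>Both \<open>x\<close> and \<open>\<rho> x\<close> must lie where
    \<open>\<Phi>\<close> is injective, in order to conclude \<open>\<rho> x = x\<close> from equal
    values.\<close>
  define U where "U = {x \<in> U'. \<rho> x \<in> U'}"
  have "open (U' \<inter> \<rho> -` U')"
    using continuous_open_preimage[OF continuous_on_subset[OF holomorphic_map_on_continuous[OF hol] U'(2)] U'(1) U'(1)] .
  then have opU: "open U" by (simp add: U_def vimage_def Int_def)
  define V where "V = \<Phi> ` U"
  have UU': "U \<subseteq> U'" by (auto simp: U_def)
  have VV': "V \<subseteq> V'" using inv(3) UU' by (auto simp: V_def)
  have "V = V' \<inter> \<psi> -` U" using inv UU' by (auto simp: V_def image_iff)
  moreover have "open (V' \<inter> \<psi> -` U)"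
    using hom V'(1) opU by (intro continuous_open_preimage) (auto simp: homeomorphism_def)
  ultimately have opV: "open V" by simp
  have hol\<Phi>: "holomorphic_map_on \<Phi> U"
    by (rule holomorphic_map_onI[where f'="\<lambda>x. blinfun_apply (\<Phi>' x)"]) (use d\<Phi> lin\<Phi> UU' U' in blast)+
  have hol\<psi>: "holomorphic_map_on \<psi> V"
  proof (rule holomorphic_map_onI[where f'=\<psi>'])
    fix y assume "y \<in> V"
    then have y: "y \<in> V'" using VV' by blast
    then have "\<psi> y \<in> D" using inv(4) U'(2) by blast
    then show "clinear (\<psi>' y)" unfolding \<psi>'(2)[OF y] using clinear_inv lin\<Phi> \<psi>'(3)[OF y] by blast
  qed (use \<psi>'(1) VV' in blast)
  have im\<psi>: "\<psi> ` V = U" using inv(1) UU' by (force simp: V_def image_image)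
  have imM: "\<Phi> ` (U \<inter> \<rho> ` D) = {y \<in> V. \<forall>i. i \<notin> J \<longrightarrow> y $ i = 0}"
  proof (intro equalityI subsetI)
    fix y assume "y \<in> \<Phi> ` (U \<inter> \<rho> ` D)"
    then obtain x where x: "x \<in> U" "x \<in> \<rho> ` D" "y = \<Phi> x" by blast
    then have "\<rho> x = x" using idem by auto
    then have "\<phi> x \<in> range A" by (simp add: \<phi>_def Als(4))
    then have "y \<in> T ` range A" using x(3) by (simp add: \<Phi>_def)
    then show "y \<in> {y \<in> V. \<forall>i. i \<notin> J \<longrightarrow> y $ i = 0}" unfolding J(2) using x by (auto simp: V_def)
  next
    fix y assume y: "y \<in> {y \<in> V. \<forall>i. i \<notin> J \<longrightarrow> y $ i = 0}"
    then obtain x where x: "x \<in> U" "y = \<Phi> x" by (auto simp: V_def)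
    have "y \<in> T ` range A" using y J(2) by simp
    then have "\<phi> x \<in> range A" using x(2) injT by (auto simp: \<Phi>_def)
    \<comment> \<open>Cartan's map satisfies \<open>\<phi> (\<rho> x) = A (\<phi> x)\<close>. As
      \<open>A\<close> fixes \<open>\<phi> x\<close>, the points \<open>x\<close> and
      \<open>\<rho> x\<close> have the same image.\<close>
    then have "A (\<phi> x) = \<phi> x" using AA by auto
    moreover have "A (A u + (v - A v)) = A u" for u v by (simp only: Als(1,2) AA) simp
    then have "A (\<phi> x) = A (\<rho> x - p)" unfolding \<phi>_def .
    moreover have xD: "x \<in> D" using x(1) UU' U' by blast
    have "\<phi> (\<rho> x) = A (\<rho> x - p)" using idem[OF xD] by (simp add: \<phi>_def Als)
    ultimately have "\<Phi> (\<rho> x) = \<Phi> x" by (simp add: \<Phi>_def)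
    then have "\<rho> x = x" using inv(1)[of "\<rho> x"] inv(1)[of x] x(1) by (auto simp: U_def)
    then have "x \<in> \<rho> ` D" using xD by (metis imageI)
    then show "y \<in> \<Phi> ` (U \<inter> \<rho> ` D)" using x by blast
  qed
  have pU: "p \<in> U" using U' rp by (simp add: U_def)
  have inv1: "\<forall>x\<in>U. \<psi> (\<Phi> x) = x" using inv(1) UU' by blast
  have inv2: "\<forall>y\<in>V. \<Phi> (\<psi> y) = y" using inv(2) VV' by blast
  show ?thesis
    by (intro exI[of _ U] exI[of _ V] exI[of _ \<Phi>] exI[of _ \<psi>] exI[of _ J] conjI
        opU pU opV J(1) hol\<Phi> hol\<psi> V_def[symmetric] im\<psi> inv1 inv2 imM)
qed

text \<open>At points of the retract the derivatives are projections, and nearby projections have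
  equal rank by \<open>projection_dim_le\<close>; the retract is connected, so the rank is constant.
  If it is 0, the derivative vanishes on all of \<open>D\<close>, because at \<open>x\<close> it
  factors through the derivative at \<open>\<rho> x\<close>.\<close>

lemma retract_submanifold:
  fixes \<rho> :: "complex^'d \<Rightarrow> complex^'d"
  assumes D: "open D" "convex D" "D \<noteq> {}" and hol: "holomorphic_map_on \<rho> D" and maps: "\<rho> ` D \<subseteq> D"
    and idem: "\<And>x. x \<in> D \<Longrightarrow> \<rho> (\<rho> x) = \<rho> x"
  obtains k where "complex_submanifold_of_dim k (\<rho> ` D)" "k \<le> CARD('d)"
    "k = 0 \<Longrightarrow> \<exists>c. \<forall>x\<in>D. \<rho> x = c"
proof -
  obtain r' where r': "\<And>x. x \<in> D \<Longrightarrow> (\<rho> has_derivative blinfun_apply (r' x)) (at x)"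
    "\<And>x. x \<in> D \<Longrightarrow> clinear (blinfun_apply (r' x))" "continuous_on D r'"
    using holomorphic_map_on_C1[OF D(1) hol] by blast
  let ?M = "\<rho> ` D"
  define rk where "rk = (\<lambda>x. vec.dim (range (blinfun_apply (r' x))))"
  have MD: "x \<in> D" "\<rho> x = x" if "x \<in> ?M" for x using that maps idem by auto
  have comp: "(\<lambda>h. r' (\<rho> x) (r' x h)) = blinfun_apply (r' x)" if x: "x \<in> D" for x
  proof -
    have "\<rho> x \<in> D" using maps x by blast
    then have "((\<lambda>x. \<rho> (\<rho> x)) has_derivative (\<lambda>h. r' (\<rho> x) (r' x h))) (at x)"
      by (rule has_derivative_compose[OF r'(1)[OF x] r'(1)])
    then have "(\<rho> has_derivative (\<lambda>h. r' (\<rho> x) (r' x h))) (at x)"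
      by (rule has_derivative_transform_within_open[OF _ D(1) x idem])
    then show ?thesis by (rule has_derivative_unique[OF _ r'(1)[OF x]])
  qed
  have proj: "r' x (r' x h) = r' x h" if "x \<in> ?M" for x h
    using comp[OF MD(1)[OF that]] MD(2)[OF that] by metis
  have loc: "\<exists>e>0. \<forall>y\<in>?M. dist y x < e \<longrightarrow> rk y = rk x" if x: "x \<in> ?M" for x
  proof -
    obtain e where e: "e > 0" "\<forall>y\<in>D. dist y x < e \<longrightarrow> dist (r' y) (r' x) < 1 / 2"
      using r'(3) MD(1)[OF x] unfolding continuous_on_iff by (metis half_gt_zero zero_less_one)
    have "rk y = rk x" if y: "y \<in> ?M" "dist y x < e" for y
    proof -
      have n: "norm (r' y - r' x) \<le> 1 / 2" using e(2) y MD(1)[OF y(1)] by (simp add: dist_norm less_imp_le)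
      have b: "norm (r' y h - r' x h) \<le> 1 / 2 * norm h" for h
      proof -
        have "norm (r' y h - r' x h) \<le> norm (r' y - r' x) * norm h"
          unfolding blinfun.diff_left[symmetric] by (rule norm_blinfun)
        also have "\<dots> \<le> 1 / 2 * norm h" using n by (intro mult_right_mono) auto
        finally show ?thesis .
      qed
      have "rk y \<le> rk x" unfolding rk_def
        by (rule projection_dim_le[OF r'(2)[OF MD(1)[OF y(1)]] proj[OF y(1)] r'(2)[OF MD(1)[OF x]] b]) simp
      moreover have b': "norm (r' x h - r' y h) \<le> 1 / 2 * norm h" for h using b[of h] by (simp add: norm_minus_commute)
      have "rk x \<le> rk y" unfolding rk_def
        by (rule projection_dim_le[OF r'(2)[OF MD(1)[OF x]] proj[OF x] r'(2)[OF MD(1)[OF y(1)]] b']) simp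
      ultimately show ?thesis by simp
    qed
    then show ?thesis using e by blast
  qed
  have conn: "connected ?M"
    using holomorphic_map_on_continuous[OF hol] convex_connected[OF D(2)] by (rule connected_continuous_image)
  obtain x0 where x0: "x0 \<in> ?M" using D(3) by blast
  have const: "rk x = rk x0" if x: "x \<in> ?M" for x
  proof (rule connected_local_const[OF conn x x0], rule ballI)
    fix a assume "a \<in> ?M"
    then show "\<forall>\<^sub>F b in at a within ?M. rk a = rk b"
      using loc unfolding eventually_at by metis
  qed
  show ?thesis
  proof (rule that[of "rk x0"])
    show "complex_submanifold_of_dim (rk x0) ?M" unfolding complex_submanifold_of_dim_def
    proof
      fix p assume p: "p \<in> ?M"
      show "\<exists>U V \<phi> \<psi>. \<exists>J :: 'd set.
        open U \<and> p \<in> U \<and> open V \<and> card J = rk x0 \<and>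
        holomorphic_map_on \<phi> U \<and> holomorphic_map_on \<psi> V \<and>
        \<phi> ` U = V \<and> \<psi> ` V = U \<and> (\<forall>x\<in>U. \<psi> (\<phi> x) = x) \<and> (\<forall>y\<in>V. \<phi> (\<psi> y) = y) \<and>
        \<phi> ` (U \<inter> \<rho> ` D) = {y \<in> V. \<forall>i. i \<notin> J \<longrightarrow> y $ i = 0}"
        unfolding const[OF p, symmetric] unfolding rk_def
        by (rule retract_chart[OF D(1) hol maps _ p r'(1)[OF MD(1)[OF p]] r'(2)[OF MD(1)[OF p]]]) (rule idem)
    qed
    show "rk x0 \<le> CARD('d)"
      using vec.dim_subset[of "range (blinfun_apply (r' x0))" UNIV] unfolding rk_def by (simp add: card_cart_basis)
    assume "rk x0 = 0"
    then have zero: "r' x h = 0" if "x \<in> ?M" for x h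
    proof -
      have "rk x = 0" using const[OF that] \<open>rk x0 = 0\<close> by simp
      then have "range (blinfun_apply (r' x)) \<subseteq> {0}" unfolding rk_def by simp
      then show ?thesis by blast
    qed
    have "(\<rho> has_derivative (\<lambda>h. 0)) (at x within D)" if x: "x \<in> D" for x
    proof -
      have "blinfun_apply (r' x) = (\<lambda>h. 0)" using comp[OF x] zero[of "\<rho> x"] x by auto
      then show ?thesis using r'(1)[OF x] has_derivative_at_withinI by metis
    qed
    then show "\<exists>c. \<forall>x\<in>D. \<rho> x = c" by (rule has_derivative_zero_constant[OF D(2)])
  qed
qed

section \<open>Limits of iterates\<close>

context cproper_convex
begin

lemma K_limit_le:
  assumes "\<And>n. a n \<in> D" "\<And>n. b n \<in> D" "a \<longlonglongrightarrow> x" "b \<longlonglongrightarrow> y" "x \<in> D" "y \<in> D" "\<And>n. K (a n) (b n) \<le> c"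
  shows "K x y \<le> c"
proof (rule LIMSEQ_le_const[of "\<lambda>n. K x (a n) + c + K y (b n)"])
  have "(\<lambda>n. K x (a n) + c + K y (b n)) \<longlonglongrightarrow> 0 + c + 0"
    by (intro tendsto_intros K_tendsto_0 assms)
  then show "(\<lambda>n. K x (a n) + c + K y (b n)) \<longlonglongrightarrow> c" by simp
  have "K x y \<le> K x (a n) + c + K y (b n)" for n
    using K_tri[OF assms(5,1) assms(6), of n] K_tri[OF assms(1) assms(2) assms(6), of n n] assms(7)[of n]
      K_sym[of y "b n"] by linarith
  then show "\<exists>N. \<forall>n\<ge>N. K x y \<le> K x (a n) + c + K y (b n)" by blast
qed

text \<open>Non-expansive maps are equicontinuous, so the argument may move along with the
  index.\<close>

lemma tendsto_nonexpansive:
  fixes F :: "nat \<Rightarrow> complex^'d \<Rightarrow> complex^'d"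
  assumes F: "\<And>n x. x \<in> D \<Longrightarrow> F n x \<in> D" "\<And>n x y. x \<in> D \<Longrightarrow> y \<in> D \<Longrightarrow> K (F n x) (F n y) \<le> K x y"
    and lim: "(\<lambda>n. F n x) \<longlonglongrightarrow> l" "l \<in> D" and x: "\<And>n. u n \<in> D" "u \<longlonglongrightarrow> x" "x \<in> D"
  shows "(\<lambda>n. F n (u n)) \<longlonglongrightarrow> l"
proof (rule tendsto_of_K[OF lim(2)])
  show "F n (u n) \<in> D" for n by (rule F(1)[OF x(1)])
  have "(\<lambda>n. K l (F n x) + K x (u n)) \<longlonglongrightarrow> 0 + 0"
    by (intro tendsto_add K_tendsto_0 lim x F(1))
  then have "(\<lambda>n. K l (F n x) + K x (u n)) \<longlonglongrightarrow> 0" by simp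
  then show "(\<lambda>n. K l (F n (u n))) \<longlonglongrightarrow> 0"
  proof (rule Lim_null_comparison[rotated], intro always_eventually allI)
    fix n
    have "K l (F n (u n)) \<le> K l (F n x) + K (F n x) (F n (u n))"
      by (intro K_tri lim F(1) x)
    then show "norm (K l (F n (u n))) \<le> K l (F n x) + K x (u n)"
      using F(2)[OF x(3) x(1), of n n] K_nonneg[OF lim(2) F(1)[OF x(1)], of n n] by simp
  qed
qed

text \<open>An Arzela-Ascoli argument for \<open>K\<close>: the maps are non-expansive, so a
  subsequence that converges on a countable dense set converges everywhere, uniformly on compact
  sets. The bound at one point confines the values at \<open>x\<close> to the compact ball
  \<open>C x\<close>, which keeps limits inside \<open>D\<close>.\<close>

lemma normal_family:
  fixes F :: "nat \<Rightarrow> complex^'d \<Rightarrow> complex^'d"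
  assumes hol: "\<And>n. holomorphic_map_on (F n) D" and maps: "\<And>n. F n ` D \<subseteq> D"
    and p: "p \<in> D" and bd: "\<And>n. K p (F n p) \<le> R"
  obtains r G where "strict_mono r" "holomorphic_map_on G D" "G ` D \<subseteq> D"
    "\<And>x. x \<in> D \<Longrightarrow> (\<lambda>n. F (r n) x) \<longlonglongrightarrow> G x"
proof -
  have FD: "F n x \<in> D" if "x \<in> D" for n x using maps that by blast
  have nonexp: "K (F n x) (F n y) \<le> K x y" if "x \<in> D" "y \<in> D" for n x y
    by (rule K_map[OF hol maps that])
  define C where "C = (\<lambda>x. {z \<in> D. K p z \<le> R + K p x})"
  have FC: "F n x \<in> C x" if "x \<in> D" for n x
    using K_tri[OF p FD[OF p] FD[OF that], of n n] nonexp[OF p that, of n] bd[of n] FD[OF that]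
    unfolding C_def by (simp add: add_mono order_trans)
  have Ccomp: "compact (C x)" for x unfolding C_def by (rule K_ball_compact[OF p])
  have "\<exists>B>0. \<forall>z\<in>C x. norm z \<le> B" for x
    using compact_imp_bounded[OF Ccomp] unfolding bounded_pos .
  then obtain B where B: "\<And>x. B x > 0" "\<And>x z. z \<in> C x \<Longrightarrow> norm z \<le> B x" by metis
  obtain Q where Q: "countable Q" "Q \<subseteq> D" "D \<subseteq> closure Q" using separable by blast
  \<comment> \<open>The diagonal argument wants one bound for all points, whence the rescaling by
    \<open>1 / B x\<close>.\<close>
  obtain r where r: "strict_mono r" and conv: "\<And>x. x \<in> Q \<Longrightarrow> \<exists>l. (\<lambda>n. (1 / B x) *\<^sub>R F (r n) x) \<longlonglongrightarrow> l"
  proof (rule function_convergent_subsequence[OF Q(1), of "\<lambda>n x. (1 / B x) *\<^sub>R F n x" 1])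
    show "norm ((1 / B x) *\<^sub>R F n x) \<le> 1" if "x \<in> Q" for n x
      using B(2)[OF FC, of x n] B(1)[of x] that Q(2) by auto
  qed (rule that; assumption)
  have convQ: "\<exists>l\<in>D. (\<lambda>n. F (r n) x) \<longlonglongrightarrow> l" if x: "x \<in> Q" for x
  proof -
    obtain l where "(\<lambda>n. (1 / B x) *\<^sub>R F (r n) x) \<longlonglongrightarrow> l" using conv x by blast
    then have "(\<lambda>n. B x *\<^sub>R ((1 / B x) *\<^sub>R F (r n) x)) \<longlonglongrightarrow> B x *\<^sub>R l" by (intro tendsto_intros)
    then have l: "(\<lambda>n. F (r n) x) \<longlonglongrightarrow> B x *\<^sub>R l" using B(1)[of x] by simp
    have "F (r n) x \<in> C x" for n using FC x Q by blast
    then have "B x *\<^sub>R l \<in> C x" using closed_sequentially[OF compact_imp_closed[OF Ccomp] _ l] by blast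
    then show ?thesis using l unfolding C_def by blast
  qed
  have convD: "\<exists>l\<in>D. (\<lambda>n. F (r n) x) \<longlonglongrightarrow> l" if x: "x \<in> D" for x
  proof -
    have "\<forall>n. F (r n) x \<in> C x" using FC[OF x] by blast
    then obtain l s where ls: "l \<in> C x" "strict_mono s" "((\<lambda>n. F (r n) x) \<circ> s) \<longlonglongrightarrow> l"
      by (rule seq_compactE[OF compact_imp_seq_compact[OF Ccomp]])
    have lD: "l \<in> D" using ls(1) by (simp add: C_def)
    have "(\<lambda>n. K l (F (r n) x)) \<longlonglongrightarrow> 0"
    proof (rule LIMSEQ_I)
      fix e :: real assume e: "e > 0"
      have "x \<in> closure Q" using Q(3) x by blast
      then obtain w where w: "\<And>n. w n \<in> Q" "w \<longlonglongrightarrow> x" unfolding closure_sequential by blast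
      have "(\<lambda>n. K x (w n)) \<longlonglongrightarrow> 0" using w Q(2) by (intro K_tendsto_0[OF x]) auto
      then have "\<forall>\<^sub>F n in sequentially. K x (w n) < e / 4" by (rule order_tendstoD) (use e in simp)
      then obtain q where q: "q \<in> Q" "K x q < e / 4" using w(1) unfolding eventually_sequentially by blast
      have qD: "q \<in> D" using q Q by blast
      obtain lq where lq: "lq \<in> D" "(\<lambda>n. F (r n) q) \<longlonglongrightarrow> lq" using convQ q by blast
      have "(\<lambda>n. K l (F (r (s n)) x) + K lq (F (r (s n)) q) + K lq (F (r n) q)) \<longlonglongrightarrow> 0 + 0 + 0"
        using ls(3) LIMSEQ_subseq_LIMSEQ[OF lq(2) ls(2)] lq(2)
        by (intro tendsto_add K_tendsto_0 lD lq(1) FD[OF x] FD[OF qD]) (simp_all add: o_def)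
      then have "\<forall>\<^sub>F n in sequentially. K l (F (r (s n)) x) + K lq (F (r (s n)) q) + K lq (F (r n) q) < e / 4"
        by (rule order_tendstoD) (use e in simp)
      then obtain N where N: "\<And>n. n \<ge> N \<Longrightarrow> K l (F (r (s n)) x) + K lq (F (r (s n)) q) + K lq (F (r n) q) < e / 4"
        unfolding eventually_sequentially by blast
      have "norm (K l (F (r n) x) - 0) < e" if n: "n \<ge> N" for n
      proof -
        let ?a = "F (r (s n)) x" and ?b = "F (r (s n)) q" and ?c = "F (r n) q" and ?d = "F (r n) x"
        have D: "?a \<in> D" "?b \<in> D" "?c \<in> D" "?d \<in> D" using FD x qD by auto
        have "K l ?d \<le> K l ?a + K ?a ?b + K ?b lq + K lq ?c + K ?c ?d"
          using K_tri[OF lD D(1) D(4)] K_tri[OF D(1) D(2) D(4)] K_tri[OF D(2) lq(1) D(4)] K_tri[OF lq(1) D(3) D(4)]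
          by linarith
        moreover have "K ?a ?b \<le> K x q" "K ?c ?d \<le> K x q"
          using nonexp[OF x qD] nonexp[OF qD x, of "r n"] K_sym[of q x] by auto
        ultimately show ?thesis
          using N[OF n] q(2) K_sym[of ?b lq] K_nonneg[OF lD D(4)] by simp
      qed
      then show "\<exists>no. \<forall>n\<ge>no. norm (K l (F (r n) x) - 0) < e" by blast
    qed
    then have "(\<lambda>n. F (r n) x) \<longlonglongrightarrow> l" by (rule tendsto_of_K[OF lD FD[OF x]])
    then show ?thesis using lD by blast
  qed
  then obtain G where G: "\<And>x. x \<in> D \<Longrightarrow> G x \<in> D" "\<And>x. x \<in> D \<Longrightarrow> (\<lambda>n. F (r n) x) \<longlonglongrightarrow> G x" by metis
  have Gnonexp: "K (G x) (G y) \<le> K x y" if "x \<in> D" "y \<in> D" for x y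
    by (rule K_limit_le[OF FD[OF that(1)] FD[OF that(2)] G(2)[OF that(1)] G(2)[OF that(2)] G(1)[OF that(1)] G(1)[OF that(2)] nonexp[OF that]])
  have "uniform_limit A (\<lambda>n. F (r n)) G sequentially" if A: "compact A" "A \<subseteq> D" for A
    unfolding uniform_limit_iff
  proof (intro allI impI, rule ccontr)
    fix e :: real assume e: "e > 0" and "\<not> (\<forall>\<^sub>F n in sequentially. \<forall>x\<in>A. dist (F (r n) x) (G x) < e)"
    then have "\<forall>N. \<exists>n. n \<ge> N \<and> (\<exists>x\<in>A. e \<le> dist (F (r n) x) (G x))"
      unfolding eventually_sequentially by (meson not_less)
    then obtain n x where n: "\<And>j. j \<le> n j" and x: "\<And>j. x j \<in> A" "\<And>j::nat. e \<le> dist (F (r (n j)) (x j)) (G (x j))"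
      by metis
    obtain l s where ls: "l \<in> A" "strict_mono s" "(x \<circ> s) \<longlonglongrightarrow> l"
      using seq_compactE[OF compact_imp_seq_compact[OF A(1)], of x] x(1) by blast
    have lD: "l \<in> D" and xD: "\<And>j. x j \<in> D" using ls(1) x(1) A(2) by auto
    have "j \<le> n (s j)" for j using seq_suble[OF ls(2), of j] n[of "s j"] by linarith
    then have fl: "filterlim (\<lambda>j. n (s j)) sequentially sequentially"
      by (auto simp: filterlim_at_top eventually_sequentially intro: order_trans)
    have "(\<lambda>j. F (r (n (s j))) (x (s j))) \<longlonglongrightarrow> G l"
      using ls(3) by (intro tendsto_nonexpansive[OF FD nonexp filterlim_compose[OF G(2)[OF lD] fl] G(1)[OF lD] xD _ lD])
        (simp_all add: o_def)
    moreover have "(\<lambda>j. G (x (s j))) \<longlonglongrightarrow> G l"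
      using ls(3) by (intro tendsto_nonexpansive[OF G(1) Gnonexp tendsto_const G(1)[OF lD] xD _ lD])
        (simp_all add: o_def)
    ultimately have "(\<lambda>j. dist (F (r (n (s j))) (x (s j))) (G (x (s j)))) \<longlonglongrightarrow> dist (G l) (G l)"
      by (intro tendsto_intros)
    then have "e \<le> dist (G l) (G l)" using x(2) by (intro LIMSEQ_le_const) blast+
    then show False using e by simp
  qed
  then have "holomorphic_map_on G D" by (rule holomorphic_map_on_limit[OF D_open hol])
  then show ?thesis using that[OF r] G by blast
qed

text \<open>A limit \<open>L'\<close> of the maps \<open>L n\<close> satisfies
  \<open>h L' = L' h = G\<close>, so it inverts \<open>h\<close> on the retract, where
  \<open>G\<close> is the identity. Composing with \<open>G\<close> puts the values of the inverse
  \<open>k\<close> in the retract by construction.\<close>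

lemma retract_automorphism:
  fixes L :: "nat \<Rightarrow> complex^'d \<Rightarrow> complex^'d"
  assumes G: "G ` D \<subseteq> D" "\<And>x. x \<in> D \<Longrightarrow> G (G x) = G x" "holomorphic_map_on G D"
    and h: "holomorphic_map_on h D" "h ` D \<subseteq> D"
    and L: "\<And>n. holomorphic_map_on (L n) D" "\<And>n. L n ` D \<subseteq> D"
    and comm: "\<And>n x. x \<in> D \<Longrightarrow> L n (h x) = h (L n x)"
    and lim: "\<And>x. x \<in> D \<Longrightarrow> (\<lambda>n. h (L n x)) \<longlonglongrightarrow> G x"
  shows "h ` G ` D = G ` D" "restricts_to_automorphism h (G ` D)"
proof -
  have GD: "G x \<in> D" and hD: "h x \<in> D" and LD: "L n x \<in> D" if "x \<in> D" for x n
    using G(1) h(2) L(2) that by blast+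
  have hcont: "(\<lambda>n. h (u n)) \<longlonglongrightarrow> h x" if "x \<in> D" "u \<longlonglongrightarrow> x" for u x
    using holomorphic_map_on_continuous[OF h(1)] that D_open
    by (metis at_within_open continuous_on_def tendsto_compose_at filterlim_compose continuous_on_eq_continuous_at isCont_tendsto_compose)
  have hG: "h (G x) = G (h x)" if x: "x \<in> D" for x
  proof (rule LIMSEQ_unique[of "\<lambda>n. h (h (L n x))"])
    show "(\<lambda>n. h (h (L n x))) \<longlonglongrightarrow> h (G x)" by (rule hcont[OF GD[OF x] lim[OF x]])
    show "(\<lambda>n. h (h (L n x))) \<longlonglongrightarrow> G (h x)" using lim[OF hD[OF x]] comm[OF x] by simp
  qed
  obtain p where p: "p \<in> D" using D_nonempty by blast
  have "(\<lambda>n. K p (h (L n p))) \<longlonglongrightarrow> K p (G p)"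
    using continuous_on_tendsto_compose[OF K_continuous[OF p] lim[OF p] GD[OF p]] hD LD p by simp
  then have "bounded (range (\<lambda>n. K p (h (L n p))))" by (rule convergent_imp_bounded)
  then obtain B where B: "\<And>n. \<bar>K p (h (L n p))\<bar> \<le> B" unfolding bounded_iff by auto
  \<comment> \<open>The points \<open>h (L n p) = L n (h p)\<close> converge and hence stay bounded,
    and \<open>L n p\<close> is at distance at most \<open>K (h p) p\<close> from them.\<close>
  have bdL: "K p (L n p) \<le> B + K (h p) p" for n
  proof -
    have "K p (L n p) \<le> K p (L n (h p)) + K (L n (h p)) (L n p)"
      by (intro K_tri p LD hD)
    moreover have "K (L n (h p)) (L n p) \<le> K (h p) p" by (rule K_map[OF L hD[OF p] p])
    ultimately show ?thesis using B[of n] comm[OF p, of n] by simp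
  qed
  obtain r L' where r: "strict_mono r" and L': "holomorphic_map_on L' D" "L' ` D \<subseteq> D"
      "\<And>x. x \<in> D \<Longrightarrow> (\<lambda>n. L (r n) x) \<longlonglongrightarrow> L' x"
    by (rule normal_family[of L, OF L p bdL]) blast
  have L'D: "L' x \<in> D" if "x \<in> D" for x using L'(2) that by blast
  have limr: "(\<lambda>n. h (L (r n) x)) \<longlonglongrightarrow> G x" if "x \<in> D" for x
    using LIMSEQ_subseq_LIMSEQ[OF lim[OF that] r] by (simp add: o_def)
  have hL': "h (L' x) = G x" if x: "x \<in> D" for x
    using hcont[OF L'D[OF x] L'(3)[OF x]] limr[OF x] LIMSEQ_unique by blast
  have L'h: "L' (h x) = G x" if x: "x \<in> D" for x
    using L'(3)[OF hD[OF x]] limr[OF x] comm[OF x] LIMSEQ_unique by simp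
  let ?M = "G ` D"
  have M: "x \<in> D" "G x = x" if "x \<in> ?M" for x using that G(1,2) by auto
  define k where "k = (\<lambda>x. G (L' x))"
  have kh: "k (h x) = x" "h (k x) = x" "h x \<in> ?M" "k x \<in> ?M" if x: "x \<in> ?M" for x
  proof -
    show "k (h x) = x" using L'h[OF M(1)[OF x]] G(2)[OF M(1)[OF x]] M(2)[OF x] by (simp add: k_def)
    show "h (k x) = x"
      using hG[OF L'D[OF M(1)[OF x]]] hL'[OF M(1)[OF x]] G(2)[OF M(1)[OF x]] M(2)[OF x] by (simp add: k_def)
    show "h x \<in> ?M" using hG[OF M(1)[OF x]] M(2)[OF x] hD[OF M(1)[OF x]] by (metis imageI)
    show "k x \<in> ?M" using L'D[OF M(1)[OF x]] by (auto simp: k_def)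
  qed
  have bij: "bij_betw h ?M ?M"
    by (rule bij_betw_byWitness[where f'=k]) (use kh in auto)
  then show "h ` G ` D = G ` D" by (simp add: bij_betw_def)
  have MD: "?M \<subseteq> D" by (rule G(1))
  have "inv_into ?M h x = k x" if "x \<in> ?M" for x
    using bij kh that by (intro inv_into_f_eq) (auto simp: bij_betw_def)
  moreover have "holomorphic_map_on k D"
    unfolding k_def by (rule holomorphic_map_on_compose[OF G(3) L'(1,2)])
  ultimately show "restricts_to_automorphism h ?M"
    unfolding restricts_to_automorphism_def holomorphic_on_submanifold_def
    using bij h(1) D_open MD by (intro conjI) (metis IntD2 subsetD)+
qed

text \<open>Along a sequence with \<open>f\<^sup>n g\<^sup>m\<close> tending to \<open>F\<close>, compare an index pair \<open>(n, m)\<close> with a much later one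
  \<open>(N, M)\<close>. The maps with exponents \<open>N - 2 n\<close> and \<open>M - 2 m\<close> tend to some \<open>H\<close>, and those with exponents
  \<open>N - n\<close> and \<open>M - m\<close> to \<open>G = F H = H F\<close>. Then \<open>G F = F\<close>, so that \<open>G G = G F H = F H = G\<close>.\<close>

lemma commuting_retract:
  assumes f: "holomorphic_map_on f D" "f ` D \<subseteq> D" and g: "holomorphic_map_on g D" "g ` D \<subseteq> D"
    and comm: "\<And>x. x \<in> D \<Longrightarrow> f (g x) = g (f x)" and p: "p \<in> D"
    and bd: "\<And>N. \<exists>n\<ge>N. \<exists>m\<ge>N. K p ((f ^^ n) ((g ^^ m) p)) \<le> R"
  obtains G where "holomorphic_map_on G D" "G ` D \<subseteq> D" "\<And>x. x \<in> D \<Longrightarrow> G (G x) = G x"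
    "f ` G ` D = G ` D" "restricts_to_automorphism f (G ` D)"
    "g ` G ` D = G ` D" "restricts_to_automorphism g (G ` D)"
proof -
  have fD: "(f ^^ n) x \<in> D" and gD: "(g ^^ n) x \<in> D" if "x \<in> D" for n x
    using holomorphic_map_on_funpow(2)[OF f] holomorphic_map_on_funpow(2)[OF g] that by blast+
  have c2: "(f ^^ n) ((g ^^ m) x) = (g ^^ m) ((f ^^ n) x)" if "x \<in> D" for n m x
    by (rule funpow_commute_on[OF _ f(2) g(2) that]) (rule comm)
  define P where "P = (\<lambda>n m x. (f ^^ n) ((g ^^ m) x))"
  have PD: "P n m x \<in> D" if "x \<in> D" for n m x using that fD gD by (simp add: P_def)
  have Pmaps: "P n m ` D \<subseteq> D" for n m using PD by blast
  have Phol: "holomorphic_map_on (P n m) D" for n m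
    unfolding P_def
    by (rule holomorphic_map_on_compose[OF holomorphic_map_on_funpow(1)[OF f] holomorphic_map_on_funpow[OF g]])
  have PP: "P n m (P n' m' x) = P (n + n') (m + m') x" if "x \<in> D" for n m n' m' x
  proof -
    have "(g ^^ m) ((f ^^ n') ((g ^^ m') x)) = (f ^^ n') ((g ^^ m) ((g ^^ m') x))"
      using c2[OF gD[OF that]] by metis
    then show ?thesis by (simp add: P_def funpow_add)
  qed
  have Pnonexp: "K (P n m x) (P n m y) \<le> K x y" if "x \<in> D" "y \<in> D" for n m x y
    by (rule K_map[OF Phol Pmaps that])
  obtain n0 m0 where n0: "\<And>j. j \<le> n0 j" "\<And>j. j \<le> m0 j" "\<And>j. K p (P (n0 j) (m0 j) p) \<le> R"
    using bd unfolding P_def by metis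
  obtain r F where r: "strict_mono r" and F: "holomorphic_map_on F D" "F ` D \<subseteq> D"
      "\<And>x. x \<in> D \<Longrightarrow> (\<lambda>j. P (n0 (r j)) (m0 (r j)) x) \<longlonglongrightarrow> F x"
    by (rule normal_family[of "\<lambda>j. P (n0 j) (m0 j)", OF Phol Pmaps p n0(3)]) blast
  have FD: "F x \<in> D" if "x \<in> D" for x using F(2) that by blast
  define n where "n = (\<lambda>j. n0 (r j))"
  define m where "m = (\<lambda>j. m0 (r j))"
  have nm: "j \<le> n j" "j \<le> m j" for j
    using n0(1,2)[of "r j"] seq_suble[OF r, of j] by (simp_all add: n_def m_def order_trans)
  \<comment> \<open>So far out that both exponents at index \<open>i j\<close> exceed twice those at
    \<open>j\<close> by at least \<open>j\<close>. The natural subtractions below are then exact,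
    and the differences tend to infinity.\<close>
  define i where "i = (\<lambda>j. 2 * n j + 2 * m j + j)"
  define \<alpha> where "\<alpha> = (\<lambda>j. n (i j) - 2 * n j)"
  define \<beta> where "\<beta> = (\<lambda>j. m (i j) - 2 * m j)"
  have ab: "n (i j) = \<alpha> j + 2 * n j" "m (i j) = \<beta> j + 2 * m j" "j \<le> \<alpha> j" "j \<le> \<beta> j" for j
    using nm[of "i j"] by (auto simp: i_def \<alpha>_def \<beta>_def)
  have fl: "filterlim h sequentially sequentially" if "\<And>j. j \<le> h j" for h :: "nat \<Rightarrow> nat"
    using that by (auto simp: filterlim_at_top eventually_sequentially intro: order_trans)
  have limE: "(\<lambda>j. P (n j) (m j) x) \<longlonglongrightarrow> F x" if "x \<in> D" for x
    using F(3)[OF that] by (simp add: n_def m_def)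
  have "j \<le> i j" for j by (simp add: i_def)
  then have limEi: "(\<lambda>j. P (n (i j)) (m (i j)) x) \<longlonglongrightarrow> F x" if "x \<in> D" for x
    by (intro filterlim_compose[OF limE[OF that]] fl)
  have moveP: "(\<lambda>j. P (a j) (b j) (u j)) \<longlonglongrightarrow> l"
    if "(\<lambda>j. P (a j) (b j) x) \<longlonglongrightarrow> l" "l \<in> D" "\<And>j. u j \<in> D" "u \<longlonglongrightarrow> x" "x \<in> D" for a b u x l
    by (rule tendsto_nonexpansive[where F="\<lambda>j. P (a j) (b j)", OF PD Pnonexp that])
  have "(\<lambda>j. P (n j) (m j) (P (n j) (m j) p)) \<longlonglongrightarrow> F (F p)"
    by (rule moveP[OF limE[OF FD[OF p]] FD[OF FD[OF p]] PD[OF p] limE[OF p] FD[OF p]])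
  then have "(\<lambda>j. K (F (F p)) (P (n j) (m j) (P (n j) (m j) p)) + K p (P (n (i j)) (m (i j)) p)) \<longlonglongrightarrow> 0 + K p (F p)"
    using continuous_on_tendsto_compose[OF K_continuous[OF p] limEi[OF p] FD[OF p]]
    by (intro tendsto_add K_tendsto_0) (simp_all add: PD FD p)
  then have "bounded (range (\<lambda>j. K (F (F p)) (P (n j) (m j) (P (n j) (m j) p)) + K p (P (n (i j)) (m (i j)) p)))"
    by (rule convergent_imp_bounded)
  then obtain B where B: "\<And>j. \<bar>K (F (F p)) (P (n j) (m j) (P (n j) (m j) p)) + K p (P (n (i j)) (m (i j)) p)\<bar> \<le> B"
    unfolding bounded_iff by auto
  \<comment> \<open>The maps with the difference exponents are controlled at a moving point, the
    two-fold image of \<open>p\<close> at index \<open>j\<close>, which they send to the image of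
    \<open>p\<close> at index \<open>i j\<close>. That point converges to \<open>F (F p)\<close>, so
    non-expansiveness transfers the control to \<open>p\<close>.\<close>
  have Hbd: "K p (P (\<alpha> j) (\<beta> j) p) \<le> B + K (F (F p)) p" for j
  proof -
    let ?e = "P (n j) (m j) (P (n j) (m j) p)" and ?q = "F (F p)"
    have D: "?e \<in> D" "?q \<in> D" using PD FD p by auto
    have eq: "P (\<alpha> j) (\<beta> j) ?e = P (n (i j)) (m (i j)) p"
      using p by (simp add: PP PD ab mult_2)
    have "K p (P (\<alpha> j) (\<beta> j) p) \<le> K p (P (\<alpha> j) (\<beta> j) ?e) + K (P (\<alpha> j) (\<beta> j) ?e) (P (\<alpha> j) (\<beta> j) ?q)
        + K (P (\<alpha> j) (\<beta> j) ?q) (P (\<alpha> j) (\<beta> j) p)"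
      using K_tri[OF p PD[OF D(1)] PD[OF p], of "\<alpha> j" "\<beta> j" "\<alpha> j" "\<beta> j"]
        K_tri[OF PD[OF D(1)] PD[OF D(2)] PD[OF p], of "\<alpha> j" "\<beta> j" "\<alpha> j" "\<beta> j" "\<alpha> j" "\<beta> j"] by linarith
    also have "\<dots> \<le> K p (P (n (i j)) (m (i j)) p) + K ?e ?q + K ?q p"
      unfolding eq[symmetric] by (intro add_mono order_refl Pnonexp D p)
    finally show ?thesis using B[of j] K_sym[of ?e ?q] by simp
  qed
  obtain q H where q: "strict_mono q" and H: "holomorphic_map_on H D" "H ` D \<subseteq> D"
      "\<And>x. x \<in> D \<Longrightarrow> (\<lambda>j. P (\<alpha> (q j)) (\<beta> (q j)) x) \<longlonglongrightarrow> H x"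
    by (rule normal_family[of "\<lambda>j. P (\<alpha> j) (\<beta> j)", OF Phol Pmaps p Hbd]) blast
  have HD: "H x \<in> D" if "x \<in> D" for x using H(2) that by blast
  have flq: "filterlim q sequentially sequentially" by (rule fl) (rule seq_suble[OF q])
  define G where "G = (\<lambda>x. H (F x))"
  define \<nu> where "\<nu> = (\<lambda>j. \<alpha> (q j) + n (q j))"
  define \<mu> where "\<mu> = (\<lambda>j. \<beta> (q j) + m (q j))"
  have numu: "j \<le> \<nu> j" "j \<le> \<mu> j" for j
    using ab(3,4)[of "q j"] seq_suble[OF q, of j] by (simp_all add: \<nu>_def \<mu>_def order_trans trans_le_add1)
  have GD: "G x \<in> D" if "x \<in> D" for x using that HD FD by (simp add: G_def)
  have limEq: "(\<lambda>j. P (n (q j)) (m (q j)) x) \<longlonglongrightarrow> F x" if "x \<in> D" for x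
    by (rule filterlim_compose[OF limE[OF that] flq])
  have limG: "(\<lambda>j. P (\<nu> j) (\<mu> j) x) \<longlonglongrightarrow> G x" if x: "x \<in> D" for x
  proof -
    have "(\<lambda>j. P (\<alpha> (q j)) (\<beta> (q j)) (P (n (q j)) (m (q j)) x)) \<longlonglongrightarrow> H (F x)"
      by (rule moveP[OF H(3)[OF FD[OF x]] HD[OF FD[OF x]] PD[OF x] limEq[OF x] FD[OF x]])
    then show ?thesis using x by (simp add: PP \<nu>_def \<mu>_def G_def)
  qed
  have FH: "F (H x) = G x" if x: "x \<in> D" for x
  proof (rule LIMSEQ_unique[OF _ limG[OF x]])
    have "(\<lambda>j. P (n (q j)) (m (q j)) (P (\<alpha> (q j)) (\<beta> (q j)) x)) \<longlonglongrightarrow> F (H x)"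
      by (rule moveP[OF limEq[OF HD[OF x]] FD[OF HD[OF x]] PD[OF x] H(3)[OF x] HD[OF x]])
    then show "(\<lambda>j. P (\<nu> j) (\<mu> j) x) \<longlonglongrightarrow> F (H x)" using x by (simp add: PP \<nu>_def \<mu>_def add.commute)
  qed
  have GF: "G (F x) = F x" if x: "x \<in> D" for x
  proof (rule LIMSEQ_unique)
    show "(\<lambda>j. P (\<nu> j) (\<mu> j) (P (n (q j)) (m (q j)) x)) \<longlonglongrightarrow> G (F x)"
      by (rule moveP[OF limG[OF FD[OF x]] GD[OF FD[OF x]] PD[OF x] limEq[OF x] FD[OF x]])
    have "P (\<nu> j) (\<mu> j) (P (n (q j)) (m (q j)) x) = P (n (i (q j))) (m (i (q j))) x" for j
      using x by (simp add: PP \<nu>_def \<mu>_def ab mult_2 add.assoc)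
    then show "(\<lambda>j. P (\<nu> j) (\<mu> j) (P (n (q j)) (m (q j)) x)) \<longlonglongrightarrow> F x"
      using filterlim_compose[OF limEi[OF x] flq] by simp
  qed
  have GG: "G (G x) = G x" if x: "x \<in> D" for x using GF[OF HD[OF x]] FH[OF x] by simp
  have Ghol: "holomorphic_map_on G D"
    unfolding G_def by (rule holomorphic_map_on_compose[OF H(1) F(1,2)])
  have Gmaps: "G ` D \<subseteq> D" using GD by blast
  \<comment> \<open>The shift by one makes both exponents positive, so that one factor
    \<open>f\<close> or \<open>g\<close> can be split off.\<close>
  have limS: "(\<lambda>j. P (\<nu> (Suc j)) (\<mu> (Suc j)) x) \<longlonglongrightarrow> G x" if "x \<in> D" for x
    using limG[OF that] by (rule LIMSEQ_Suc)
  have pos: "Suc (\<nu> (Suc j) - Suc 0) = \<nu> (Suc j)" "Suc (\<mu> (Suc j) - Suc 0) = \<mu> (Suc j)" for j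
    using numu[of "Suc j"] by auto
  have P1: "P 1 0 x = f x" "P 0 1 x = g x" for x by (simp_all add: P_def)
  have f1: "P a b (f x) = P (Suc a) b x" "f (P a b x) = P (Suc a) b x" if "x \<in> D" for a b x
    using PP[OF that, of a b 1 0] PP[OF that, of 1 0 a b] P1 by simp_all
  have g1: "P a b (g x) = P a (Suc b) x" "g (P a b x) = P a (Suc b) x" if "x \<in> D" for a b x
    using PP[OF that, of a b 0 1] PP[OF that, of 0 1 a b] P1 by simp_all
  have "f ` G ` D = G ` D \<and> restricts_to_automorphism f (G ` D)"
    by (intro conjI retract_automorphism[OF Gmaps GG Ghol f, of "\<lambda>j. P (\<nu> (Suc j) - 1) (\<mu> (Suc j))"])
      (use Phol Pmaps limS in \<open>simp_all add: f1 pos\<close>)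
  moreover have "g ` G ` D = G ` D \<and> restricts_to_automorphism g (G ` D)"
    by (intro conjI retract_automorphism[OF Gmaps GG Ghol g, of "\<lambda>j. P (\<nu> (Suc j)) (\<mu> (Suc j) - 1)"])
      (use Phol Pmaps limS in \<open>simp_all add: g1 pos\<close>)
  ultimately show ?thesis using that[OF Ghol Gmaps GG] by blast
qed

end

section \<open>Commuting maps\<close>

context hyperbolic_domain
begin

text \<open>A closed \<open>K\<close>-ball is a compact subset of \<open>D\<close>: its complement
  is a neighbourhood of each boundary point, and it is bounded, so a sequence tending to an end
  leaves it.\<close>

lemma leaves_balls:
  assumes p: "p \<in> D" and Q: "compact_exhaustion (closure D) Q"
    and lim: "limitin (end_compactification (closure D) Q) (\<lambda>n. Pt (x n)) \<xi> sequentially" "\<xi> \<notin> Pt ` D"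
    and xD: "\<And>n. x n \<in> D"
  shows "\<forall>\<^sub>F n in sequentially. R < K p (x n)"
proof -
  let ?C = "{z \<in> D. K p z \<le> R}"
  have C: "compact ?C" by (rule K_ball_compact[OF p])
  have "\<forall>\<^sub>F n in sequentially. x n \<notin> ?C"
  proof (cases \<xi>)
    case (Pt a)
    then have "a \<in> - ?C" using lim(2) by auto
    moreover have "x \<longlonglongrightarrow> a" using limitin_Pt lim(1) Pt by blast
    moreover have "open (- ?C)" using compact_imp_closed[OF C] by (simp add: open_Compl)
    ultimately show ?thesis using topological_tendstoD by fastforce
  next
    case (End U)
    have X: "convex (closure D)" "closed (closure D)" using D_convex convex_closure by auto
    obtain B where B: "\<And>z. z \<in> ?C \<Longrightarrow> norm z \<le> B" using compact_imp_bounded[OF C] unfolding bounded_iff by blast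
    have "filterlim (\<lambda>n. norm (x n)) at_top sequentially"
      by (rule limitin_End(3)[OF X Q lim(1)[unfolded End]])
    then have "\<forall>\<^sub>F n in sequentially. B + 1 \<le> norm (x n)" unfolding filterlim_at_top by blast
    then show ?thesis
    proof eventually_elim
      case (elim n)
      then show ?case using B[of "x n"] by auto
    qed
  qed
  then show ?thesis
  proof eventually_elim
    case (elim n)
    then show ?case using xD[of n] by auto
  qed
qed

lemma bounded_commuting_iterates:
  assumes f: "holomorphic_map_on f D" "f ` D \<subseteq> D" and g: "holomorphic_map_on g D" "g ` D \<subseteq> D"
    and comm: "\<And>x. x \<in> D \<Longrightarrow> f (g x) = g (f x)" and p: "p \<in> D"
    and Q: "compact_exhaustion (closure D) Q"
    and lf: "limitin (end_compactification (closure D) Q) (\<lambda>n. Pt ((f ^^ n) p)) \<xi> sequentially" "\<xi> \<notin> Pt ` D"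
    and lg: "limitin (end_compactification (closure D) Q) (\<lambda>n. Pt ((g ^^ n) p)) \<eta> sequentially" "\<eta> \<notin> Pt ` D"
    and ne: "\<xi> \<noteq> \<eta>"
  shows "\<exists>R. \<forall>N. \<exists>n\<ge>N. \<exists>m\<ge>N. K p ((f ^^ n) ((g ^^ m) p)) \<le> R"
proof -
  have fD: "(f ^^ n) x \<in> D" and gD: "(g ^^ n) x \<in> D" if "x \<in> D" for n x
    using holomorphic_map_on_funpow(2)[OF f] holomorphic_map_on_funpow(2)[OF g] that by blast+
  have c2: "(f ^^ n) ((g ^^ m) x) = (g ^^ m) ((f ^^ n) x)" if "x \<in> D" for n m x
    by (rule funpow_commute_on[OF _ f(2) g(2) that]) (rule comm)
  define a where "a = (\<lambda>n. K p ((f ^^ n) p))"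
  define b where "b = (\<lambda>n. K p ((g ^^ n) p))"
  define s where "s = K p (f p)"
  have s: "0 \<le> s" using K_nonneg[OF p fD[OF p, of 1]] by (simp add: s_def)
  have step: "a (Suc n) \<le> a n + s" for n
  proof -
    have "K p ((f ^^ Suc n) p) \<le> K p ((f ^^ n) p) + K ((f ^^ n) p) ((f ^^ n) (f p))"
      using K_tri[OF p fD[OF p] fD[OF p], of "Suc n" n] by (simp add: funpow_swap1)
    moreover have "K ((f ^^ n) p) ((f ^^ n) (f p)) \<le> s"
      unfolding s_def using fD[OF p, of 1] p by (intro K_map holomorphic_map_on_funpow f) auto
    ultimately show ?thesis by (simp add: a_def)
  qed
  have a0: "a 0 = 0" using K_refl[OF p] by (simp add: a_def)
  have alin: "a n \<le> real n * s" for n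
  proof (induction n)
    case (Suc n)
    then show ?case using step[of n] by (simp add: algebra_simps)
  qed (simp add: a0)
  have b0: "0 \<le> b m" for m using K_nonneg[OF p gD[OF p]] by (simp add: b_def)
  have ainf: "\<forall>\<^sub>F n in sequentially. R < a n" for R
    unfolding a_def by (rule leaves_balls[OF p Q lf fD[OF p]])
  have binf: "\<forall>\<^sub>F n in sequentially. R < b n" for R
    unfolding b_def by (rule leaves_balls[OF p Q lg gD[OF p]])
  obtain R N0 where vis: "\<And>n m S. \<lbrakk>n \<ge> N0; m \<ge> N0; seg ((f ^^ n) p) ((g ^^ m) p) S\<rbrakk> \<Longrightarrow> \<exists>u\<in>S. K p u \<le> R"
  proof (rule visibility[OF p Q fD[OF p] lf(1) gD[OF p] lg(1) ne])
    fix R N0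
    assume "\<And>n m S. \<lbrakk>n \<ge> N0; m \<ge> N0; seg ((f ^^ n) p) ((g ^^ m) p) S\<rbrakk> \<Longrightarrow> \<exists>u\<in>S. K p u \<le> R"
    then show thesis by (rule that)
  qed
  have "\<exists>n\<ge>N. \<exists>m\<ge>N. K p ((f ^^ n) ((g ^^ m) p)) \<le> s + 2 * R + 2 * \<delta>" for N
  proof -
    \<comment> \<open>\<open>m\<close> is chosen before \<open>n\<close>, so large that
      \<open>b m\<close> exceeds \<open>N' * s\<close>; then \<open>n\<close> is the first index
      with \<open>b m \<le> a n\<close>. Steps of \<open>a\<close> are at most \<open>s\<close>, so
      \<open>a n\<close> overshoots \<open>b m\<close> by at most \<open>s\<close>, and
      \<open>alin\<close> forces \<open>N' \<le> n\<close>.\<close>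
    define N' where "N' = max N N0"
    obtain M where M: "\<And>m. m \<ge> M \<Longrightarrow> real N' * s < b m"
      using binf unfolding eventually_sequentially by blast
    define m where "m = max M N'"
    have m: "m \<ge> N'" "real N' * s < b m" using M by (auto simp: m_def)
    have "\<exists>n. b m \<le> a n" using ainf[of "b m"] unfolding eventually_sequentially by (meson less_imp_le order_refl)
    define n where "n = (LEAST n. b m \<le> a n)"
    have n: "b m \<le> a n" unfolding n_def by (rule LeastI_ex) fact
    have "N' \<le> n"
    proof (rule ccontr)
      assume "\<not> N' \<le> n"
      then have "real n * s \<le> real N' * s" using s by (intro mult_right_mono) auto
      then show False using alin[of n] n m(2) by linarith
    qed
    have "a n \<le> b m + s"
    proof (cases n)
      case 0
      then show ?thesis using a0 b0[of m] s by simp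
    next
      case (Suc k)
      then have "\<not> b m \<le> a k" unfolding n_def by (metis lessI not_less_Least)
      then show ?thesis using step[of k] Suc by simp
    qed
    then have close: "\<bar>a n - b m\<bar> \<le> s" using n s by simp
    obtain S where S: "seg ((f ^^ n) p) ((g ^^ m) p) S" using geodesic fD gD p by blast
    obtain u where u: "u \<in> S" "K p u \<le> R"
      using vis[OF _ _ S] \<open>N' \<le> n\<close> m(1) by (auto simp: N'_def)
    let ?z = "(f ^^ n) ((g ^^ m) p)"
    have "K ?z p \<le> \<bar>a n - b m\<bar> + 2 * R + 2 * \<delta>"
      unfolding a_def b_def
    proof (rule dist_le_of_seg_meets_ball[OF S u(1) p _ u(2)])
      show "?z \<in> D" using fD gD p by blast
      show "K ?z ((f ^^ n) p) \<le> K p ((g ^^ m) p)"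
        using K_map[OF holomorphic_map_on_funpow[OF f] gD[OF p] p] K_sym by metis
      show "K ?z ((g ^^ m) p) \<le> K p ((f ^^ n) p)"
        unfolding c2[OF p] using K_map[OF holomorphic_map_on_funpow[OF g] fD[OF p] p] K_sym by metis
    qed
    then have "K p ?z \<le> s + 2 * R + 2 * \<delta>" using close K_sym[of p ?z] by simp
    then show ?thesis using \<open>N' \<le> n\<close> m(1) by (intro exI[of _ n] exI[of _ m] conjI) (auto simp: N'_def)
  qed
  then show ?thesis by blast
qed

end

theorem corollary1p12:
  fixes D :: "(complex^'d) set"
    and f g :: "complex^'d \<Rightarrow> complex^'d"
    and K :: "nat \<Rightarrow> (complex^'d) set"
    and p_f p_g :: "(complex^'d) end_pt"
  assumes "complex_proper_convex_domain D"
    and "gromov_hyperbolic D (kobayashi_dist D)"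
    and "holomorphic_map_on f D" and "f ` D \<subseteq> D"
    and "holomorphic_map_on g D" and "g ` D \<subseteq> D"
    and "\<forall>x\<in>D. f (g x) = g (f x)"
    and "\<forall>x\<in>D. f x \<noteq> x" and "\<forall>x\<in>D. g x \<noteq> x"
    and "compact_exhaustion (closure D) K"
    and "denjoy_wolff_point D K f p_f"
    and "denjoy_wolff_point D K g p_g"
  shows "p_f = p_g \<or>
    (\<exists>M k. holomorphic_retract D M \<and> complex_submanifold_of_dim k M \<and>
       1 \<le> k \<and> k \<le> CARD('d) \<and>
       p_f \<in> (end_compactification (closure D) K closure_of (Pt ` M)) - Pt ` M \<and>
       p_g \<in> (end_compactification (closure D) K closure_of (Pt ` M)) - Pt ` M \<and>
       f ` M = M \<and> g ` M = M \<and>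
       restricts_to_automorphism f M \<and> restricts_to_automorphism g M)"
proof (cases "p_f = p_g")
  case False
  let ?T = "end_compactification (closure D) K"
  obtain \<delta> where "hyperbolic_domain D \<delta>" using gromov_hyperbolic_domain[OF assms(1,2)] by blast
  then interpret hyperbolic_domain D \<delta> .
  have pf: "p_f \<in> topspace ?T - Pt ` D" "\<And>x. x \<in> D \<Longrightarrow> limitin ?T (\<lambda>n. Pt ((f ^^ n) x)) p_f sequentially"
    using assms(11) unfolding denjoy_wolff_point_def Let_def by blast+
  have pg: "p_g \<in> topspace ?T - Pt ` D" "\<And>x. x \<in> D \<Longrightarrow> limitin ?T (\<lambda>n. Pt ((g ^^ n) x)) p_g sequentially"
    using assms(12) unfolding denjoy_wolff_point_def Let_def by blast+
  have comm: "f (g x) = g (f x)" if "x \<in> D" for x using assms(7) that by blast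
  obtain p where p: "p \<in> D" using D_nonempty by blast
  obtain R where R: "\<And>N. \<exists>n\<ge>N. \<exists>m\<ge>N. kobayashi_dist D p ((f ^^ n) ((g ^^ m) p)) \<le> R"
    using bounded_commuting_iterates[OF assms(3-6) comm p assms(10) pf(2)[OF p] _ pg(2)[OF p] _ False] pf(1) pg(1)
    by blast
  obtain G where G: "holomorphic_map_on G D" "G ` D \<subseteq> D" "\<And>x. x \<in> D \<Longrightarrow> G (G x) = G x"
    and fM: "f ` G ` D = G ` D" "restricts_to_automorphism f (G ` D)"
    and gM: "g ` G ` D = G ` D" "restricts_to_automorphism g (G ` D)"
    using commuting_retract[OF assms(3-6) comm p R] by blast
  obtain k where k: "complex_submanifold_of_dim k (G ` D)" "k \<le> CARD('d)"
    "k = 0 \<Longrightarrow> \<exists>c. \<forall>x\<in>D. G x = c"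
    using retract_submanifold[OF D_open D_convex D_nonempty G] by blast
  \<comment> \<open>For \<open>k = 0\<close> the retract would be a single point of
    \<open>D\<close>, fixed by \<open>f\<close>.\<close>
  have "k \<noteq> 0"
  proof
    assume "k = 0"
    then obtain c where c: "\<forall>x\<in>D. G x = c" using k(3) by blast
    then have "G ` D = {c}" using p by auto
    then have "f c = c" "c \<in> D" using fM(1) G(2) by auto
    then show False using assms(8) by blast
  qed
  \<comment> \<open>The orbit of \<open>G p\<close> stays in the retract and, like every orbit,
    tends to \<open>q\<close>. The point \<open>q\<close> itself is not in the retract because the
    retract lies in \<open>D\<close>.\<close>
  have closure: "q \<in> ?T closure_of (Pt ` G ` D) - Pt ` G ` D"
    if q: "q \<in> topspace ?T - Pt ` D" "\<And>x. x \<in> D \<Longrightarrow> limitin ?T (\<lambda>n. Pt ((h ^^ n) x)) q sequentially"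
      and h: "h ` G ` D = G ` D" for q h
  proof -
    have it: "(h ^^ n) (G p) \<in> G ` D" for n
      using h p by (induction n) auto
    have "\<exists>y\<in>Pt ` G ` D. y \<in> W" if W: "q \<in> W" "openin ?T W" for W
    proof -
      have "\<forall>\<^sub>F n in sequentially. Pt ((h ^^ n) (G p)) \<in> W"
        using q(2)[of "G p"] G(2) p W unfolding limitin_def by blast
      then obtain n where "Pt ((h ^^ n) (G p)) \<in> W" unfolding eventually_sequentially by blast
      then show ?thesis using it[of n] by blast
    qed
    then have "q \<in> ?T closure_of (Pt ` G ` D)" using q(1) unfolding in_closure_of by blast
    then show ?thesis using q(1) G(2) by blast
  qed
  have "holomorphic_retract D (G ` D)" unfolding holomorphic_retract_def using G by blast
  then show ?thesis
    using k(1,2) \<open>k \<noteq> 0\<close> closure[OF pf fM(1)] closure[OF pg gM(1)] fM gM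
    by (intro disjI2 exI[of _ "G ` D"] exI[of _ k]) simp
qed simp

end
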